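(* Let $\Phi^0=\{\mathcal{F}_j^0\}_{j\in\mathbb{I}_m}$ be a $\mathbf{d}$-design and let $\Theta:\mathcal{D}(\alpha,\mathbf{d})\to\mathbb{R}_{\ge 0}$ be given by $\Theta(\Phi)=\sum_{j\in\mathbb{I}_m}\|S_{\mathcal{F}_j^0}-S_{\mathcal{F}_j}\|_2^2$ for $\Phi=\{\mathcal{F}_j\}_{j\in\mathbb{I}_m}$. For $j\in\mathbb{I}_m$ let $\lambda_j=(\lambda_{i,j})_{i\in\mathbb{I}_{d_j}}=\lambda(S_{\mathcal{F}_j^0})$ be the eigenvalues of $S_{\mathcal{F}_j^0}$ in non-increasing order, let $M=\max_{j\in\mathbb{I}_m}\|S_{\mathcal{F}_j^0}\|$ (operator norm), and let $\delta_j=(\delta_{i,j})_{i\in\mathbb{I}_{d_j}}=M\,\mathbf{1}_{d_j}-\tilde\nu_j\in\mathbb{R}^{d_j}$, where $\tilde\nu_j$ are the optimal spectra described in the context. Then: 1. $\displaystyle\min\{\Theta(\Phi):\Phi\in\mathcal{D}(\alpha,\mathbf{d})\}=\sum_{j\in\mathbb{I}_m}\|\delta_j\|^2$. 2. If $\Phi=\{\mathcal{F}_j\}_{j\in\mathbb{I}_m}\in\mathcal{D}(\alpha,\mathbf{d})$, then $\Theta(\Phi)=\sum_{j\in\mathbb{I}_m}\|\delta_j\|^2$ if and only if $\lambda(S_{\mathcal{F}_j^0}-S_{\mathcal{F}_j})=\delta_j^{\downarrow}$ for every $j\in\mathbb{I}_m$. In this case, for each $j\in\mathbb{I}_m$ there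 exists an orthonormal basis $\{v_{i,j}\}_{i\in\mathbb{I}_{d_j}}$ of $\mathbb{C}^{d_j}$ such that $$S_{\mathcal{F}_j^0}=\sum_{i\in\mathbb{I}_{d_j}}\lambda_{i,j}\,v_{i,j}\otimes v_{i,j}\quad\text{and}\quad S_{\mathcal{F}_j}=\sum_{i\in\mathbb{I}_{d_j}}(\lambda_{i,j}-\delta_{i,j})\,v_{i,j}\otimes v_{i,j}.$$ 3. Local minimizers of $\Theta$ in $\mathcal{D}(\alpha,\mathbf{d})$ are also global minimizers.
   Context: For $n\in\mathbb{N}$, $\mathbb{I}_n=\{1,\dots,n\}$ and $\mathbf{1}_n\in\mathbb{R}^n$ is the all-ones vector. Standing data: $m,n\in\mathbb{N}$; $\mathbf{d}=(d_j)_{j\in\mathbb{I}_m}\in\mathbb{N}^m$ is non-increasing with $d_1\le n$; $\alpha=(\alpha_i)_{i\in\mathbb{I}_n}$ is a non-increasing sequence of strictly positive real numbers. For a finite sequence $\mathcal{F}=\{f_i\}_{i\in\mathbb{I}_k}$ in $\mathbb{C}^d$ its frame operator is the positive semidefinite matrix $S_{\mathcal{F}}=\sum_i f_i\otimes f_i$, where $(x\otimes y)z=\langle z,y\rangle x$. A $\mathbf{d}$-design is a family $\Phi=\{\mathcal{F}_j\}_{j\in\mathbb{I}_m}$ where each $\mathcal{F}_j=\{f_{i,j}\}_{i\in\mathbb{I}_k}$ is a finite sequence in $\mathbb{C}^{d_j}$. An $(\alpha,\mathbf{d})$-design is a $\mathbf{d}$-design with $\mathcal{F}_j=\{f_{i,j}\}_{i\in\mathbb{I}_n}$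 for every $j$ such that $\sum_{j\in\mathbb{I}_m}\|f_{i,j}\|^2=\alpha_i$ for all $i\in\mathbb{I}_n$. The set of all $(\alpha,\mathbf{d})$-designs is $\mathcal{D}(\alpha,\mathbf{d})$, endowed with the metric $m(\Phi,\Phi')=\sum_{j\in\mathbb{I}_m}\big(\sum_{i\in\mathbb{I}_n}\|f_{i,j}-f'_{i,j}\|^2\big)^{1/2}$; local minimizers are understood with respect to this metric. $\|\cdot\|_2$ is the Frobenius norm, $\|A\|_2^2=\operatorname{tr}(A^*A)$; $\|\delta_j\|$ is the Euclidean norm. $\lambda(A)$ is the vector of eigenvalues of a selfadjoint matrix $A$ with multiplicity in non-increasing order; $x^{\downarrow}$ is the non-increasing rearrangement of $x$; $t^+=\max(t,0)$. Majorization: for vectors $x\in\mathbb{R}_{\ge0}^k$, $y\in\mathbb{R}_{\ge 0}^d$ of possibly different lengths, $x\prec y$ means $\sum_{i=1}^{l}x_i^{\downarrow}\le\sum_{i=1}^l y_i^{\downarrow}$ for $1\le l\le\min\{k,d\}$ and $\sum_{i\in\mathbb{I}_k}x_i=\sum_{i\in\mathbb{I}_d}y_i$. The optimal spectra $\tilde\nu_j$. Put $\tilde\lambda_j=M\mathbf{1}_{d_j}-\lambda_j=(\tilde\lambda_{i,j})_{i\in\mathbb{I}_{d_j}}$, which is non-negative and non-decreasing, and is the spectrum of $M I_{d_j}-S_{\mathcal{F}_j^0}$. Let $\mathbf{c}=(c_1\mathbf{1}_{s_1},c_2\mathbf{1}_{s_2},\dots,c_p\mathbf{1}_{s_p})\in\mathbb{R}^{d_1}$,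 with $c_1>c_2>\dots>c_p>0$ and $\sum_{k=1}^p s_k=d_1$ ($s_k\geq 1$), be the unique vector of this form such that, with $i_0=0$ and $i_k=\sum_{l=1}^k s_l$, $$(\alpha_i)_{i=i_{k-1}+1}^{i_k}\prec\Big(\sum_{j:\,i\le d_j}(c_k-\tilde\lambda_{i,j})^+\Big)_{i=i_{k-1}+1}^{i_k}\quad(1\le k\le p-1),$$ $$(\alpha_i)_{i=i_{p-1}+1}^{n}\prec\Big(\sum_{j:\,i\le d_j}(c_p-\tilde\lambda_{i,j})^+\Big)_{i=i_{p-1}+1}^{d_1}.$$ Then $\tilde\nu_j:=\max((\mathbf{c})_{d_j},\tilde\lambda_j)\in\mathbb{R}^{d_j}$ (entrywise maximum), where $(\mathbf{c})_{d_j}$ is the truncation of $\mathbf{c}$ to its first $d_j$ entries. The existence and uniqueness of $\mathbf{c}$, and the following property of the $\tilde\nu_j$, are known results on optimal multi-completions: letting $\Psi(\Phi)=\sum_{j\in\mathbb{I}_m}\operatorname{tr}\big((M I_{d_j}-S_{\mathcal{F}_j^0}+S_{\mathcal{F}_j})^2\big)$ on $\mathcal{D}(\alpha,\mathbf{d})$, a design $\Phi\in\mathcal{D}(\alpha,\mathbf{d})$ is a local minimizer of $\Psi$ if and only if $\lambda(M I_{d_j}-S_{\mathcal{F}_j^0}+S_{\mathcal{F}_j})=\tilde\nu_j^{\downarrow}$ for all $j\in\mathbb{I}_m$, and in this case $\Phi$ is a global minimizer of $\Psi$ and each $S_{\mathcal{F}_j}$ commutes with $M I_{d_j}-S_{\mathcal{F}_j^0}$.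 *)

theory Defs
  imports
    Complex_Main
    "HOL-Library.Multiset"
    "HOL-Computational_Algebra.Polynomial"
    "Jordan_Normal_Form.Char_Poly"
    "Jordan_Normal_Form.Schur_Decomposition"
begin

text \<open>
  All indices are shifted to start at 0: the entry with mathematical index \<open>i\<close> sits at list or
  vector position \<open>i - 1\<close>. Vectors in \<open>C^k\<close> are the elements of \<^term>\<open>carrier_vec k\<close>,
  real vectors are lists, and \<^term>\<open>v \<bullet>c w\<close> is the inner product, linear in \<^term>\<open>v\<close>.
\<close>

definition vnorm :: "complex vec \<Rightarrow> real" where
  "vnorm v = sqrt (Re (v \<bullet>c v))"

text \<open>\<open>outer_prod x y *\<^sub>v z = (z \<bullet>c y) \<cdot>\<^sub>v x\<close>.\<close>

definition outer_prod :: "complex vec \<Rightarrow> complex vec \<Rightarrow> complex mat" where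
  "outer_prod x y = mat (dim_vec x) (dim_vec y) (\<lambda>(k, l). x $ k * cnj (y $ l))"

definition mat_sum :: "nat \<Rightarrow> complex mat list \<Rightarrow> complex mat" where
  "mat_sum k As = foldr (+) As (0\<^sub>m k k)"

definition frame_op :: "nat \<Rightarrow> complex vec list \<Rightarrow> complex mat" where
  "frame_op k fs = mat_sum k (map (\<lambda>f. outer_prod f f) fs)"

definition mat_trace :: "complex mat \<Rightarrow> complex" where
  "mat_trace A = (\<Sum>k<dim_row A. A $$ (k, k))"

definition frobenius_norm :: "complex mat \<Rightarrow> real" where
  "frobenius_norm A = sqrt (Re (mat_trace (mat_adjoint A * A)))"

definition op_norm :: "complex mat \<Rightarrow> real" where
  "op_norm A = Sup {vnorm (A *\<^sub>v v) | v. v \<in> carrier_vec (dim_col A) \<and> vnorm v \<le> 1}"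

definition desc :: "real list \<Rightarrow> real list" where
  "desc xs = rev (sort xs)"

text \<open>
  Only meant for selfadjoint matrices: there the roots of the characteristic polynomial are real,
  so that \<^const>\<open>Re\<close> loses nothing, and algebraic and geometric multiplicities agree.
\<close>

definition eig_desc :: "complex mat \<Rightarrow> real list" where
  "eig_desc A = rev (sorted_list_of_multiset (image_mset Re (proots (char_poly A))))"

definition orthonormal_basis :: "nat \<Rightarrow> complex vec list \<Rightarrow> bool" where
  "orthonormal_basis k vs \<longleftrightarrow>
     length vs = k \<and>
     vectorspace.basis class_ring (module_vec TYPE(complex) k) (set vs) \<and>
     (\<forall>i<k. \<forall>l<k. vs ! i \<bullet>c vs ! l = (if i = l then 1 else 0))"

text \<open>\<open>\<Sum>\<^sub>i \<mu>\<^sub>i v\<^sub>i \<otimes> v\<^sub>i\<close>.\<close>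

definition spectral_sum :: "nat \<Rightarrow> real list \<Rightarrow> complex vec list \<Rightarrow> complex mat" where
  "spectral_sum k \<mu> vs =
     mat_sum k (map (\<lambda>i. complex_of_real (\<mu> ! i) \<cdot>\<^sub>m outer_prod (vs ! i) (vs ! i)) [0..<k])"

definition majorized :: "real list \<Rightarrow> real list \<Rightarrow> bool" where
  "majorized xs ys \<longleftrightarrow>
     (\<forall>l\<in>{1..min (length xs) (length ys)}.
        sum_list (take l (desc xs)) \<le> sum_list (take l (desc ys))) \<and>
     sum_list xs = sum_list ys"

text \<open>
  \<open>\<Phi> ! j ! i\<close> is the vector \<open>f\<^bsub>i,j\<^esub>\<close>; the numbers \<open>m\<close> and \<open>n\<close> are
  \<^term>\<open>length d\<close> and \<^term>\<open>length \<alpha>\<close>.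
\<close>

type_synonym design = "complex vec list list"

definition d_designs :: "nat list \<Rightarrow> design set" where
  "d_designs d =
     {\<Phi>. length \<Phi> = length d \<and> (\<forall>j<length d. set (\<Phi> ! j) \<subseteq> carrier_vec (d ! j))}"

definition ad_designs :: "real list \<Rightarrow> nat list \<Rightarrow> design set" where
  "ad_designs \<alpha> d =
     {\<Phi> \<in> d_designs d.
        (\<forall>j<length d. length (\<Phi> ! j) = length \<alpha>) \<and>
        (\<forall>i<length \<alpha>. (\<Sum>j<length d. (vnorm (\<Phi> ! j ! i))\<^sup>2) = \<alpha> ! i)}"

definition design_dist :: "real list \<Rightarrow> nat list \<Rightarrow> design \<Rightarrow> design \<Rightarrow> real" where
  "design_dist \<alpha> d \<Phi> \<Phi>' =
     (\<Sum>j<length d. sqrt (\<Sum>i<length \<alpha>. (vnorm (\<Phi> ! j ! i - \<Phi>' ! j ! i))\<^sup>2))"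

definition design_op :: "nat list \<Rightarrow> design \<Rightarrow> nat \<Rightarrow> complex mat" where
  "design_op d \<Phi> j = frame_op (d ! j) (\<Phi> ! j)"

definition Theta :: "nat list \<Rightarrow> design \<Rightarrow> design \<Rightarrow> real" where
  "Theta d \<Phi>0 \<Phi> =
     (\<Sum>j<length d. (frobenius_norm (design_op d \<Phi>0 j - design_op d \<Phi> j))\<^sup>2)"

definition global_minimizer :: "real list \<Rightarrow> nat list \<Rightarrow> (design \<Rightarrow> real) \<Rightarrow> design \<Rightarrow> bool" where
  "global_minimizer \<alpha> d F \<Phi> \<longleftrightarrow>
     \<Phi> \<in> ad_designs \<alpha> d \<and> (\<forall>\<Phi>'\<in>ad_designs \<alpha> d. F \<Phi> \<le> F \<Phi>')"

definition local_minimizer :: "real list \<Rightarrow> nat list \<Rightarrow> (design \<Rightarrow> real) \<Rightarrow> design \<Rightarrow> bool" where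
  "local_minimizer \<alpha> d F \<Phi> \<longleftrightarrow>
     \<Phi> \<in> ad_designs \<alpha> d \<and>
     (\<exists>\<epsilon>>0. \<forall>\<Phi>'\<in>ad_designs \<alpha> d. design_dist \<alpha> d \<Phi> \<Phi>' < \<epsilon> \<longrightarrow> F \<Phi> \<le> F \<Phi>')"

definition lam :: "nat list \<Rightarrow> design \<Rightarrow> nat \<Rightarrow> real list" where
  "lam d \<Phi>0 j = eig_desc (design_op d \<Phi>0 j)"

definition Mbound :: "nat list \<Rightarrow> design \<Rightarrow> real" where
  "Mbound d \<Phi>0 = Max ((\<lambda>j. op_norm (design_op d \<Phi>0 j)) ` {..<length d})"

definition lam_tilde :: "nat list \<Rightarrow> design \<Rightarrow> nat \<Rightarrow> real list" where
  "lam_tilde d \<Phi>0 j = map (\<lambda>x. Mbound d \<Phi>0 - x) (lam d \<Phi>0 j)"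

text \<open>\<open>water d \<Phi>0 t i = \<Sum>\<^bsub>j: i \<le> d\<^sub>j\<^esub> (t - lam_tilde\<^bsub>i,j\<^esub>)\<^sup>+\<close>, before the index shift.\<close>

definition water :: "nat list \<Rightarrow> design \<Rightarrow> real \<Rightarrow> nat \<Rightarrow> real" where
  "water d \<Phi>0 t i = (\<Sum>j | j < length d \<and> i < d ! j. max (t - lam_tilde d \<Phi>0 j ! i) 0)"

text \<open>
  \<open>c\<close> is the vector \<open>(c\<^sub>1 1\<^bsub>s\<^sub>1\<^esub>, \<dots>, c\<^sub>p 1\<^bsub>s\<^sub>p\<^esub>)\<close> with \<open>cs = [c\<^sub>1, \<dots>, c\<^sub>p]\<close> and
  \<open>ss = [s\<^sub>1, \<dots>, s\<^sub>p]\<close>. With \<open>b k = s\<^sub>1 + \<dots> + s\<^sub>k\<close>, the block with 0-based number \<open>k\<close> occupies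
  the positions \<open>b k, \<dots>, b (k + 1) - 1\<close>. In the last block the weights \<open>\<alpha>\<close> run up to
  \<open>n\<close>, while the positions of \<open>c\<close> stop at \<open>b p\<close>, the first entry of \<open>d\<close>.
\<close>

definition optimal_constants :: "real list \<Rightarrow> nat list \<Rightarrow> design \<Rightarrow> real list \<Rightarrow> bool" where
  "optimal_constants \<alpha> d \<Phi>0 c \<longleftrightarrow>
     (\<exists>cs ss. let p = length cs; b = (\<lambda>k. sum_list (take k ss)) in
        p \<ge> 1 \<and> length ss = p \<and>
        sorted_wrt (>) cs \<and> (\<forall>x\<in>set cs. x > 0) \<and>
        (\<forall>s\<in>set ss. s \<ge> 1) \<and> sum_list ss = d ! 0 \<and>
        c = concat (map (\<lambda>k. replicate (ss ! k) (cs ! k)) [0..<p]) \<and>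
        (\<forall>k<p - 1. majorized (map (\<lambda>i. \<alpha> ! i) [b k..<b (k + 1)])
                             (map (water d \<Phi>0 (cs ! k)) [b k..<b (k + 1)])) \<and>
        majorized (map (\<lambda>i. \<alpha> ! i) [b (p - 1)..<length \<alpha>])
                  (map (water d \<Phi>0 (cs ! (p - 1))) [b (p - 1)..<d ! 0]))"

definition nu_tilde :: "nat list \<Rightarrow> design \<Rightarrow> real list \<Rightarrow> nat \<Rightarrow> real list" where
  "nu_tilde d \<Phi>0 c j = map (\<lambda>i. max (c ! i) (lam_tilde d \<Phi>0 j ! i)) [0..<d ! j]"

definition delta :: "nat list \<Rightarrow> design \<Rightarrow> real list \<Rightarrow> nat \<Rightarrow> real list" where
  "delta d \<Phi>0 c j = map (\<lambda>x. Mbound d \<Phi>0 - x) (nu_tilde d \<Phi>0 c j)"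

definition delta_sum :: "nat list \<Rightarrow> design \<Rightarrow> real list \<Rightarrow> real" where
  "delta_sum d \<Phi>0 c = (\<Sum>j<length d. (sqrt (\<Sum>x\<leftarrow>delta d \<Phi>0 c j. x\<^sup>2))\<^sup>2)"

end

theory Submission
  imports Defs "HOL-Computational_Algebra.Fundamental_Theorem_Algebra"
begin

text \<open>
  Put \<open>B\<^sub>j = S(F\<^sub>j\<^sup>0)\<close> and \<open>R\<^sub>j = S(F\<^sub>j) - B\<^sub>j\<close>; the bound \<open>M\<close> only shifts all quantities and plays no role.

  At a local minimizer the first order condition says \<open>R\<^sub>j f\<^bsub>i,j\<^esub> = c\<^sub>i f\<^bsub>i,j\<^esub>\<close> for all \<open>j\<close>, so \<open>S(F\<^sub>j)\<close> commutes with
  \<open>R\<^sub>j\<close> and \<open>B\<^sub>j\<close>. Suitable rank two and rank one variations in the second order condition show that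
  \<open>S(F\<^sub>j)\<close> and \<open>B\<^sub>j\<close> have a common eigenbasis in which both spectra decrease, and that the vectors with
  \<open>c\<^sub>i > r\<close> are linearly independent in every block in which \<open>r\<close> is an eigenvalue of \<open>R\<^sub>j\<close>. Counting
  dimensions, the \<open>i\<close>-th eigenvalue \<open>\<mu> - \<kappa>\<close> of \<open>R\<^sub>j\<close> is at least the \<open>i\<close>-th largest \<open>c\<close>, with equality
  if \<open>\<mu> > 0\<close>. These are the Karush-Kuhn-Tucker conditions of the problem of minimizing
  \<open>\<Sum>\<^sub>j \<Sum>\<^sub>i (\<mu>\<^bsub>i,j\<^esub> - \<kappa>\<^bsub>i,j\<^esub>)\<^sup>2\<close> over decreasing \<open>\<mu>\<^sub>j\<close> whose sum over \<open>j\<close> majorizes \<open>\<alpha>\<close>. That problem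
  is strictly convex, and by von Neumann's trace inequality and Ky Fan's inequality its value is a
  lower bound for \<open>\<Theta>\<close>.

  The optimal spectra satisfy the same conditions, with multipliers read off from \<open>c\<close>, and they
  are attained: starting from rescaled eigenvectors, rotations of pairs of vectors adjust the norms
  to \<open>\<alpha>\<close> without changing the frame operators. An optimal design is a local minimizer, so
  its spectra are the unique solution and the common eigenbasis is the required one.
\<close>

section \<open>Weighted sums of sorted sequences\<close>

text \<open>The weight constraint at an index \<open>i\<close> couples all blocks, so its multiplier
  \<open>c i\<close> is common to them, while the second order conditions can be tested inside a
  single block. These conditions leave one degenerate case open: two eigenvalues of S(F_j) may
  coincide although the residual has different eigenvalues there. This would break the comparison of
  the sorted spectra and needs a separate argument. Nothing relates the order of the multipliers of
  a local minimizer to the order of \<open>\<alpha>\<close> in advance. The KKT conditions are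
  therefore stated with an arbitrary permutation \<open>\<pi>\<close> of the weights; Ky Fan's
  inequality holds for every set of indices, so the same lower bound serves local minimizers and the
  constants \<open>c\<close>. The equality case of the trace inequality is never analysed. Strong
  convexity keeps a squared distance of spectra in the lower bound, which settles the spectra of an
  optimal design, and its joint eigenbases come from feeding it back into the analysis of local
  minimizers.\<close>

lemma sum_mult_mono_prefix:
  fixes C u w :: "nat \<Rightarrow> real"
  assumes dec: "\<And>i j. i \<le> j \<Longrightarrow> j < n \<Longrightarrow> C j \<le> C i"
    and pre: "\<And>l. l < n \<Longrightarrow> (\<Sum>i<l. u i) \<le> (\<Sum>i<l. w i)"
    and tot: "(\<Sum>i<n. u i) = (\<Sum>i<n. w i)"
  shows "(\<Sum>i<n. C i * u i) \<le> (\<Sum>i<n. C i * w i)"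
proof (cases n)
  case (Suc N)
  \<comment> \<open>Abel summation by induction: the partial sums of \<open>w - u\<close> are
    non-negative, so the coefficient in front of them may be lowered from \<open>C l\<close> to
    \<open>C (Suc l)\<close>. At the last index the partial sum is zero, so the sign of
    \<open>C\<close> does not enter.\<close>
  have "C l * (\<Sum>i<Suc l. w i - u i) \<le> (\<Sum>i<Suc l. C i * (w i - u i))" if "l < n" for l
    using that
  proof (induction l)
    case (Suc l)
    have "C (Suc l) * (\<Sum>i<Suc l. w i - u i) \<le> C l * (\<Sum>i<Suc l. w i - u i)"
      using pre[OF Suc.prems] dec[of l "Suc l"] Suc.prems
      by (intro mult_right_mono) (simp_all add: sum_subtractf)
    with Suc show ?case by (simp add: algebra_simps)
  qed simp
  moreover have "(\<Sum>i<Suc N. w i - u i) = 0" using tot Suc by (simp only: sum_subtractf)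
  ultimately have "0 \<le> (\<Sum>i<n. C i * (w i - u i))" using Suc by (metis lessI mult_zero_right)
  then show ?thesis by (simp only: right_diff_distrib sum_subtractf)
qed simp

lemma sum_mult_weights_le_prefix:
  fixes \<mu> t :: "nat \<Rightarrow> real"
  assumes dec: "\<And>i j. i \<le> j \<Longrightarrow> j < n \<Longrightarrow> \<mu> j \<le> \<mu> i"
    and t: "\<And>k. k < n \<Longrightarrow> 0 \<le> t k \<and> t k \<le> 1" and l: "l \<le> n"
    and tot: "(\<Sum>k<n. t k) = l \<or> (\<Sum>k<n. t k) \<le> l \<and> (\<forall>k<n. \<mu> k \<ge> 0)"
  shows "(\<Sum>k<n. \<mu> k * t k) \<le> (\<Sum>k<l. \<mu> k)"
proof -
  \<comment> \<open>\<open>m\<close> separates the values: those at indices below \<open>l\<close>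
    are at least \<open>m\<close>, the others at most \<open>m\<close>. Hence replacing
    \<open>\<mu> k\<close> by \<open>m\<close> only increases the sum of the differences to the
    indicator of \<open>{..<l}\<close>. For \<open>l = n\<close> the smallest value serves.\<close>
  define m where "m = (if l < n then \<mu> l else if n = 0 then 0 else \<mu> (n - 1))"
  have ind: "(\<Sum>k<n. g k * (if k < l then 1 else 0)) = (\<Sum>k<l. g k)" for g :: "nat \<Rightarrow> real"
  proof -
    have "{..<n} \<inter> {k. k < l} = {..<l}" using l by auto
    then show ?thesis by (simp add: sum.inter_restrict[symmetric] if_distrib[of "(*) _"] sum.If_cases cong: if_cong)
  qed
  have "(\<Sum>k<n. \<mu> k * (t k - (if k < l then 1 else 0))) \<le> (\<Sum>k<n. m * (t k - (if k < l then 1 else 0)))"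
  proof (rule sum_mono)
    fix k assume "k \<in> {..<n}"
    then have k: "k < n" by simp
    show "\<mu> k * (t k - (if k < l then 1 else 0)) \<le> m * (t k - (if k < l then 1 else 0))"
    proof (cases "k < l")
      case True
      have "m \<le> \<mu> k" unfolding m_def using True k l dec[of k l] dec[of k "n - 1"] by auto
      then show ?thesis using True t[OF k] by (simp add: mult_right_mono_neg)
    next
      case False
      then have "\<mu> k \<le> m" unfolding m_def using k dec[of l k] by auto
      then show ?thesis using False t[OF k] by (simp add: mult_right_mono)
    qed
  qed
  also have "\<dots> = m * ((\<Sum>k<n. t k) - l)"
    using ind[of "\<lambda>_. 1"] by (simp add: sum_distrib_left[symmetric] sum_subtractf)
  also have "\<dots> \<le> 0"
    using tot
  proof
    assume a: "(\<Sum>k<n. t k) \<le> l \<and> (\<forall>k<n. \<mu> k \<ge> 0)"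
    then have "m \<ge> 0" unfolding m_def by auto
    with a show ?thesis by (simp add: mult_le_0_iff)
  qed simp
  finally show ?thesis using ind[of \<mu>] by (simp add: algebra_simps sum_subtractf)
qed

text \<open>Summation by parts in \<open>\<kappa>\<close> takes the place of Birkhoff's theorem: it
  leaves the column sums of the first \<open>p\<close> rows, which are weights between 0 and 1 of
  total \<open>p\<close>. In the application \<open>D\<close> holds the squared moduli of the inner
  products of two orthonormal bases.\<close>

lemma doubly_stochastic_sum_le:
  fixes \<kappa> \<mu> :: "nat \<Rightarrow> real"
  assumes kdec: "\<And>i j. i \<le> j \<Longrightarrow> j < n \<Longrightarrow> \<kappa> j \<le> \<kappa> i"
    and mdec: "\<And>i j. i \<le> j \<Longrightarrow> j < n \<Longrightarrow> \<mu> j \<le> \<mu> i"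
    and D: "\<And>i l. i < n \<Longrightarrow> l < n \<Longrightarrow> 0 \<le> D i l"
    and rows: "\<And>i. i < n \<Longrightarrow> (\<Sum>l<n. D i l) = 1"
    and cols: "\<And>l. l < n \<Longrightarrow> (\<Sum>i<n. D i l) = 1"
  shows "(\<Sum>i<n. \<Sum>l<n. \<kappa> i * \<mu> l * D i l) \<le> (\<Sum>i<n. \<kappa> i * \<mu> i)"
proof -
  have "(\<Sum>i<n. \<Sum>l<n. \<kappa> i * \<mu> l * D i l) = (\<Sum>i<n. \<kappa> i * (\<Sum>l<n. \<mu> l * D i l))"
    by (simp add: sum_distrib_left algebra_simps)
  also have "\<dots> \<le> (\<Sum>i<n. \<kappa> i * \<mu> i)"
  proof (rule sum_mult_mono_prefix[OF kdec])
    fix p assume p: "p < n"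
    have "(\<Sum>i<p. \<Sum>l<n. \<mu> l * D i l) = (\<Sum>l<n. \<mu> l * (\<Sum>i<p. D i l))"
      by (subst sum.swap) (simp add: sum_distrib_left)
    also have "\<dots> \<le> (\<Sum>i<p. \<mu> i)"
    proof (rule sum_mult_weights_le_prefix[OF mdec])
      fix k assume k: "k < n"
      have "(\<Sum>i<p. D i k) \<le> (\<Sum>i<n. D i k)"
        using p D k by (intro sum_mono2) auto
      then show "0 \<le> (\<Sum>i<p. D i k) \<and> (\<Sum>i<p. D i k) \<le> 1"
        using cols[OF k] D p k by (auto intro!: sum_nonneg)
    next
      have "(\<Sum>k<n. \<Sum>i<p. D i k) = (\<Sum>i<p. 1)"
        by (subst sum.swap) (use rows p in auto)
      then show "(\<Sum>k<n. \<Sum>i<p. D i k) = real p \<or> (\<Sum>k<n. \<Sum>i<p. D i k) \<le> real p \<and> (\<forall>k<n. 0 \<le> \<mu> k)"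
        by simp
    qed (use p in auto)
    finally show "(\<Sum>i<p. \<Sum>l<n. \<mu> l * D i l) \<le> (\<Sum>i<p. \<mu> i)" .
  next
    have "(\<Sum>i<n. \<Sum>l<n. \<mu> l * D i l) = (\<Sum>l<n. \<mu> l * (\<Sum>i<n. D i l))"
      by (subst sum.swap) (simp add: sum_distrib_left)
    then show "(\<Sum>i<n. \<Sum>l<n. \<mu> l * D i l) = (\<Sum>i<n. \<mu> i)" using cols by simp
  qed auto
  finally show ?thesis .
qed

lemma ex_sorting_permutation:
  fixes key :: "nat \<Rightarrow> real"
  shows "\<exists>\<pi>. bij_betw \<pi> {..<n} {..<n} \<and> (\<forall>i j. i \<le> j \<longrightarrow> j < n \<longrightarrow> key (\<pi> j) \<le> key (\<pi> i))"
proof -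
  define xs where "xs = sort_key (\<lambda>i. - key i) [0..<n]"
  have len: "length xs = n" and dist: "distinct xs" and set: "set xs = {..<n}"
    unfolding xs_def by auto
  have "sorted (map (\<lambda>i. - key i) xs)" by (simp add: xs_def)
  then have "key (xs ! j) \<le> key (xs ! i)" if "i \<le> j" "j < n" for i j
    using sorted_nth_mono[of _ i j] that len by fastforce
  moreover have "bij_betw ((!) xs) {..<n} {..<n}"
    by (rule bij_betw_nth[OF dist]) (simp_all only: len set)
  ultimately show ?thesis by blast
qed

section \<open>Linear algebra in coordinates\<close>

text \<open>Gaussian elimination: an equation with a nonzero coefficient at \<open>b0\<close>
  determines \<open>x b0\<close> from the other unknowns, which costs one equation and one unknown.
  The dimension counts for coordinate vectors below rest on this lemma.\<close>

lemma underdetermined_system: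
  fixes E :: "'e \<Rightarrow> 'b \<Rightarrow> 'c :: field"
  assumes "finite I" "finite K" "card I < card K"
  shows "\<exists>x. (\<exists>b\<in>K. x b \<noteq> 0) \<and> (\<forall>e\<in>I. (\<Sum>b\<in>K. E e b * x b) = 0)"
  using assms
proof (induction I arbitrary: K E rule: finite_induct)
  case empty
  then have "K \<noteq> {}" by auto
  then show ?case by (intro exI[of _ "\<lambda>_. 1"]) auto
next
  case (insert e0 I)
  show ?case
  proof (cases "\<forall>b\<in>K. E e0 b = 0")
    case True
    have "card I < card K" using insert by simp
    from insert.IH[OF insert.prems(1) this, of E] True show ?thesis by auto
  next
    case False
    then obtain b0 where b0: "b0 \<in> K" "E e0 b0 \<noteq> 0" by auto
    \<comment> \<open>\<open>E'\<close> is the system that remains after \<open>b0\<close> has been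
      eliminated by means of the equation \<open>e0\<close>.\<close>
    define E' where "E' e b = E e b - E e b0 * E e0 b / E e0 b0" for e b
    have "card I < card (K - {b0})" using insert b0 by simp
    from insert.IH[OF _ this, of E'] insert.prems obtain x
      where x: "\<exists>b\<in>K - {b0}. x b \<noteq> 0" "\<forall>e\<in>I. (\<Sum>b\<in>K - {b0}. E' e b * x b) = 0" by auto
    define y where "y = x(b0 := - (\<Sum>b\<in>K - {b0}. E e0 b * x b) / E e0 b0)"
    have sum_y: "(\<Sum>b\<in>K. E e b * y b) = E e b0 * y b0 + (\<Sum>b\<in>K - {b0}. E e b * x b)" for e
      using b0 insert.prems by (subst sum.remove[of _ b0]) (auto simp: y_def intro!: sum.cong)
    have "(\<Sum>b\<in>K. E e0 b * y b) = 0" unfolding sum_y using b0 by (simp add: y_def)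
    moreover have "(\<Sum>b\<in>K. E e b * y b) = 0" if "e \<in> I" for e
    proof -
      have "0 = (\<Sum>b\<in>K - {b0}. E' e b * x b)" using x(2) that by simp
      also have "\<dots> = (\<Sum>b\<in>K - {b0}. E e b * x b - E e b0 / E e0 b0 * (E e0 b * x b))"
        by (simp add: E'_def left_diff_distrib mult.assoc)
      also have "\<dots> = (\<Sum>b\<in>K - {b0}. E e b * x b) - (\<Sum>b\<in>K - {b0}. E e b0 / E e0 b0 * (E e0 b * x b))"
        by (rule sum_subtractf)
      also have "\<dots> = (\<Sum>b\<in>K - {b0}. E e b * x b) + E e b0 * y b0"
        by (simp add: y_def sum_distrib_left sum_divide_distrib)
      finally show ?thesis unfolding sum_y by (simp add: add.commute)
    qed
    moreover have "\<exists>b\<in>K. y b \<noteq> 0" using x(1) by (auto simp: y_def)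
    ultimately show ?thesis by (intro exI[of _ y]) auto
  qed
qed

lemma sum_kronecker:
  fixes c :: "nat \<Rightarrow> 'a :: semiring_1"
  assumes "l < k"
  shows "(\<Sum>i<k. c i * (if i = l then 1 else 0)) = c l"
    and "(\<Sum>i<k. (if i = l then 1 else 0) * c i) = c l"
    and "(\<Sum>i<k. c i * (if l = i then 1 else 0)) = c l"
    and "(\<Sum>i<k. (if l = i then 1 else 0) * c i) = c l"
  using assms by (simp_all add: if_distrib[of "\<lambda>x. _ * x"] if_distrib[of "\<lambda>x. x * _"] cong: if_cong)

text \<open>Only the values at indices below the dimension matter, and the dimension is an argument
  of each notion. Blocks of different sizes thus share one type, and vectors are added and scaled
  pointwise without carrier conditions; in return, equations are stated only for indices below
  \<open>k\<close>.\<close>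

type_synonym cvec = "nat \<Rightarrow> complex"
type_synonym cmat = "nat \<Rightarrow> cvec"
type_synonym cfam = "nat \<Rightarrow> cmat"

definition ip :: "nat \<Rightarrow> cvec \<Rightarrow> cvec \<Rightarrow> complex" where
  "ip k u v = (\<Sum>a<k. u a * cnj (v a))"

definition mv :: "nat \<Rightarrow> cmat \<Rightarrow> cvec \<Rightarrow> cvec" where
  "mv k A x a = (\<Sum>b<k. A a b * x b)"

definition hermitian_on :: "nat \<Rightarrow> cmat \<Rightarrow> bool" where
  "hermitian_on k A \<longleftrightarrow> (\<forall>a<k. \<forall>b<k. A a b = cnj (A b a))"

definition onb :: "nat \<Rightarrow> cmat \<Rightarrow> bool" where
  "onb k v \<longleftrightarrow> (\<forall>i<k. \<forall>l<k. ip k (v i) (v l) = (if i = l then 1 else 0))"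

definition eigvec_on :: "nat \<Rightarrow> cmat \<Rightarrow> complex \<Rightarrow> cvec \<Rightarrow> bool" where
  "eigvec_on k A r x \<longleftrightarrow> (\<forall>a<k. mv k A x a = r * x a)"

definition spec :: "nat \<Rightarrow> (nat \<Rightarrow> real) \<Rightarrow> cmat \<Rightarrow> cmat" where
  "spec k \<mu> v a b = (\<Sum>i<k. of_real (\<mu> i) * v i a * cnj (v i b))"

lemma spec_cong: "(\<And>i. i < k \<Longrightarrow> \<mu> i = \<mu>' i) \<Longrightarrow> spec k \<mu> w a b = spec k \<mu>' w a b"
  by (simp add: spec_def)

lemma ip_cong: "(\<And>a. a < k \<Longrightarrow> u a = u' a) \<Longrightarrow> (\<And>a. a < k \<Longrightarrow> v a = v' a) \<Longrightarrow> ip k u v = ip k u' v'"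
  by (simp add: ip_def)

lemma ip_cnj: "cnj (ip k u v) = ip k v u"
  by (simp add: ip_def mult.commute)

lemma ip_add_left: "ip k (\<lambda>a. u a + v a) w = ip k u w + ip k v w"
  and ip_diff_left: "ip k (\<lambda>a. u a - v a) w = ip k u w - ip k v w"
  and ip_scale_left: "ip k (\<lambda>a. c * u a) w = c * ip k u w"
  by (simp_all add: ip_def ring_distribs sum.distrib sum_subtractf sum_distrib_left mult.assoc)

lemma ip_sum_left: "ip k (\<lambda>a. \<Sum>i\<in>I. f i a) w = (\<Sum>i\<in>I. ip k (f i) w)"
  unfolding ip_def sum_distrib_right by (rule sum.swap)

lemma ip_add_right: "ip k w (\<lambda>a. u a + v a) = ip k w u + ip k w v"
  and ip_diff_right: "ip k w (\<lambda>a. u a - v a) = ip k w u - ip k w v"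
  and ip_scale_right: "ip k w (\<lambda>a. c * u a) = cnj c * ip k w u"
  by (simp_all add: ip_def ring_distribs sum.distrib sum_subtractf sum_distrib_left mult_ac)

lemma ip_sum_right: "ip k w (\<lambda>a. \<Sum>i\<in>I. f i a) = (\<Sum>i\<in>I. ip k w (f i))"
  unfolding ip_def cnj_sum sum_distrib_left by (rule sum.swap)

lemmas ip_linear = ip_add_left ip_diff_left ip_scale_left ip_sum_left
  ip_add_right ip_diff_right ip_scale_right ip_sum_right

lemma ip_self: "ip k u u = of_real (\<Sum>a<k. (cmod (u a))\<^sup>2)"
  by (simp add: ip_def complex_norm_square[symmetric])

lemma ip_self_eq_0_iff: "ip k u u = 0 \<longleftrightarrow> (\<forall>a<k. u a = 0)"
  by (simp only: ip_self of_real_eq_0_iff) (subst sum_nonneg_eq_0_iff, auto)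

lemma ip_mv:
  assumes "hermitian_on k A"
  shows "ip k (mv k A x) y = ip k x (mv k A y)"
proof -
  have "ip k (mv k A x) y = (\<Sum>b<k. \<Sum>a<k. A a b * x b * cnj (y a))"
    unfolding ip_def mv_def sum_distrib_right by (rule sum.swap)
  also have "\<dots> = (\<Sum>b<k. \<Sum>a<k. x b * cnj (A b a * y a))"
  proof (intro sum.cong refl)
    fix a b assume "b \<in> {..<k}" "a \<in> {..<k}"
    then have "A a b = cnj (A b a)" using assms unfolding hermitian_on_def by blast
    then show "A a b * x b * cnj (y a) = x b * cnj (A b a * y a)" by simp
  qed
  finally show ?thesis by (simp add: ip_def mv_def sum_distrib_left)
qed

text \<open>The \<open>k\<close> basis vectors and \<open>x\<close> satisfy a nontrivial linear
  relation. Inner products with the \<open>v l\<close> express every coefficient as a multiple of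
  that of \<open>x\<close>, which therefore cannot vanish.\<close>

lemma onb_expand:
  assumes v: "onb k v" and a: "a < k"
  shows "x a = (\<Sum>i<k. ip k x (v i) * v i a)"
proof -
  define E where "E a i = (if i < k then v i a else x a)" for a i
  from underdetermined_system[of "{..<k}" "{..k}" E] obtain c
    where c: "\<exists>i\<le>k. c i \<noteq> 0" "\<And>a. a < k \<Longrightarrow> (\<Sum>i\<le>k. E a i * c i) = 0" by auto
  have rel: "(\<Sum>i<k. c i * v i a) = - c k * x a" if "a < k" for a
  proof -
    have "(\<Sum>i<k. c i * v i a) = (\<Sum>i<k. E a i * c i)"
      by (intro sum.cong) (auto simp: E_def)
    moreover have "(\<Sum>i<k. E a i * c i) + x a * c k = 0"
      using c(2)[OF that] by (simp only: lessThan_Suc_atMost[symmetric]) (simp add: E_def)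
    ultimately show ?thesis by (simp add: eq_neg_iff_add_eq_0 mult.commute)
  qed
  have coef: "c l = - c k * ip k x (v l)" if l: "l < k" for l
  proof -
    have "- c k * ip k x (v l) = ip k (\<lambda>a. \<Sum>i<k. c i * v i a) (v l)"
      unfolding ip_scale_left[symmetric] by (rule ip_cong) (auto simp: rel)
    also have "\<dots> = (\<Sum>i<k. c i * (if i = l then 1 else 0))"
      using v l by (simp add: ip_linear onb_def)
    also have "\<dots> = c l" using l by (rule sum_kronecker)
    finally show ?thesis by simp
  qed
  have "c k \<noteq> 0" using c(1) coef by (metis le_neq_implies_less mult_eq_0_iff neg_equal_0_iff_equal)
  moreover have "- c k * x a = - c k * (\<Sum>i<k. ip k x (v i) * v i a)"
    using rel[OF a] coef by (simp add: sum_distrib_left sum_negf mult_ac)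
  ultimately show ?thesis by simp
qed

lemma onb_resolution:
  assumes "onb k v" "a < k" "b < k"
  shows "(\<Sum>i<k. v i a * cnj (v i b)) = (if a = b then 1 else 0)"
proof -
  have "ip k (\<lambda>a. if a = b then 1 else 0) (v i) = cnj (v i b)" for i
    using assms(3) by (simp add: ip_def sum_kronecker)
  with onb_expand[OF assms(1,2), of "\<lambda>a. if a = b then 1 else 0"] show ?thesis
    by (simp add: mult.commute)
qed

lemma parseval:
  assumes v: "onb k v"
  shows "ip k x y = (\<Sum>i<k. ip k x (v i) * cnj (ip k y (v i)))"
proof -
  have "ip k x y = ip k (\<lambda>a. \<Sum>i<k. ip k x (v i) * v i a) y"
    by (rule ip_cong) (auto intro: onb_expand[OF v])
  then show ?thesis by (simp add: ip_linear ip_cnj)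
qed

lemma spec_of_eigenbasis:
  assumes v: "onb k v" and eig: "\<And>i. i < k \<Longrightarrow> eigvec_on k A (of_real (\<mu> i)) (v i)"
    and "a < k" "b < k"
  shows "A a b = spec k \<mu> v a b"
proof -
  have "A a b = (\<Sum>c<k. A a c * (if c = b then 1 else 0))" using \<open>b < k\<close> by (simp add: sum_kronecker)
  also have "\<dots> = (\<Sum>c<k. A a c * (\<Sum>i<k. v i c * cnj (v i b)))"
    using onb_resolution[OF v _ \<open>b < k\<close>] by simp
  also have "\<dots> = (\<Sum>i<k. mv k A (v i) a * cnj (v i b))"
    unfolding mv_def sum_distrib_left sum_distrib_right
    by (subst sum.swap) (simp add: mult.assoc)
  also have "\<dots> = spec k \<mu> v a b"
    using eig \<open>a < k\<close> by (simp add: spec_def eigvec_on_def)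
  finally show ?thesis .
qed

lemma eigvec_spec:
  assumes v: "onb k v" and A: "\<And>a b. a < k \<Longrightarrow> b < k \<Longrightarrow> A a b = spec k \<mu> v a b" and i: "i < k"
  shows "eigvec_on k A (of_real (\<mu> i)) (v i)"
  unfolding eigvec_on_def
proof (intro allI impI)
  fix a assume a: "a < k"
  have "mv k A (v i) a = (\<Sum>l<k. of_real (\<mu> l) * v l a * ip k (v i) (v l))"
    unfolding mv_def using A[OF a]
    by (simp add: spec_def ip_def sum_distrib_left sum_distrib_right mult_ac) (rule sum.swap)
  also have "\<dots> = (\<Sum>l<k. if l = i then of_real (\<mu> l) * v l a else 0)"
    using v i by (intro sum.cong) (auto simp: onb_def)
  finally show "mv k A (v i) a = of_real (\<mu> i) * v i a" using i by simp
qed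

section \<open>Eigenvectors in invariant subspaces and the joint spectral theorem\<close>

definition subspace_on :: "cvec set \<Rightarrow> bool" where
  "subspace_on W \<longleftrightarrow> (\<forall>x\<in>W. \<forall>y\<in>W. \<forall>p q. (\<lambda>a. p * x a + q * y a) \<in> W)"

lemma subspace_on_sum:
  assumes W: "subspace_on W" and "finite I" "I \<noteq> {}" "\<And>i. i \<in> I \<Longrightarrow> f i \<in> W"
  shows "(\<lambda>a. \<Sum>i\<in>I. c i * f i a) \<in> W"
  using assms(2-)
proof (induction rule: finite_ne_induct)
  case (singleton i)
  then have "(\<lambda>a. c i * f i a + 0 * f i a) \<in> W"
    using W[unfolded subspace_on_def] by blast
  then show ?case by simp
next
  case (insert i I)
  then have "(\<lambda>a. c i * f i a + 1 * (\<Sum>i\<in>I. c i * f i a)) \<in> W"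
    using W[unfolded subspace_on_def, THEN bspec[of _ _ "f i"], THEN bspec[of _ _ "\<lambda>a. \<Sum>i\<in>I. c i * f i a"]]
    by blast
  with insert show ?case by simp
qed

lemma mv_sum: "mv k A (\<lambda>a. \<Sum>i\<in>I. c i * f i a) a = (\<Sum>i\<in>I. c i * mv k A (f i) a)"
  by (simp add: mv_def sum_distrib_left mult_ac) (subst sum.swap, simp add: mult_ac)

text \<open>The eigenvector is \<open>q(A) w\<close>, where \<open>(X - r) q\<close> has least degree among the nonzero
  polynomials that annihilate some nonzero vector of the subspace.\<close>

lemma ex_eigvec_in_subspace:
  assumes W: "subspace_on W" and inv: "\<And>x. x \<in> W \<Longrightarrow> mv k A x \<in> W"
    and ne: "x0 \<in> W" "\<exists>a<k. x0 a \<noteq> 0"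
  shows "\<exists>r x. x \<in> W \<and> (\<exists>a<k. x a \<noteq> 0) \<and> eigvec_on k A r x"
proof -
  define it where "it w e = (mv k A ^^ e) w" for w e
  have it_in: "it w e \<in> W" if "w \<in> W" for w e
    using that by (induction e) (auto simp: it_def inv)
  define ev where "ev p w = (\<lambda>a. \<Sum>e\<le>k. coeff p e * it w e a)" for p w
  have ev_in: "ev p w \<in> W" if "w \<in> W" for p w
    unfolding ev_def using it_in[OF that] by (intro subspace_on_sum[OF W]) auto
  define Q where "Q p \<longleftrightarrow> p \<noteq> 0 \<and> degree p \<le> k \<and>
    (\<exists>w\<in>W. (\<exists>a<k. w a \<noteq> 0) \<and> (\<forall>a<k. ev p w a = 0))" for p
  have "\<exists>p. Q p"
  proof -
    \<comment> \<open>The \<open>k + 1\<close> iterates of \<open>x0\<close> are dependent in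
      \<open>k\<close> coordinates, which yields an annihilating polynomial of degree at most
      \<open>k\<close>.\<close>
    from underdetermined_system[of "{..<k}" "{..k}" "\<lambda>a e. it x0 e a"] obtain c
      where c: "\<exists>i\<le>k. c i \<noteq> 0" "\<And>a. a < k \<Longrightarrow> (\<Sum>i\<le>k. it x0 i a * c i) = 0" by auto
    define p where "p = (\<Sum>e\<le>k. monom (c e) e)"
    have cp: "coeff p e = (if e \<le> k then c e else 0)" for e
      by (simp add: p_def coeff_sum)
    have "p \<noteq> 0" using c(1) cp by (metis coeff_0)
    moreover have "degree p \<le> k" by (rule degree_le) (simp add: cp)
    moreover have "ev p x0 a = 0" if "a < k" for a
      using c(2)[OF that] by (simp add: ev_def cp mult.commute)
    ultimately show ?thesis using ne by (auto simp: Q_def)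
  qed
  then obtain p where p: "Q p" and min: "\<And>q. Q q \<Longrightarrow> degree p \<le> degree q"
    using ex_has_least_nat[of Q _ degree] by blast
  then obtain w where w: "w \<in> W" "\<exists>a<k. w a \<noteq> 0" "\<And>a. a < k \<Longrightarrow> ev p w a = 0"
    and p0: "p \<noteq> 0" "degree p \<le> k" by (auto simp: Q_def)
  have "degree p \<noteq> 0"
  proof
    assume d: "degree p = 0"
    have "ev p w a = (\<Sum>e\<le>k. if e = 0 then coeff p 0 * w a else 0)" for a
      unfolding ev_def using d by (intro sum.cong) (auto simp: it_def coeff_eq_0)
    then have "coeff p 0 * w a = 0" if "a < k" for a using w(3)[OF that] by simp
    moreover have "coeff p 0 \<noteq> 0" using d p0 by (metis leading_coeff_0_iff)
    ultimately show False using w(2) by auto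
  qed
  then obtain r where "poly p r = 0"
    using fundamental_theorem_of_algebra[of p] by (auto simp: constant_degree)
  then obtain q where q: "p = [:- r, 1:] * q" by (metis poly_eq_0_iff_dvd dvdE)
  with p0 have q0: "q \<noteq> 0" by auto
  have dq: "degree p = Suc (degree q)" unfolding q using q0 by (subst degree_mult_eq) auto
  have cq: "coeff p e = (case e of 0 \<Rightarrow> 0 | Suc e' \<Rightarrow> coeff q e') - r * coeff q e" for e
    unfolding q by (simp add: coeff_pCons split: nat.split)
  have key: "mv k A (ev q w) a - r * ev q w a = ev p w a" for a
  proof -
    have "mv k A (ev q w) a = (\<Sum>e\<le>k. coeff q e * it w (Suc e) a)"
      by (simp add: ev_def mv_sum it_def)
    \<comment> \<open>The degree of \<open>q\<close> is below \<open>k\<close>, so the top term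
      vanishes and the index shift stays inside the range of \<open>ev\<close>.\<close>
    also have "\<dots> = (\<Sum>e<k. coeff q e * it w (Suc e) a)"
      using dq p0 by (simp add: lessThan_Suc_atMost[symmetric] coeff_eq_0)
    also have "\<dots> = (\<Sum>e\<le>k. (case e of 0 \<Rightarrow> 0 | Suc e' \<Rightarrow> coeff q e') * it w e a)"
      by (simp only: lessThan_Suc_atMost[symmetric] sum.lessThan_Suc_shift) simp
    finally show ?thesis
      by (simp add: ev_def cq sum_distrib_left left_diff_distrib sum_subtractf mult.assoc)
  qed
  have "\<not> Q q" using min[of q] dq by auto
  then have "\<exists>a<k. ev q w a \<noteq> 0" using q0 dq p0 w by (auto simp: Q_def)
  moreover have "eigvec_on k A r (ev q w)"
    using key w(3) by (auto simp: eigvec_on_def algebra_simps)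
  ultimately show ?thesis using ev_in[OF w(1)] by blast
qed

lemma hermitian_eigval_real:
  assumes "hermitian_on k A" "eigvec_on k A r x" "\<exists>a<k. x a \<noteq> 0"
  shows "r = of_real (Re r)"
proof -
  have "r * ip k x x = ip k (mv k A x) x"
    unfolding ip_scale_left[symmetric] using assms(2) by (intro ip_cong) (auto simp: eigvec_on_def)
  also have "\<dots> = ip k x (\<lambda>a. r * x a)"
    unfolding ip_mv[OF assms(1)] using assms(2) by (intro ip_cong) (auto simp: eigvec_on_def)
  also have "\<dots> = cnj r * ip k x x" by (simp add: ip_linear)
  finally have "r = cnj r" using assms(3) ip_self_eq_0_iff[of k x] by auto
  then show ?thesis by (simp add: complex_eq_iff)
qed

text \<open>The orthogonal complement \<open>W\<close> of the vectors found so far is invariant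
  under both matrices. The part \<open>W1\<close> of an eigenspace of \<open>A\<close> inside
  \<open>W\<close> is invariant under \<open>S\<close> because the matrices commute, so an
  eigenvector of \<open>S\<close> in \<open>W1\<close> extends the system. The case
  \<open>A = S\<close> gives the spectral theorem.\<close>

lemma ex_joint_eigenbasis:
  assumes A: "hermitian_on k A" and S: "hermitian_on k S"
    and comm: "\<And>a b. a < k \<Longrightarrow> b < k \<Longrightarrow> (\<Sum>c<k. A a c * S c b) = (\<Sum>c<k. S a c * A c b)"
  shows "\<exists>v r s. onb k v \<and> (\<forall>i<k. eigvec_on k A (of_real (r i :: real)) (v i)
            \<and> eigvec_on k S (of_real (s i :: real)) (v i))"
proof -
  have "\<exists>v r s. (\<forall>i<l. \<forall>i'<l. ip k (v i) (v i') = (if i = i' then 1 else 0)) \<and>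
     (\<forall>i<l. eigvec_on k A (of_real (r i :: real)) (v i) \<and> eigvec_on k S (of_real (s i :: real)) (v i))"
    if "l \<le> k" for l
    using that
  proof (induction l)
    case (Suc l)
    then have "l \<le> k" by simp
    from Suc.IH[OF this] obtain v r s where
      orth: "\<forall>i<l. \<forall>i'<l. ip k (v i) (v i') = (if i = i' then 1 else 0)" and
      e: "\<forall>i<l. eigvec_on k A (of_real (r i :: real)) (v i) \<and>
        eigvec_on k S (of_real (s i :: real)) (v i)" by blast
    from e have
      eA: "\<And>i. i < l \<Longrightarrow> eigvec_on k A (of_real (r i :: real)) (v i)" and
      eS: "\<And>i. i < l \<Longrightarrow> eigvec_on k S (of_real (s i :: real)) (v i)" by blast+
    define W where "W = {x. \<forall>i<l. ip k x (v i) = 0}"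
    have W: "subspace_on W" by (auto simp: subspace_on_def W_def ip_linear)
    have inv: "mv k C x \<in> W" if C: "hermitian_on k C" and
        e: "\<And>i. i < l \<Longrightarrow> eigvec_on k C (of_real (t i :: real)) (v i)" and x: "x \<in> W" for C t x
    proof -
      have "ip k (mv k C x) (v i) = 0" if i: "i < l" for i
      proof -
        have "ip k (mv k C x) (v i) = ip k x (\<lambda>a. of_real (t i) * v i a)"
          unfolding ip_mv[OF C] using e[OF i] by (intro ip_cong) (auto simp: eigvec_on_def)
        then show ?thesis using x i by (simp add: ip_linear W_def)
      qed
      then show ?thesis by (simp add: W_def)
    qed
    \<comment> \<open>Fewer than \<open>k\<close> orthogonality conditions leave a nonzero vector in
      \<open>W\<close>.\<close>
    from underdetermined_system[of "{..<l}" "{..<k}" "\<lambda>i b. cnj (v i b)"] Suc.prems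
    obtain x0 where "\<exists>a<k. x0 a \<noteq> 0" "x0 \<in> W"
      by (auto simp: W_def ip_def mult.commute)
    with ex_eigvec_in_subspace[OF W inv[OF A eA]]
    obtain ra x1 where x1: "x1 \<in> W" "\<exists>a<k. x1 a \<noteq> 0" "eigvec_on k A ra x1" by metis
    define W1 where "W1 = {x \<in> W. eigvec_on k A ra x}"
    have "mv k A (\<lambda>a. p * x a + q * y a) a = p * mv k A x a + q * mv k A y a" for p q x y a
      by (simp add: mv_def ring_distribs sum.distrib sum_distrib_left mult_ac)
    then have W1: "subspace_on W1"
      using W by (auto simp: W1_def subspace_on_def eigvec_on_def ring_distribs mult_ac)
    have comm': "mv k A (mv k S x) a = mv k S (mv k A x) a" if "a < k" for x a
    proof -
      have "mv k A (mv k S x) a = (\<Sum>b<k. (\<Sum>c<k. A a c * S c b) * x b)"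
        unfolding mv_def sum_distrib_left sum_distrib_right by (subst sum.swap) (simp add: mult.assoc)
      also have "\<dots> = (\<Sum>b<k. (\<Sum>c<k. S a c * A c b) * x b)" using comm that by simp
      also have "\<dots> = mv k S (mv k A x) a"
        unfolding mv_def sum_distrib_left sum_distrib_right by (subst sum.swap) (simp add: mult.assoc)
      finally show ?thesis .
    qed
    have inv1: "mv k S x \<in> W1" if "x \<in> W1" for x
    proof -
      have "mv k S (mv k A x) a = mv k S (\<lambda>a. ra * x a) a" for a
        using that unfolding mv_def[of k S] by (simp add: W1_def eigvec_on_def)
      then have "mv k A (mv k S x) a = ra * mv k S x a" if "a < k" for a
        using comm'[OF that] by (simp add: mv_def sum_distrib_left mult_ac)
      then show ?thesis using that inv[OF S eS] by (simp add: W1_def eigvec_on_def)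
    qed
    from ex_eigvec_in_subspace[OF W1 inv1, of x1] x1
    obtain rs x where x: "x \<in> W" "\<exists>a<k. x a \<noteq> 0" "eigvec_on k A ra x" "eigvec_on k S rs x"
      by (auto simp: W1_def)
    define N where "N = sqrt (\<Sum>a<k. (cmod (x a))\<^sup>2)"
    have N2: "ip k x x = of_real (N\<^sup>2)"
      unfolding N_def ip_self by (simp add: sum_nonneg)
    then have N0: "N \<noteq> 0" using x(2) ip_self_eq_0_iff[of k x] by auto
    define y where "y = (\<lambda>a. of_real (1 / N) * x a)"
    have ey: "eigvec_on k C t y" if "eigvec_on k C t x" for C t
      using that unfolding eigvec_on_def y_def mv_def
      by (simp add: sum_divide_distrib[symmetric])
    have "ip k y y = 1" using N0 unfolding y_def ip_linear N2 by (simp add: power2_eq_square)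
    moreover have "ip k y (v i) = 0" "ip k (v i) y = 0" if "i < l" for i
    proof -
      show *: "ip k y (v i) = 0" using x(1) that unfolding y_def ip_linear by (simp add: W_def)
      show "ip k (v i) y = 0" using ip_cnj[of k y "v i"] * by simp
    qed
    moreover have "ra = of_real (Re ra)" "rs = of_real (Re rs)"
      using hermitian_eigval_real A S x by blast+
    ultimately show ?case
      using orth eA eS ey[OF x(3)] ey[OF x(4)]
      by (intro exI[of _ "v(l := y)"] exI[of _ "r(l := Re ra)"] exI[of _ "s(l := Re rs)"])
         (auto simp: less_Suc_eq)
  qed (auto intro!: exI)
  from this[of k] show ?thesis by (auto simp: onb_def)
qed

lemma ex_spectral_decomposition:
  assumes A: "hermitian_on k A"
  shows "\<exists>v r. onb k v \<and> (\<forall>i j. i \<le> j \<longrightarrow> j < k \<longrightarrow> r j \<le> r i) \<and>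
     (\<forall>a<k. \<forall>b<k. A a b = spec k r v a b)"
proof -
  obtain v r where v: "onb k v" and e: "\<And>i. i < k \<Longrightarrow> eigvec_on k A (of_real (r i :: real)) (v i)"
    using ex_joint_eigenbasis[OF A A] by auto
  obtain \<pi> where \<pi>: "bij_betw \<pi> {..<k} {..<k}" and dec: "\<And>i j. i \<le> j \<Longrightarrow> j < k \<Longrightarrow> r (\<pi> j) \<le> r (\<pi> i)"
    using ex_sorting_permutation[of k r] by blast
  have lt: "\<pi> i < k" if "i < k" for i using \<pi> that by (auto simp: bij_betw_def)
  have inj: "\<pi> i = \<pi> j \<longleftrightarrow> i = j" if "i < k" "j < k" for i j
    using \<pi> that by (auto simp: bij_betw_def inj_on_def)
  have "onb k (v \<circ> \<pi>)" using v lt inj by (auto simp: onb_def)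
  moreover from spec_of_eigenbasis[OF this, of A "r \<circ> \<pi>"] e[OF lt]
  have "A a b = spec k (r \<circ> \<pi>) (v \<circ> \<pi>) a b" if "a < k" "b < k" for a b
    using that by simp
  ultimately show ?thesis using dec by (intro exI[of _ "v \<circ> \<pi>"] exI[of _ "r \<circ> \<pi>"]) auto
qed

section \<open>First and second order conditions at a local minimum\<close>

text \<open>A quadratic polynomial with a uniform cubic error takes the place of derivatives, so
  that sums, squared moduli and quotients only need algebra with explicit bounds. \<open>h2\<close>
  is the coefficient of the square, half a second derivative.\<close>

definition taylor2 :: "(real \<Rightarrow> 'a :: real_normed_vector) \<Rightarrow> 'a \<Rightarrow> 'a \<Rightarrow> 'a \<Rightarrow> bool" where
  "taylor2 h h0 h1 h2 \<longleftrightarrow>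
     (\<exists>K\<ge>0. \<forall>t. \<bar>t\<bar> \<le> 1 \<longrightarrow> norm (h t - (h0 + t *\<^sub>R h1 + t\<^sup>2 *\<^sub>R h2)) \<le> K * \<bar>t\<bar> ^ 3)"

lemma taylor2_const: "taylor2 (\<lambda>_. c) c 0 0"
  by (auto simp: taylor2_def)

lemma taylor2_add:
  assumes "taylor2 h h0 h1 h2" "taylor2 g g0 g1 g2"
  shows "taylor2 (\<lambda>t. h t + g t) (h0 + g0) (h1 + g1) (h2 + g2)"
proof -
  obtain K L where K: "K \<ge> 0" "\<And>t. \<bar>t\<bar> \<le> 1 \<Longrightarrow> norm (h t - (h0 + t *\<^sub>R h1 + t\<^sup>2 *\<^sub>R h2)) \<le> K * \<bar>t\<bar> ^ 3"
    and L: "L \<ge> 0" "\<And>t. \<bar>t\<bar> \<le> 1 \<Longrightarrow> norm (g t - (g0 + t *\<^sub>R g1 + t\<^sup>2 *\<^sub>R g2)) \<le> L * \<bar>t\<bar> ^ 3"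
    using assms unfolding taylor2_def by blast
  have "norm (h t + g t - (h0 + g0 + t *\<^sub>R (h1 + g1) + t\<^sup>2 *\<^sub>R (h2 + g2))) \<le> (K + L) * \<bar>t\<bar> ^ 3"
    if "\<bar>t\<bar> \<le> 1" for t
  proof -
    have eq: "h t + g t - (h0 + g0 + t *\<^sub>R (h1 + g1) + t\<^sup>2 *\<^sub>R (h2 + g2)) =
      (h t - (h0 + t *\<^sub>R h1 + t\<^sup>2 *\<^sub>R h2)) + (g t - (g0 + t *\<^sub>R g1 + t\<^sup>2 *\<^sub>R g2))"
      by (simp add: algebra_simps)
    show ?thesis
      unfolding eq distrib_right by (rule norm_triangle_mono[OF K(2)[OF that] L(2)[OF that]])
  qed
  with K(1) L(1) show ?thesis unfolding taylor2_def by (intro exI[of _ "K + L"]) auto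
qed

lemma taylor2_sum:
  assumes "\<And>i. i \<in> I \<Longrightarrow> taylor2 (h i) (h0 i) (h1 i) (h2 i)"
  shows "taylor2 (\<lambda>t. \<Sum>i\<in>I. h i t) (\<Sum>i\<in>I. h0 i) (\<Sum>i\<in>I. h1 i) (\<Sum>i\<in>I. h2 i)"
  using assms
  by (induction I rule: infinite_finite_induct) (auto intro: taylor2_const[of 0, simplified] taylor2_add)

lemma taylor2_diff_const:
  assumes "taylor2 h h0 h1 h2"
  shows "taylor2 (\<lambda>t. h t - c) (h0 - c) h1 h2"
  using taylor2_add[OF assms taylor2_const[of "- c"]] by simp

lemma taylor2_cmod_square:
  assumes "taylor2 e e0 e1 e2"
  shows "taylor2 (\<lambda>t. (cmod (e t))\<^sup>2) ((cmod e0)\<^sup>2) (2 * Re (e0 * cnj e1))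
    ((cmod e1)\<^sup>2 + 2 * Re (e0 * cnj e2))"
proof -
  obtain K where K: "K \<ge> 0" "\<And>t. \<bar>t\<bar> \<le> 1 \<Longrightarrow> cmod (e t - (e0 + t *\<^sub>R e1 + t\<^sup>2 *\<^sub>R e2)) \<le> K * \<bar>t\<bar> ^ 3"
    using assms unfolding taylor2_def by blast
  define P where "P = cmod e0 + cmod e1 + cmod e2"
  \<comment> \<open>The first summand bounds the effect of replacing \<open>e t\<close> by its
    quadratic part \<open>p\<close>, through the factorization of a difference of squares. The
    second bounds the terms of order 3 and 4 in the squared modulus of \<open>p\<close>.\<close>
  define C where "C = K * (2 * P + K) + (2 * (cmod e1 * cmod e2) + (cmod e2)\<^sup>2)"
  have "\<bar>(cmod (e t))\<^sup>2 - ((cmod e0)\<^sup>2 + t * (2 * Re (e0 * cnj e1)) + t\<^sup>2 * ((cmod e1)\<^sup>2 + 2 * Re (e0 * cnj e2)))\<bar>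
     \<le> C * \<bar>t\<bar> ^ 3" if t: "\<bar>t\<bar> \<le> 1" for t
  proof -
    define p where "p = e0 + t *\<^sub>R e1 + t\<^sup>2 *\<^sub>R e2"
    have t2: "t\<^sup>2 \<le> 1" using t by (simp add: abs_square_le_1)
    have t3: "\<bar>t\<bar> ^ 3 \<le> 1" using t by (simp add: power_le_one)
    have "cmod p \<le> cmod e0 + cmod (t *\<^sub>R e1) + cmod (t\<^sup>2 *\<^sub>R e2)"
      unfolding p_def by (intro norm_triangle_le add_mono norm_triangle_ineq order_refl)
    also have "\<dots> \<le> P" unfolding P_def
      using mult_right_mono[OF t norm_ge_zero[of e1]] mult_right_mono[OF t2 norm_ge_zero[of e2]] by simp
    finally have pP: "cmod p \<le> P" .
    have ep: "cmod (e t - p) \<le> K * \<bar>t\<bar> ^ 3" using K(2)[OF t] by (simp add: p_def)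
    also have "\<dots> \<le> K" using mult_left_mono[OF t3 K(1)] by simp
    finally have eK: "cmod (e t - p) \<le> K" .
    have "cmod (e t) + cmod p \<le> 2 * P + K"
      using norm_triangle_ineq[of "e t - p" p] pP eK by simp
    moreover have "\<bar>cmod (e t) - cmod p\<bar> \<le> K * \<bar>t\<bar> ^ 3"
      using norm_triangle_ineq3[of "e t" p] ep by linarith
    ultimately have "\<bar>cmod (e t) - cmod p\<bar> * (cmod (e t) + cmod p) \<le> K * \<bar>t\<bar> ^ 3 * (2 * P + K)"
      using K(1) by (intro mult_mono) auto
    then have 1: "\<bar>(cmod (e t))\<^sup>2 - (cmod p)\<^sup>2\<bar> \<le> K * (2 * P + K) * \<bar>t\<bar> ^ 3"
      by (simp add: power2_eq_square square_diff_square_factored abs_mult mult_ac)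
    have "(cmod p)\<^sup>2 - ((cmod e0)\<^sup>2 + t * (2 * Re (e0 * cnj e1)) + t\<^sup>2 * ((cmod e1)\<^sup>2 + 2 * Re (e0 * cnj e2)))
       = t ^ 3 * (2 * Re (e1 * cnj e2) + t * (cmod e2)\<^sup>2)"
      unfolding p_def cmod_power2 by (simp add: power2_eq_square power3_eq_cube algebra_simps)
    moreover have "\<bar>t ^ 3 * (2 * Re (e1 * cnj e2) + t * (cmod e2)\<^sup>2)\<bar>
       \<le> \<bar>t\<bar> ^ 3 * (2 * (cmod e1 * cmod e2) + (cmod e2)\<^sup>2)"
    proof -
      have "\<bar>Re (e1 * cnj e2)\<bar> \<le> cmod e1 * cmod e2"
        using abs_Re_le_cmod[of "e1 * cnj e2"] by (simp add: norm_mult)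
      moreover have "\<bar>t * (cmod e2)\<^sup>2\<bar> \<le> (cmod e2)\<^sup>2"
        using mult_right_mono[OF t, of "(cmod e2)\<^sup>2"] by (simp add: abs_mult)
      ultimately have "\<bar>2 * Re (e1 * cnj e2) + t * (cmod e2)\<^sup>2\<bar> \<le> 2 * (cmod e1 * cmod e2) + (cmod e2)\<^sup>2"
        by linarith
      then show ?thesis by (simp add: abs_mult power_abs mult_left_mono)
    qed
    ultimately have 2: "\<bar>(cmod p)\<^sup>2 - ((cmod e0)\<^sup>2 + t * (2 * Re (e0 * cnj e1)) + t\<^sup>2 * ((cmod e1)\<^sup>2 + 2 * Re (e0 * cnj e2)))\<bar>
      \<le> (2 * (cmod e1 * cmod e2) + (cmod e2)\<^sup>2) * \<bar>t\<bar> ^ 3" by (simp add: mult.commute)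
    show ?thesis unfolding C_def distrib_right[of "K * (2 * P + K)"] using 1 2 by linarith
  qed
  moreover have "C \<ge> 0" unfolding C_def P_def using K(1) by auto
  ultimately show ?thesis unfolding taylor2_def by (intro exI[of _ C]) auto
qed

lemma taylor2_local_min:
  fixes h :: "real \<Rightarrow> real"
  assumes h: "taylor2 h h0 h1 h2" and min: "\<forall>\<^sub>F t in at 0. h0 \<le> h t"
  shows "h1 = 0" and "h2 \<ge> 0"
proof -
  obtain K where K: "K \<ge> 0" "\<And>t. \<bar>t\<bar> \<le> 1 \<Longrightarrow> \<bar>h t - (h0 + t * h1 + t\<^sup>2 * h2)\<bar> \<le> K * \<bar>t\<bar> ^ 3"
    using h unfolding taylor2_def by auto
  obtain \<epsilon> where \<epsilon>: "\<epsilon> > 0" "\<And>t. t \<noteq> 0 \<Longrightarrow> \<bar>t\<bar> < \<epsilon> \<Longrightarrow> h0 \<le> h t"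
    using min unfolding eventually_at by (auto simp: dist_real_def)
  define \<eta> where "\<eta> = min 1 \<epsilon>"
  have \<eta>: "\<eta> > 0" using \<epsilon> by (simp add: \<eta>_def)
  have key: "0 \<le> t * h1 + t\<^sup>2 * h2 + K * \<bar>t\<bar> ^ 3" if "t \<noteq> 0" "\<bar>t\<bar> < \<eta>" for t
    using \<epsilon>(2)[of t] K(2)[of t] that by (simp add: \<eta>_def)
  have small: "x \<le> 0" if "\<And>s. 0 < s \<Longrightarrow> s < \<eta> \<Longrightarrow> x \<le> s * C" for x C :: real
  proof (rule tendsto_lowerbound)
    show "((\<lambda>s. s * C) \<longlongrightarrow> 0) (at_right 0)" by (auto intro!: tendsto_eq_intros)
    show "\<forall>\<^sub>F s in at_right 0. x \<le> s * C"
      using that eventually_at_right_real[OF \<eta>] by (auto elim: eventually_mono)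
  qed simp
  have "\<bar>h1\<bar> \<le> 0"
  proof (rule small)
    fix s assume s: "0 < s" "s < \<eta>"
    have "s < 1" using s by (simp add: \<eta>_def)
    \<comment> \<open>Of \<open>t = s\<close> and \<open>t = - s\<close>, the sign is taken that
      makes \<open>t * h1\<close> equal to \<open>- (s * \<bar>h1\<bar>)\<close>.\<close>
    have "0 \<le> - (s * \<bar>h1\<bar>) + s\<^sup>2 * h2 + K * s ^ 3"
      using key[of s] key[of "- s"] s by (cases "h1 > 0") auto
    then have "s * \<bar>h1\<bar> \<le> s * (s * (h2 + K * s))"
      by (simp add: power2_eq_square power3_eq_cube algebra_simps)
    then have "\<bar>h1\<bar> \<le> s * (h2 + K * s)" using s by simp
    also have "\<dots> \<le> s * (h2 + K)"
      using s \<open>s < 1\<close> K(1) by (intro mult_left_mono) (auto simp: mult_left_le)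
    finally show "\<bar>h1\<bar> \<le> s * (h2 + K)" .
  qed
  then show h1: "h1 = 0" by simp
  have "- h2 \<le> 0"
  proof (rule small)
    fix s assume s: "0 < s" "s < \<eta>"
    have "0 \<le> s\<^sup>2 * (h2 + s * K)"
      using key[of s] s h1 by (simp add: power2_eq_square power3_eq_cube algebra_simps)
    then show "- h2 \<le> s * K" using s by (simp add: zero_le_mult_iff)
  qed
  then show "h2 \<ge> 0" by simp
qed

text \<open>This is an entry of the outer product of a vector moving on a line and rescaled to
  constant norm. The denominator contributes the factor \<open>1 - t^2 * c\<close> up to fourth
  order, whence the correction in the quadratic coefficient.\<close>

lemma taylor2_normalized_product:
  fixes x y u w :: complex
  assumes "c \<ge> 0"
  shows "taylor2 (\<lambda>t. (x + of_real t * y) * cnj (u + of_real t * w) / of_real (1 + t\<^sup>2 * c))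
    (x * cnj u) (x * cnj w + y * cnj u) (y * cnj w - of_real c * (x * cnj u))"
proof -
  define p0 p1 p2 where "p0 = x * cnj u" and "p1 = x * cnj w + y * cnj u" and "p2 = y * cnj w"
  define C where "C = c * cmod p1 + c * cmod p2 + c\<^sup>2 * (cmod p0 + cmod p1 + cmod p2)"
  have "cmod ((x + of_real t * y) * cnj (u + of_real t * w) / of_real (1 + t\<^sup>2 * c)
      - (p0 + t *\<^sub>R p1 + t\<^sup>2 *\<^sub>R (p2 - of_real c * p0))) \<le> C * \<bar>t\<bar> ^ 3"
    if t: "\<bar>t\<bar> \<le> 1" for t
  proof -
    define P where "P = p0 + t *\<^sub>R p1 + t\<^sup>2 *\<^sub>R p2"
    define \<rho> where "\<rho> = 1 / (1 + t\<^sup>2 * c)"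
    have pos: "1 + t\<^sup>2 * c > 0" using assms by (simp add: add_pos_nonneg)
    have \<rho>: "0 \<le> \<rho>" "\<rho> \<le> 1" using assms pos by (simp_all add: \<rho>_def divide_le_eq)
    have P: "(x + of_real t * y) * cnj (u + of_real t * w) = P"
      by (simp add: P_def p0_def p1_def p2_def scaleR_conv_of_real algebra_simps power2_eq_square)
    have t2: "t\<^sup>2 \<le> 1" using t by (simp add: abs_square_le_1)
    have "cmod P \<le> cmod p0 + cmod (t *\<^sub>R p1) + cmod (t\<^sup>2 *\<^sub>R p2)"
      unfolding P_def by (intro norm_triangle_le add_mono norm_triangle_ineq order_refl)
    also have "\<dots> \<le> cmod p0 + cmod p1 + cmod p2"
      using mult_right_mono[OF t norm_ge_zero[of p1]] mult_right_mono[OF t2 norm_ge_zero[of p2]] by simp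
    finally have Pb: "cmod P \<le> cmod p0 + cmod p1 + cmod p2" .
    \<comment> \<open>\<open>z\<close> collects all terms beyond second order, divided by
      \<open>t ^ 3\<close>; its last summand comes from the exact identity
      \<open>\<rho> = 1 - t^2 * c + t^4 * c^2 * \<rho>\<close>.\<close>
    define z where "z = - (c *\<^sub>R p1) - t *\<^sub>R c *\<^sub>R p2 + (t * c\<^sup>2 * \<rho>) *\<^sub>R P"
    have "1 = \<rho> + t\<^sup>2 * c * \<rho>" using pos by (simp add: \<rho>_def field_simps)
    then have "\<rho> = 1 - t\<^sup>2 * c * (1 - t\<^sup>2 * c * \<rho>)" by (metis add_diff_cancel_right')
    then have "\<rho> = 1 - t\<^sup>2 * c + t ^ 4 * c\<^sup>2 * \<rho>"
      by (simp add: right_diff_distrib power2_eq_square power4_eq_xxxx mult_ac)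
    then have "\<rho> *\<^sub>R P = (1 - t\<^sup>2 * c + t ^ 4 * c\<^sup>2 * \<rho>) *\<^sub>R P" by simp
    also have "\<dots> = p0 + t *\<^sub>R p1 + t\<^sup>2 *\<^sub>R (p2 - of_real c * p0) + t ^ 3 *\<^sub>R z"
    proof -
      have "(1 - t\<^sup>2 * c) *\<^sub>R P = p0 + t *\<^sub>R p1 + t\<^sup>2 *\<^sub>R (p2 - of_real c * p0)
          + t ^ 3 *\<^sub>R (- (c *\<^sub>R p1) - t *\<^sub>R c *\<^sub>R p2)"
        unfolding P_def by (simp add: scaleR_conv_of_real algebra_simps power2_eq_square power3_eq_cube)
      moreover have "t ^ 4 * c\<^sup>2 * \<rho> = t ^ 3 * (t * c\<^sup>2 * \<rho>)"
        by (simp add: power2_eq_square power3_eq_cube power4_eq_xxxx)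
      ultimately show ?thesis unfolding z_def scaleR_add_left scaleR_add_right by simp
    qed
    finally have "(x + of_real t * y) * cnj (u + of_real t * w) / of_real (1 + t\<^sup>2 * c)
      - (p0 + t *\<^sub>R p1 + t\<^sup>2 *\<^sub>R (p2 - of_real c * p0)) = t ^ 3 *\<^sub>R z"
      unfolding P by (simp add: \<rho>_def scaleR_conv_of_real)
    moreover have "cmod z \<le> C"
    proof -
      have "cmod z \<le> cmod (c *\<^sub>R p1) + cmod (t *\<^sub>R c *\<^sub>R p2) + cmod ((t * c\<^sup>2 * \<rho>) *\<^sub>R P)"
        unfolding z_def
        by (intro norm_triangle_le add_mono order_refl) (metis norm_minus_cancel norm_triangle_ineq4)
      also have "cmod (c *\<^sub>R p1) = c * cmod p1" using assms by simp
      also have "cmod (t *\<^sub>R c *\<^sub>R p2) \<le> c * cmod p2"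
        using assms mult_right_mono[OF t, of "c * cmod p2"] by (simp add: abs_mult mult.assoc)
      also have "cmod ((t * c\<^sup>2 * \<rho>) *\<^sub>R P) \<le> c\<^sup>2 * (cmod p0 + cmod p1 + cmod p2)"
      proof -
        have "\<bar>t\<bar> * \<rho> \<le> 1" using t \<rho> by (simp add: mult_le_one)
        then have "(\<bar>t\<bar> * \<rho>) * (c\<^sup>2 * cmod P) \<le> 1 * (c\<^sup>2 * (cmod p0 + cmod p1 + cmod p2))"
          using \<rho> Pb by (intro mult_mono mult_left_mono) auto
        then show ?thesis using \<rho> by (simp add: abs_mult mult_ac)
      qed
      finally show ?thesis by (simp add: C_def)
    qed
    ultimately show ?thesis
      by (simp add: power_abs mult.commute[of C] mult_left_mono)
  qed
  moreover have "C \<ge> 0" using assms by (simp add: C_def)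
  ultimately show ?thesis unfolding taylor2_def p0_def p1_def p2_def by (intro exI[of _ C]) auto
qed

section \<open>Families of vectors under norm constraints and their variations\<close>

definition frm :: "nat \<Rightarrow> cmat \<Rightarrow> cmat" where
  "frm n F a b = (\<Sum>i<n. F i a * cnj (F i b))"

lemma frm_hermitian: "hermitian_on k (frm n F)"
  by (simp add: hermitian_on_def frm_def mult.commute)

lemma Re_ip_commute: "Re (ip k u v) = Re (ip k v u)"
  using ip_cnj[of k u v] by (metis cnj.simps(1))

text \<open>The Frobenius inner product with a rank one matrix is a value of the sesquilinear form
  of \<open>A\<close>. This turns the derivatives of \<open>dev\<close> into inner products with the
  residual.\<close>

lemma sum_entries_eq_ip:
  "(\<Sum>a<k. \<Sum>b<k. A a b * cnj (u a * cnj (w b))) = ip k (mv k A w) u"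
  by (simp add: ip_def mv_def sum_distrib_left sum_distrib_right mult_ac)

locale design_space =
  fixes m n :: nat and d :: "nat \<Rightarrow> nat" and \<alpha> :: "nat \<Rightarrow> real"
    and B :: cfam
  assumes B_hermitian: "j < m \<Longrightarrow> hermitian_on (d j) (B j)"
    and \<alpha>_pos: "i < n \<Longrightarrow> \<alpha> i > 0"
begin

definition weight :: "cfam \<Rightarrow> nat \<Rightarrow> real" where
  "weight f i = (\<Sum>j<m. Re (ip (d j) (f j i) (f j i)))"

definition admissible :: "cfam \<Rightarrow> bool" where
  "admissible f \<longleftrightarrow> (\<forall>i<n. weight f i = \<alpha> i)"

definition dev :: "cfam \<Rightarrow> real" where
  "dev f = (\<Sum>j<m. \<Sum>a<d j. \<Sum>b<d j. (cmod (frm n (f j) a b - B j a b))\<^sup>2)"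

text \<open>A uniform bound on the entries stands in for the metric on designs; in the translation
  to matrices it is shown to make the design distance small.\<close>

definition close :: "real \<Rightarrow> cfam \<Rightarrow> cfam \<Rightarrow> bool" where
  "close \<epsilon> f g \<longleftrightarrow> (\<forall>j<m. \<forall>i<n. \<forall>a<d j. cmod (g j i a - f j i a) < \<epsilon>)"

definition locmin :: "cfam \<Rightarrow> bool" where
  "locmin f \<longleftrightarrow> admissible f \<and> (\<exists>\<epsilon>>0. \<forall>g. admissible g \<longrightarrow> close \<epsilon> f g \<longrightarrow> dev f \<le> dev g)"

definition res :: "cfam \<Rightarrow> cfam" where
  "res f j a b = frm n (f j) a b - B j a b"

abbreviation R :: "cfam \<Rightarrow> nat \<Rightarrow> cvec \<Rightarrow> cvec" where
  "R f j \<equiv> mv (d j) (res f j)"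

lemma res_hermitian:
  assumes "j < m"
  shows "hermitian_on (d j) (res f j)"
  using B_hermitian[OF assms] frm_hermitian[of "d j" n "f j"]
  unfolding hermitian_on_def res_def by (metis complex_cnj_diff)

lemma weight_nonneg: "weight f i \<ge> 0"
  by (auto simp: weight_def ip_self intro!: sum_nonneg)

lemma eventually_close:
  assumes "\<And>j i a. ((\<lambda>t. F t j i a) \<longlongrightarrow> f j i a) (at (0::real))" "\<epsilon> > 0"
  shows "\<forall>\<^sub>F t in at 0. close \<epsilon> f (F t)"
proof -
  have "\<forall>\<^sub>F t in at 0. cmod (F t j i a - f j i a) < \<epsilon>" for j i a
    using tendstoD[OF assms(1) assms(2)] by (simp add: dist_norm)
  then have "\<forall>\<^sub>F t in at 0. \<forall>j\<in>{..<m}. \<forall>i\<in>{..<n}. \<forall>a\<in>{..<d j}. cmod (F t j i a - f j i a) < \<epsilon>"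
    by (intro eventually_ball_finite ballI) auto
  then show ?thesis by (simp add: close_def Ball_def)
qed

text \<open>The test curve follows \<open>f + t g\<close> and rescales each index to its prescribed
  weight. In the second order condition the first sum is the squared Frobenius norm of the
  derivative of the frame operators; the rest pairs the residual with their second order term,
  including the loss from rescaling.\<close>

lemma locmin_conditions:
  assumes f: "locmin f" and g: "\<And>i. i < n \<Longrightarrow> (\<Sum>j<m. Re (ip (d j) (f j i) (g j i))) = 0"
  shows "(\<Sum>j<m. \<Sum>i<n. Re (ip (d j) (R f j (f j i)) (g j i))) = 0" (is ?first)
    and "0 \<le> (\<Sum>j<m. \<Sum>a<d j. \<Sum>b<d j.
          (cmod (\<Sum>i<n. f j i a * cnj (g j i b) + g j i a * cnj (f j i b)))\<^sup>2)
      + 2 * (\<Sum>j<m. \<Sum>i<n. Re (ip (d j) (R f j (g j i)) (g j i))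
            - weight g i / \<alpha> i * Re (ip (d j) (R f j (f j i)) (f j i)))" (is ?second)
proof -
  define c where "c i = weight g i / \<alpha> i" for i
  have c: "c i \<ge> 0" if "i < n" for i using weight_nonneg \<alpha>_pos[OF that] by (simp add: c_def)
  \<comment> \<open>By the hypothesis on \<open>g\<close>, the weight of \<open>f + t g\<close> at
    \<open>i\<close> is \<open>\<alpha> i + t^2 * weight g i\<close>, that is
    \<open>\<alpha> i * (1 + t^2 * c i)\<close>. This denominator therefore keeps the curve
    admissible.\<close>
  define F where "F t j i a = (f j i a + of_real t * g j i a) / of_real (sqrt (1 + t\<^sup>2 * c i))" for t j i a
  have adm: "admissible f" using f by (simp add: locmin_def)
  have pos: "1 + t\<^sup>2 * c i > 0" if "i < n" for t i using c[OF that] by (simp add: add_pos_nonneg)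
  have sq: "F t j i a * cnj (F t j i b) = (f j i a + of_real t * g j i a) * cnj (f j i b + of_real t * g j i b)
     / of_real (1 + t\<^sup>2 * c i)" if "i < n" for t j i a b
    using pos[OF that, of t] by (simp add: F_def of_real_mult[symmetric] del: of_real_mult)
  have admF: "admissible (F t)" for t
    unfolding admissible_def
  proof (intro allI impI)
    fix i assume i: "i < n"
    have "Re (ip (d j) (F t j i) (F t j i)) = (Re (ip (d j) (f j i) (f j i)) + 2 * t * Re (ip (d j) (f j i) (g j i))
      + t\<^sup>2 * Re (ip (d j) (g j i) (g j i))) / (1 + t\<^sup>2 * c i)" for j
    proof -
      have "ip (d j) (F t j i) (F t j i)
        = ip (d j) (\<lambda>a. f j i a + of_real t * g j i a) (\<lambda>a. f j i a + of_real t * g j i a) / of_real (1 + t\<^sup>2 * c i)"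
        unfolding ip_def sq[OF i] sum_divide_distrib ..
      moreover have "Re (ip (d j) (g j i) (f j i)) = Re (ip (d j) (f j i) (g j i))"
        by (rule Re_ip_commute)
      ultimately show ?thesis by (simp only: Re_divide_of_real) (simp add: ip_linear algebra_simps power2_eq_square)
    qed
    then have "weight (F t) i = (weight f i + t\<^sup>2 * weight g i) / (1 + t\<^sup>2 * c i)"
      using g[OF i] by (simp add: weight_def sum_divide_distrib[symmetric] sum.distrib sum_distrib_left[symmetric])
    also have "\<dots> = \<alpha> i" using adm pos[OF i, of t] \<alpha>_pos[OF i] i by (simp add: c_def admissible_def field_simps)
    finally show "weight (F t) i = \<alpha> i" .
  qed
  have lim: "((\<lambda>t. F t j i a) \<longlongrightarrow> f j i a) (at 0)" for j i a
    unfolding F_def by (auto intro!: tendsto_eq_intros)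
  obtain \<epsilon> where \<epsilon>: "\<epsilon> > 0" and min: "\<And>g. admissible g \<Longrightarrow> close \<epsilon> f g \<Longrightarrow> dev f \<le> dev g"
    using f by (auto simp: locmin_def)
  have ev: "\<forall>\<^sub>F t in at 0. dev f \<le> dev (F t)"
    by (rule eventually_mono[OF eventually_close[of F f, OF lim \<epsilon>] min[OF admF]])
  define X Y where "X j a b = (\<Sum>i<n. f j i a * cnj (g j i b) + g j i a * cnj (f j i b))"
    and "Y j a b = (\<Sum>i<n. g j i a * cnj (g j i b) - of_real (c i) * (f j i a * cnj (f j i b)))" for j a b
  have "taylor2 (\<lambda>t. frm n (F t j) a b) (frm n (f j) a b) (X j a b) (Y j a b)" for j a b
    unfolding frm_def X_def Y_def
  proof (intro taylor2_sum, goal_cases)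
    case (1 i)
    then have i: "i < n" by simp
    show ?case unfolding sq[OF i] by (rule taylor2_normalized_product[OF c[OF i]])
  qed
  then have "taylor2 (\<lambda>t. (cmod (frm n (F t j) a b - B j a b))\<^sup>2) ((cmod (res f j a b))\<^sup>2)
      (2 * Re (res f j a b * cnj (X j a b))) ((cmod (X j a b))\<^sup>2 + 2 * Re (res f j a b * cnj (Y j a b)))" for j a b
    unfolding res_def by (intro taylor2_cmod_square taylor2_diff_const)
  then have tay: "taylor2 (\<lambda>t. dev (F t)) (dev f)
      (\<Sum>j<m. \<Sum>a<d j. \<Sum>b<d j. 2 * Re (res f j a b * cnj (X j a b)))
      (\<Sum>j<m. \<Sum>a<d j. \<Sum>b<d j. (cmod (X j a b))\<^sup>2 + 2 * Re (res f j a b * cnj (Y j a b)))"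
    unfolding dev_def res_def[symmetric] by (intro taylor2_sum)
  have X: "(\<Sum>a<d j. \<Sum>b<d j. Re (res f j a b * cnj (X j a b)))
     = 2 * (\<Sum>i<n. Re (ip (d j) (R f j (f j i)) (g j i)))" if "j < m" for j
  proof -
    let ?u = "\<lambda>i. ip (d j) (R f j (g j i)) (f j i)" and ?w = "\<lambda>i. ip (d j) (R f j (f j i)) (g j i)"
      and ?X = "\<Sum>a<d j. \<Sum>b<d j. res f j a b * cnj (X j a b)"
    have "?X = (\<Sum>i<n.
       (\<Sum>a<d j. \<Sum>b<d j. res f j a b * cnj (f j i a * cnj (g j i b)))
       + (\<Sum>a<d j. \<Sum>b<d j. res f j a b * cnj (g j i a * cnj (f j i b))))"
      unfolding X_def cnj_sum sum_distrib_left sum.distrib[symmetric] complex_cnj_add distrib_left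
      by (subst sum.swap[of _ "{..<n}"])+ rule
    also have "\<dots> = (\<Sum>i<n. ?u i + ?w i)"
      unfolding sum_entries_eq_ip ..
    finally have "Re ?X = Re (\<Sum>i<n. ?u i + ?w i)" by (rule arg_cong)
    then have "(\<Sum>a<d j. \<Sum>b<d j. Re (res f j a b * cnj (X j a b)))
      = (\<Sum>i<n. Re (?u i) + Re (?w i))"
      by (simp only: Re_sum plus_complex.sel)
    moreover have "Re (?u i) = Re (?w i)" for i
      unfolding ip_mv[OF res_hermitian[OF that], of f "g j i"] by (rule Re_ip_commute)
    ultimately show ?thesis by (simp add: sum_distrib_left)
  qed
  have Y: "(\<Sum>a<d j. \<Sum>b<d j. Re (res f j a b * cnj (Y j a b)))
     = (\<Sum>i<n. Re (ip (d j) (R f j (g j i)) (g j i))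
            - c i * Re (ip (d j) (R f j (f j i)) (f j i)))" for j
  proof -
    let ?u = "\<lambda>i. ip (d j) (R f j (g j i)) (g j i)" and ?w = "\<lambda>i. ip (d j) (R f j (f j i)) (f j i)"
      and ?Y = "\<Sum>a<d j. \<Sum>b<d j. res f j a b * cnj (Y j a b)"
    have "?Y = (\<Sum>i<n.
       (\<Sum>a<d j. \<Sum>b<d j. res f j a b * cnj (g j i a * cnj (g j i b)))
       - of_real (c i) * (\<Sum>a<d j. \<Sum>b<d j. res f j a b * cnj (f j i a * cnj (f j i b))))"
      unfolding Y_def cnj_sum sum_distrib_left sum_subtractf[symmetric] complex_cnj_diff right_diff_distrib
      by (subst sum.swap[of _ "{..<n}"])+ (simp add: mult_ac)
    also have "\<dots> = (\<Sum>i<n. ?u i - of_real (c i) * ?w i)"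
      unfolding sum_entries_eq_ip ..
    finally have "Re ?Y = Re (\<Sum>i<n. ?u i - of_real (c i) * ?w i)"
      by (rule arg_cong)
    moreover have "Re (of_real x * z) = x * Re z" for x z by simp
    ultimately show ?thesis by (simp only: Re_sum minus_complex.sel)
  qed
  have first: "(\<Sum>j<m. \<Sum>a<d j. \<Sum>b<d j. 2 * Re (res f j a b * cnj (X j a b)))
    = (\<Sum>j<m. 2 * (2 * (\<Sum>i<n. Re (ip (d j) (R f j (f j i)) (g j i)))))"
    by (intro sum.cong[OF refl]) (simp only: sum_distrib_left[symmetric] X lessThan_iff)
  from taylor2_local_min(1)[OF tay ev] show ?first
    unfolding first unfolding sum_distrib_left[symmetric] by simp
  have "(\<Sum>j<m. \<Sum>a<d j. \<Sum>b<d j. (cmod (X j a b))\<^sup>2 + 2 * Re (res f j a b * cnj (Y j a b)))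
    = (\<Sum>j<m. \<Sum>a<d j. \<Sum>b<d j. (cmod (X j a b))\<^sup>2)
    + 2 * (\<Sum>j<m. \<Sum>i<n. Re (ip (d j) (R f j (g j i)) (g j i))
            - c i * Re (ip (d j) (R f j (f j i)) (f j i)))"
    by (simp only: sum.distrib sum_distrib_left[symmetric] Y)
  with taylor2_local_min(2)[OF tay ev] show ?second by (simp only: X_def c_def)
qed

end

section \<open>Structure of local minimizers\<close>

lemma mv_frm: "mv k (frm n F) x a = (\<Sum>i<n. F i a * cnj (ip k (F i) x))"
proof -
  have "mv k (frm n F) x a = (\<Sum>b<k. \<Sum>i<n. F i a * cnj (F i b) * x b)"
    by (simp add: mv_def frm_def sum_distrib_right)
  also have "\<dots> = (\<Sum>i<n. \<Sum>b<k. F i a * cnj (F i b) * x b)" by (rule sum.swap)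
  finally show ?thesis by (simp add: ip_def sum_distrib_left mult.assoc)
qed

text \<open>The frame operator maps \<open>v l\<close> to the combination of the \<open>F i\<close>
  with the conjugates of their coefficients at \<open>v l\<close>. Taking inner products with the
  basis, the eigenvector equation says that the coefficient matrix has orthogonal columns whose
  squared lengths are the eigenvalues.\<close>

lemma frame_coeffs:
  assumes v: "onb k v" and e: "eigvec_on k (frm n F) (of_real s) (v l)" and l: "l < k"
  shows "a < k \<Longrightarrow> (\<Sum>i<n. F i a * cnj (ip k (F i) (v l))) = of_real s * v l a"
    and "l' < k \<Longrightarrow> (\<Sum>i<n. ip k (F i) (v l') * cnj (ip k (F i) (v l))) = (if l' = l then of_real s else 0)"
    and "(\<Sum>i<n. (cmod (ip k (F i) (v l)))\<^sup>2) = s"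
proof -
  show 1: "(\<Sum>i<n. F i a * cnj (ip k (F i) (v l))) = of_real s * v l a" if "a < k" for a
    using e that by (simp add: eigvec_on_def mv_frm)
  show 2: "(\<Sum>i<n. ip k (F i) (v l') * cnj (ip k (F i) (v l))) = (if l' = l then of_real s else 0)"
    if "l' < k" for l'
  proof -
    have "(\<Sum>i<n. ip k (F i) (v l') * cnj (ip k (F i) (v l)))
       = ip k (\<lambda>a. \<Sum>i<n. cnj (ip k (F i) (v l)) * F i a) (v l')"
      unfolding ip_linear by (simp add: mult.commute)
    also have "\<dots> = ip k (\<lambda>a. of_real s * v l a) (v l')"
      using 1 by (intro ip_cong) (simp_all add: mult.commute)
    also have "\<dots> = of_real s * ip k (v l) (v l')" by (rule ip_scale_left)
    finally show ?thesis using v l that by (simp add: onb_def)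
  qed
  have "of_real (\<Sum>i<n. (cmod (ip k (F i) (v l)))\<^sup>2) = (of_real s :: complex)"
    unfolding of_real_sum complex_norm_square using 2[OF l] by simp
  then show "(\<Sum>i<n. (cmod (ip k (F i) (v l)))\<^sup>2) = s" by (simp only: of_real_eq_iff)
qed

lemma ip_eigvec_left:
  assumes "eigvec_on k A r x"
  shows "ip k (mv k A x) y = r * ip k x y"
  unfolding ip_scale_left[symmetric] using assms by (intro ip_cong) (auto simp: eigvec_on_def)

lemma ip_eigvecs:
  assumes "hermitian_on k A" "eigvec_on k A r x" "eigvec_on k A (of_real t) y"
  shows "r * ip k x y = of_real t * ip k x y"
proof -
  have "r * ip k x y = ip k x (mv k A y)"
    using ip_eigvec_left[OF assms(2), of y] ip_mv[OF assms(1)] by simp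
  also have "\<dots> = cnj (ip k (mv k A y) x)" by (simp add: ip_cnj)
  also have "\<dots> = of_real t * ip k x y" by (simp add: ip_eigvec_left[OF assms(3)] ip_cnj)
  finally show ?thesis .
qed

lemma frobenius_symmetrized_outer:
  assumes "ip k u u = 1" "ip k w w = 1" "ip k u w = 0"
  shows "(\<Sum>a<k. \<Sum>b<k. (cmod (c * (u a * cnj (w b) + w a * cnj (u b))))\<^sup>2) = 2 * (cmod c)\<^sup>2"
proof -
  have wu: "ip k w u = 0" using ip_cnj[of k u w] assms by simp
  have "of_real (\<Sum>a<k. \<Sum>b<k. (cmod (c * (u a * cnj (w b) + w a * cnj (u b))))\<^sup>2)
    = (\<Sum>a<k. \<Sum>b<k. c * cnj c * ((u a * cnj (u a)) * (w b * cnj (w b)) + (w a * cnj (w a)) * (u b * cnj (u b))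
       + (u a * cnj (w a)) * (u b * cnj (w b)) + (w a * cnj (u a)) * (w b * cnj (u b))))"
    unfolding of_real_sum complex_norm_square by (intro sum.cong refl) (simp add: algebra_simps)
  also have "\<dots> = c * cnj c * (ip k u u * ip k w w + ip k w w * ip k u u + ip k u w * ip k u w + ip k w u * ip k w u)"
    unfolding sum_distrib_left[symmetric] sum.distrib sum_distrib_right[symmetric] ip_def ..
  also have "\<dots> = of_real (2 * (cmod c)\<^sup>2)"
    unfolding of_real_mult complex_norm_square using assms wu by simp
  finally show ?thesis by (simp only: of_real_eq_iff)
qed

context design_space
begin

text \<open>A ball of half the radius around a nearby family lies in the original ball. Thus the
  first order condition can be applied again after a small move along which \<open>dev\<close> is
  constant.\<close>

lemma locmin_transfer:
  assumes "locmin f"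
  obtains \<epsilon> where "\<epsilon> > 0" "\<And>g. admissible g \<Longrightarrow> close \<epsilon> f g \<Longrightarrow> dev g = dev f \<Longrightarrow> locmin g"
proof -
  obtain \<epsilon> where \<epsilon>: "\<epsilon> > 0" and min: "\<And>g. admissible g \<Longrightarrow> close \<epsilon> f g \<Longrightarrow> dev f \<le> dev g"
    using assms by (auto simp: locmin_def)
  have "locmin g" if g: "admissible g" "close (\<epsilon> / 2) f g" "dev g = dev f" for g
    unfolding locmin_def
  proof (intro conjI exI[of _ "\<epsilon> / 2"] allI impI)
    fix h assume h: "admissible h" "close (\<epsilon> / 2) g h"
    have "close \<epsilon> f h"
      unfolding close_def
    proof (intro allI impI)
      fix j i a assume *: "j < m" "i < n" "a < d j"
      then have "cmod (g j i a - f j i a) < \<epsilon> / 2" "cmod (h j i a - g j i a) < \<epsilon> / 2"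
        using g(2) h(2) by (auto simp: close_def)
      then show "cmod (h j i a - f j i a) < \<epsilon>"
        using norm_triangle_ineq[of "h j i a - g j i a" "g j i a - f j i a"] by simp
    qed
    then show "dev g \<le> dev h" using min[OF h(1)] g(3) by simp
  qed (use g \<epsilon> in auto)
  with \<epsilon> that[of "\<epsilon> / 2"] show ?thesis by simp
qed

lemma locmin_eigvec:
  assumes f: "locmin f"
  shows "\<exists>c. \<forall>j<m. \<forall>i<n. eigvec_on (d j) (res f j) (of_real (c i :: real)) (f j i)"
proof -
  \<comment> \<open>The Lagrange multiplier of the \<open>i\<close>-th constraint: the Rayleigh
    quotient of the residuals at the vectors \<open>f j i\<close> of all blocks taken
    together.\<close>
  define c where "c i = (\<Sum>j<m. Re (ip (d j) (R f j (f j i)) (f j i))) / \<alpha> i" for i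
  have "eigvec_on (d j0) (res f j0) (of_real (c i0)) (f j0 i0)" if j0: "j0 < m" and i0: "i0 < n" for j0 i0
  proof -
    let ?R = "\<lambda>j. R f j (f j i0)"
    \<comment> \<open>\<open>h\<close> is what remains of the image of \<open>f j i0\<close> under
      the residual after subtracting the multiplier term. It is an admissible direction, and the
      first order condition in this direction gives its own squared norm.\<close>
    define h where "h j = (\<lambda>a. ?R j a - of_real (c i0) * f j i0 a)" for j
    define g where "g j i = (if i = i0 then h j else (\<lambda>_. 0))" for j i
    have w: "weight f i0 = \<alpha> i0" using f i0 by (simp add: locmin_def admissible_def)
    have fh: "(\<Sum>j<m. Re (ip (d j) (f j i0) (h j))) = 0"
    proof -
      have "(\<Sum>j<m. Re (ip (d j) (f j i0) (h j)))
        = (\<Sum>j<m. Re (ip (d j) (?R j) (f j i0)) - c i0 * Re (ip (d j) (f j i0) (f j i0)))"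
        unfolding h_def ip_linear by (simp add: Re_ip_commute)
      also have "\<dots> = c i0 * \<alpha> i0 - c i0 * weight f i0"
        using \<alpha>_pos[OF i0] by (simp add: sum_subtractf c_def weight_def sum_distrib_left)
      finally show ?thesis using w by simp
    qed
    have g0: "Re (ip (d j) x (g j i)) = (if i = i0 then Re (ip (d j) x (h j)) else 0)" for j i x
      by (simp add: g_def ip_def)
    have "(\<Sum>j<m. Re (ip (d j) (f j i) (g j i))) = 0" for i
      unfolding g0 using fh by (cases "i = i0") auto
    from locmin_conditions(1)[OF f this]
    have "(\<Sum>j<m. Re (ip (d j) (?R j) (h j))) = 0"
      unfolding g0 using i0 by (simp add: sum.delta)
    then have "(\<Sum>j<m. Re (ip (d j) (?R j) (h j)) - c i0 * Re (ip (d j) (f j i0) (h j))) = 0"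
      using fh by (simp add: sum_subtractf sum_distrib_left[symmetric])
    moreover have "Re (ip (d j) (?R j) (h j)) - c i0 * Re (ip (d j) (f j i0) (h j)) = Re (ip (d j) (h j) (h j))" for j
      unfolding h_def ip_diff_left[of _ _ _ "\<lambda>a. _ a - _ a"] ip_scale_left by simp
    ultimately have sum0: "(\<Sum>j<m. Re (ip (d j) (h j) (h j))) = 0" by simp
    have "\<forall>j\<in>{..<m}. Re (ip (d j) (h j) (h j)) = 0"
      by (subst sum_nonneg_eq_0_iff[symmetric]) (use sum0 in \<open>auto simp: ip_self intro!: sum_nonneg\<close>)
    then have "Re (ip (d j0) (h j0) (h j0)) = 0" using j0 by simp
    then have "ip (d j0) (h j0) (h j0) = 0" by (simp only: ip_self Re_complex_of_real) simp
    then show ?thesis by (simp add: ip_self_eq_0_iff h_def eigvec_on_def)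
  qed
  then show ?thesis by blast
qed

end

text \<open>One block of a local minimizer, in a joint eigenbasis \<open>v\<close> of its residual
  and its frame operator. In this basis the target \<open>B j\<close> has the eigenvalues
  \<open>s l - r l\<close>.\<close>

locale critical_block = design_space +
  fixes f :: cfam and c :: "nat \<Rightarrow> real" and j :: nat
    and v :: cmat and r s :: "nat \<Rightarrow> real"
  assumes f: "locmin f"
    and crit: "\<And>j i. j < m \<Longrightarrow> i < n \<Longrightarrow> eigvec_on (d j) (res f j) (of_real (c i)) (f j i)"
    and j: "j < m" and v: "onb (d j) v"
    and eR: "\<And>l. l < d j \<Longrightarrow> eigvec_on (d j) (res f j) (of_real (r l)) (v l)"
    and eS: "\<And>l. l < d j \<Longrightarrow> eigvec_on (d j) (frm n (f j)) (of_real (s l)) (v l)"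
begin

abbreviation q :: cmat where
  "q i l \<equiv> ip (d j) (f j i) (v l)"

text \<open>Eigenvectors of the residual for different eigenvalues are orthogonal, so
  \<open>f j i\<close> lives in the eigenspace for \<open>c i\<close>.\<close>

lemma q_eigval:
  assumes "i < n" "l < d j" "q i l \<noteq> 0"
  shows "c i = r l"
  using ip_eigvecs[OF res_hermitian[OF j] crit[OF j assms(1)] eR[OF assms(2)]] assms(3) by simp

lemma q_square_sum: "l < d j \<Longrightarrow> (\<Sum>i<n. (cmod (q i l))\<^sup>2) = s l"
  by (rule frame_coeffs(3)[OF v eS])

lemma s_nonneg: "l < d j \<Longrightarrow> s l \<ge> 0"
  using q_square_sum[of l] by (metis sum_nonneg zero_le_power2)

lemma q_nonzero: "i < n \<Longrightarrow> l < d j \<Longrightarrow> q i l \<noteq> 0 \<Longrightarrow> s l > 0"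
proof -
  assume i: "i < n" and l: "l < d j" and q: "q i l \<noteq> 0"
  have "0 < (cmod (q i l))\<^sup>2" using q by simp
  also have "\<dots> \<le> (\<Sum>i<n. (cmod (q i l))\<^sup>2)" using i by (intro member_le_sum) auto
  finally show "s l > 0" using q_square_sum[OF l] by simp
qed

abbreviation variation :: "cmat \<Rightarrow> cmat" where
  "variation h a b \<equiv> \<Sum>i<n. f j i a * cnj (h i b) + h i a * cnj (f j i b)"

text \<open>Only block \<open>j\<close> is varied, while the rescaling acts on all blocks. The
  residual forms at the vectors \<open>f j' i\<close> add up to \<open>c i * \<alpha> i\<close> over
  the blocks, which turns the loss from rescaling into \<open>c i\<close> times the squared norm of
  \<open>h i\<close>.\<close>

lemma block_second_order:
  assumes h: "\<And>i. i < n \<Longrightarrow> Re (ip (d j) (f j i) (h i)) = 0"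
  shows "0 \<le> (\<Sum>a<d j. \<Sum>b<d j. (cmod (variation h a b))\<^sup>2)
      + 2 * (\<Sum>i<n. Re (ip (d j) (R f j (h i)) (h i)) - c i * Re (ip (d j) (h i) (h i)))"
proof -
  define g where "g j' i = (if j' = j then h i else (\<lambda>_. 0))" for j' i
  have g0: "ip k x (g j' i) = (if j' = j then ip k x (h i) else 0)" for k x j' i
    by (simp add: g_def ip_def)
  have X: "(\<Sum>i<n. f j' i a * cnj (g j' i b) + g j' i a * cnj (f j' i b))
    = (if j' = j then variation h a b else 0)" for j' a b
    by (simp add: g_def)
  have constr: "(\<Sum>j'<m. Re (ip (d j') (f j' i) (g j' i))) = 0" if "i < n" for i
    unfolding g0 using h[OF that] by (intro sum.neutral) auto
  have fw: "Re (ip (d j') (R f j' (f j' i)) (f j' i)) = c i * Re (ip (d j') (f j' i) (f j' i))"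
    if "j' < m" "i < n" for j' i
    using ip_eigvec_left[OF crit[OF that]] by simp
  have wg: "weight g i = Re (ip (d j) (h i) (h i))" for i
  proof -
    have "weight g i = (\<Sum>j'<m. if j' = j then Re (ip (d j) (h i) (h i)) else 0)"
      unfolding weight_def g0 by (intro sum.cong) (auto simp: g_def)
    then show ?thesis using j by simp
  qed
  have norm_term: "(\<Sum>j'<m. \<Sum>i<n. weight g i / \<alpha> i * Re (ip (d j') (R f j' (f j' i)) (f j' i)))
    = (\<Sum>i<n. c i * Re (ip (d j) (h i) (h i)))"
  proof (subst sum.swap, rule sum.cong[OF refl])
    fix i assume "i \<in> {..<n}"
    then have i: "i < n" by simp
    let ?S = "\<Sum>j'<m. weight g i / \<alpha> i * Re (ip (d j') (R f j' (f j' i)) (f j' i))"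
    have "?S
      = weight g i / \<alpha> i * c i * weight f i"
      unfolding weight_def[of f] sum_distrib_left using fw i by (intro sum.cong) auto
    then show "?S
      = c i * Re (ip (d j) (h i) (h i))"
      using f i \<alpha>_pos[OF i] by (simp add: locmin_def admissible_def wg)
  qed
  have R_term: "(\<Sum>j'<m. \<Sum>i<n. Re (ip (d j') (R f j' (g j' i)) (g j' i)))
    = (\<Sum>i<n. Re (ip (d j) (R f j (h i)) (h i)))"
  proof -
    have "(\<Sum>j'<m. \<Sum>i<n. Re (ip (d j') (R f j' (g j' i)) (g j' i)))
      = (\<Sum>j'<m. if j' = j then \<Sum>i<n. Re (ip (d j) (R f j (h i)) (h i)) else 0)"
      unfolding g0 by (intro sum.cong) (auto simp: g_def)
    then show ?thesis using j by simp
  qed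
  have X_term: "(\<Sum>j'<m. \<Sum>a<d j'. \<Sum>b<d j'.
        (cmod (\<Sum>i<n. f j' i a * cnj (g j' i b) + g j' i a * cnj (f j' i b)))\<^sup>2)
    = (\<Sum>a<d j. \<Sum>b<d j. (cmod (variation h a b))\<^sup>2)"
  proof -
    have "(\<Sum>j'<m. \<Sum>a<d j'. \<Sum>b<d j'.
        (cmod (\<Sum>i<n. f j' i a * cnj (g j' i b) + g j' i a * cnj (f j' i b)))\<^sup>2)
      = (\<Sum>j'<m. if j' = j then (\<Sum>a<d j. \<Sum>b<d j.
        (cmod (variation h a b))\<^sup>2) else 0)"
      unfolding X by (intro sum.cong) auto
    then show ?thesis using j by simp
  qed
  from locmin_conditions(2)[OF f constr] show ?thesis
    unfolding sum_subtractf norm_term R_term X_term by simp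
qed

text \<open>The variation adds the \<open>v y\<close> component of each vector to its
  \<open>v x\<close> component with factor \<open>p\<close>, and the other way round with factor
  \<open>t\<close>. It respects the norm constraints if \<open>p = - t\<close>, and also if
  \<open>r x \<noteq> r y\<close>, since then no vector has both components.\<close>

lemma pair_condition:
  fixes p t :: real
  assumes x: "x < d j" and y: "y < d j" and xy: "x \<noteq> y" and pt: "p = - t \<or> r x \<noteq> r y"
  shows "0 \<le> (p * s y + t * s x)\<^sup>2 + p\<^sup>2 * s y * (r x - r y) + t\<^sup>2 * s x * (r y - r x)"
proof -
  define h where "h i = (\<lambda>a. (of_real p * q i y) * v x a + (of_real t * q i x) * v y a)" for i
  have ov: "ip (d j) (v x) (v x) = 1" "ip (d j) (v y) (v y) = 1" "ip (d j) (v x) (v y) = 0" "ip (d j) (v y) (v x) = 0"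
    using v x y xy by (auto simp: onb_def)
  have disj: "q i x * cnj (q i y) = 0" if "i < n" "r x \<noteq> r y" for i
    using q_eigval[OF that(1) x] q_eigval[OF that(1) y] that(2) by (cases "q i x = 0") auto
  have h0: "Re (ip (d j) (f j i) (h i)) = 0" if i: "i < n" for i
  proof -
    have "Re (ip (d j) (f j i) (h i)) = (p + t) * Re (q i x * cnj (q i y))"
      unfolding h_def ip_linear by (simp add: algebra_simps)
    then show ?thesis using pt disj[OF i] by (cases "r x = r y") auto
  qed
  have X: "variation h a b
    = of_real (p * s y + t * s x) * (v x a * cnj (v y b) + v y a * cnj (v x b))" if "a < d j" "b < d j" for a b
  proof -
    have 1: "(\<Sum>i<n. f j i a * cnj (h i b)) = of_real p * (of_real (s y) * v y a) * cnj (v x b)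
       + of_real t * (of_real (s x) * v x a) * cnj (v y b)" if "a < d j" for a b
      unfolding frame_coeffs(1)[OF v eS[OF x] x that, symmetric] frame_coeffs(1)[OF v eS[OF y] y that, symmetric] h_def
      by (simp add: sum_distrib_left sum_distrib_right sum.distrib algebra_simps)
    have "(\<Sum>i<n. h i a * cnj (f j i b)) = cnj (\<Sum>i<n. f j i b * cnj (h i a))"
      by (simp add: mult.commute)
    then show ?thesis unfolding sum.distrib 1[OF that(1)] 1[OF that(2)] by (simp add: algebra_simps)
  qed
  have "(\<Sum>a<d j. \<Sum>b<d j. (cmod (variation h a b))\<^sup>2)
    = (\<Sum>a<d j. \<Sum>b<d j. (cmod (of_real (p * s y + t * s x) * (v x a * cnj (v y b) + v y a * cnj (v x b))))\<^sup>2)"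
    by (intro sum.cong refl arg_cong[of _ _ "\<lambda>z. (cmod z)\<^sup>2"] X) auto
  also have "\<dots> = 2 * (p * s y + t * s x)\<^sup>2"
    by (subst frobenius_symmetrized_outer) (simp_all only: ov norm_of_real power2_abs)
  finally have Xsum: "(\<Sum>a<d j. \<Sum>b<d j. (cmod (variation h a b))\<^sup>2)
    = 2 * (p * s y + t * s x)\<^sup>2" .
  have hh: "Re (ip (d j) (h i) (h i)) = p\<^sup>2 * (cmod (q i y))\<^sup>2 + t\<^sup>2 * (cmod (q i x))\<^sup>2" for i
    unfolding h_def ip_linear ov by (simp add: cmod_power2) (simp add: power2_eq_square algebra_simps)
  have Rh: "ip (d j) (R f j (h i)) (h i)
     = ip (d j) (\<lambda>a. (of_real (r x) * (of_real p * q i y)) * v x a + (of_real (r y) * (of_real t * q i x)) * v y a) (h i)" for i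
  proof (rule ip_cong)
    fix a assume a: "a < d j"
    have "R f j (h i) a = (of_real p * q i y) * R f j (v x) a
       + (of_real t * q i x) * R f j (v y) a"
      by (simp add: h_def mv_def sum_distrib_left sum.distrib algebra_simps)
    then show "R f j (h i) a = (of_real (r x) * (of_real p * q i y)) * v x a
       + (of_real (r y) * (of_real t * q i x)) * v y a"
      using eR[OF x] eR[OF y] a by (simp add: eigvec_on_def)
  qed simp
  have Rhh: "Re (ip (d j) (R f j (h i)) (h i))
     = r x * (p\<^sup>2 * (cmod (q i y))\<^sup>2) + r y * (t\<^sup>2 * (cmod (q i x))\<^sup>2)" for i
    unfolding Rh unfolding h_def ip_linear ov by (simp add: cmod_power2) (simp add: power2_eq_square algebra_simps)
  have cq: "c i * (cmod (q i l))\<^sup>2 = r l * (cmod (q i l))\<^sup>2" if "i < n" "l < d j" for i l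
    using q_eigval[OF that] by auto
  have "(\<Sum>i<n. Re (ip (d j) (R f j (h i)) (h i)) - c i * Re (ip (d j) (h i) (h i)))
    = (\<Sum>i<n. p\<^sup>2 * (r x - r y) * (cmod (q i y))\<^sup>2 + t\<^sup>2 * (r y - r x) * (cmod (q i x))\<^sup>2)"
  proof (rule sum.cong[OF refl])
    fix i assume "i \<in> {..<n}"
    then have i: "i < n" by simp
    have "c i * Re (ip (d j) (h i) (h i)) = p\<^sup>2 * (c i * (cmod (q i y))\<^sup>2) + t\<^sup>2 * (c i * (cmod (q i x))\<^sup>2)"
      unfolding hh by (simp add: algebra_simps)
    then show "Re (ip (d j) (R f j (h i)) (h i)) - c i * Re (ip (d j) (h i) (h i))
      = p\<^sup>2 * (r x - r y) * (cmod (q i y))\<^sup>2 + t\<^sup>2 * (r y - r x) * (cmod (q i x))\<^sup>2"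
      unfolding Rhh cq[OF i x] cq[OF i y] by (simp add: algebra_simps)
  qed
  also have "\<dots> = p\<^sup>2 * (r x - r y) * s y + t\<^sup>2 * (r y - r x) * s x"
    unfolding sum.distrib sum_distrib_left[symmetric] q_square_sum[OF x] q_square_sum[OF y] ..
  finally show ?thesis using block_second_order[OF h0] unfolding Xsum by (simp add: mult_ac)
qed

text \<open>For \<open>p = -1\<close> and \<open>t = 1\<close> the variation generates a rotation of
  the plane of \<open>v x\<close> and \<open>v y\<close>, applied to the whole block, and the
  condition factors. As \<open>s l - r l\<close> are the eigenvalues of \<open>B j\<close>, frame
  operator and target turn out to be ordered alike.\<close>

lemma opposite_order:
  assumes "x < d j" "y < d j" "s x > s y"
  shows "s x - r x \<ge> s y - r y"
proof -
  have "x \<noteq> y" using assms by auto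
  from pair_condition[OF assms(1,2) this, of "-1" 1]
  have "0 \<le> (s x - s y) * ((s x - r x) - (s y - r y))"
    by (simp add: power2_eq_square algebra_simps)
  then show ?thesis using assms(3) by (simp add: zero_le_mult_iff)
qed

text \<open>The choice \<open>p = s x\<close> and \<open>t = - s y\<close> makes the first order
  change of the frame operator vanish, so that only the residual terms are left.\<close>

lemma class_order_weak:
  assumes x: "x < d j" and y: "y < d j" and s: "s x > 0" "s y > 0" and r: "r y > r x"
  shows "s x \<le> s y"
proof -
  have "x \<noteq> y" using r by auto
  from pair_condition[OF x y this, of "s x" "- s y"] r
  have "0 \<le> (s x * s y) * ((s x - s y) * (r x - r y))"
    by (simp add: power2_eq_square algebra_simps)
  then have "0 \<le> (s x - s y) * (r x - r y)"
    using mult_pos_pos[OF s] by (metis mult_pos_neg not_less)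
  then show ?thesis using r by (simp add: zero_le_mult_iff)
qed

text \<open>Moving the vectors of a linear relation along \<open>v x\<close>, with the conjugate
  coefficients, does not change the frame operator to first order, and it respects the constraints
  because these vectors are orthogonal to \<open>v x\<close>. What is left is a sum of terms
  \<open>(r x - c i)\<close> times a squared modulus, negative for every nonzero
  coefficient.\<close>

lemma independent_above_eigval:
  assumes x: "x < d j" and J: "J \<subseteq> {i. i < n \<and> c i > r x}"
    and z: "\<And>a. a < d j \<Longrightarrow> (\<Sum>i\<in>J. z i * f j i a) = 0" and i: "i \<in> J"
  shows "z i = 0"
proof -
  define h where "h i = (\<lambda>a. (if i \<in> J then cnj (z i) else 0) * v x a)" for i
  have fin: "finite J" using J by (rule finite_subset) simp
  have JI: "{..<n} \<inter> J = J" using J by auto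
  have q0: "q i x = 0" if "i \<in> J" for i using q_eigval[of i x] that J x by (cases "q i x = 0") auto
  have "Re (ip (d j) (f j i) (h i)) = 0" for i
    using q0[of i] by (simp add: h_def ip_linear)
  note second = block_second_order[OF this]
  have J_sum: "(\<Sum>i<n. if i \<in> J then g i else 0) = sum g J" for g :: "nat \<Rightarrow> 'b :: comm_monoid_add"
    by (simp add: sum.If_cases JI)
  have fh: "(\<Sum>i<n. f j i a * cnj (h i b)) = 0" if "a < d j" for a b
  proof -
    have "(\<Sum>i<n. f j i a * cnj (h i b)) = (\<Sum>i<n. if i \<in> J then z i * f j i a * cnj (v x b) else 0)"
      by (intro sum.cong) (auto simp: h_def)
    also have "\<dots> = (\<Sum>i\<in>J. z i * f j i a) * cnj (v x b)" unfolding J_sum sum_distrib_right ..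
    finally show ?thesis using z[OF that] by simp
  qed
  have "variation h a b = 0" if "a < d j" "b < d j" for a b
  proof -
    have "(\<Sum>i<n. h i a * cnj (f j i b)) = cnj (\<Sum>i<n. f j i b * cnj (h i a))" by (simp add: mult.commute)
    then show ?thesis unfolding sum.distrib fh[OF that(1)] fh[OF that(2)] by simp
  qed
  then have X: "(\<Sum>a<d j. \<Sum>b<d j. (cmod (variation h a b))\<^sup>2) = 0"
    by simp
  have hh: "Re (ip (d j) (h i) (h i)) = (if i \<in> J then (cmod (z i))\<^sup>2 else 0)" for i
  proof -
    have "ip (d j) (v x) (v x) = 1" using v x by (simp add: onb_def)
    then show ?thesis unfolding h_def ip_linear
      by (simp add: cmod_power2) (simp add: power2_eq_square)
  qed
  have eh: "eigvec_on (d j) (res f j) (of_real (r x)) (h i)" for i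
  proof -
    have "R f j (h i) a = (if i \<in> J then cnj (z i) else 0) * R f j (v x) a" for a
      unfolding h_def mv_def sum_distrib_left by (simp add: mult_ac)
    then show ?thesis using eR[OF x] by (simp add: eigvec_on_def h_def)
  qed
  have "Re (ip (d j) (R f j (h i)) (h i)) - c i * Re (ip (d j) (h i) (h i))
     = (if i \<in> J then - ((c i - r x) * (cmod (z i))\<^sup>2) else 0)" for i
    unfolding ip_eigvec_left[OF eh] using hh[of i] by (simp add: algebra_simps)
  with second X have "(\<Sum>i\<in>J. (c i - r x) * (cmod (z i))\<^sup>2) \<le> 0"
    by (simp add: J_sum sum_negf)
  moreover have nn: "(c i - r x) * (cmod (z i))\<^sup>2 \<ge> 0" if "i \<in> J" for i
    using J that by auto
  ultimately have "(\<Sum>i\<in>J. (c i - r x) * (cmod (z i))\<^sup>2) = 0"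
    by (meson order_antisym sum_nonneg)
  then have "(c i - r x) * (cmod (z i))\<^sup>2 = 0"
    using sum_nonneg_eq_0_iff[OF fin, of "\<lambda>i. (c i - r x) * (cmod (z i))\<^sup>2"] nn i by blast
  then show ?thesis using J i by auto
qed

text \<open>The vectors with \<open>c i > r x\<close> are linearly independent and lie in the span
  of the basis vectors counted on the right, since all their other coefficients vanish.\<close>

lemma card_above_le:
  assumes x: "x < d j"
  shows "card {i. i < n \<and> c i > r x} \<le> card {l. l < d j \<and> s l > 0 \<and> r l > r x}"
proof (rule ccontr)
  let ?J = "{i. i < n \<and> c i > r x}" and ?E = "{l. l < d j \<and> s l > 0 \<and> r l > r x}"
  assume "\<not> card ?J \<le> card ?E"
  then obtain z where z: "\<exists>i\<in>?J. z i \<noteq> 0" "\<forall>l\<in>?E. (\<Sum>i\<in>?J. q i l * z i) = 0"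
    using underdetermined_system[of ?E ?J "\<lambda>l i. q i l"] by auto
  have q0: "(\<Sum>i\<in>?J. q i l * z i) = 0" if l: "l < d j" for l
  proof (cases "l \<in> ?E")
    case False
    have "q i l = 0" if "i \<in> ?J" for i
      using q_nonzero[of i l] q_eigval[of i l] False l that by (cases "q i l = 0") auto
    then show ?thesis by (simp add: sum.neutral)
  qed (use z in auto)
  have "(\<Sum>i\<in>?J. z i * f j i a) = 0" if a: "a < d j" for a
  proof -
    have "(\<Sum>i\<in>?J. z i * f j i a) = (\<Sum>i\<in>?J. z i * (\<Sum>l<d j. q i l * v l a))"
      using onb_expand[OF v a] by simp
    also have "\<dots> = (\<Sum>l<d j. (\<Sum>i\<in>?J. q i l * z i) * v l a)"
      unfolding sum_distrib_left sum_distrib_right by (subst sum.swap) (simp add: mult_ac)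
    finally show ?thesis using q0 by simp
  qed
  from independent_above_eigval[OF x order_refl this] z(1) show False by blast
qed

text \<open>The columns of the coefficient matrix with \<open>s l > 0\<close> are nonzero and
  orthogonal, hence independent; those with \<open>r l \<ge> \<rho>\<close> are supported on the
  rows counted on the right.\<close>

lemma card_at_least_le: "card {l. l < d j \<and> s l > 0 \<and> r l \<ge> \<rho>} \<le> card {i. i < n \<and> c i \<ge> \<rho>}"
proof (rule ccontr)
  let ?E = "{l. l < d j \<and> s l > 0 \<and> r l \<ge> \<rho>}" and ?J = "{i. i < n \<and> c i \<ge> \<rho>}"
  assume "\<not> card ?E \<le> card ?J"
  then obtain z where z: "\<exists>l\<in>?E. z l \<noteq> 0" "\<forall>i\<in>?J. (\<Sum>l\<in>?E. q i l * z l) = 0"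
    using underdetermined_system[of ?J ?E q] by auto
  have q0: "(\<Sum>l\<in>?E. q i l * z l) = 0" if i: "i < n" for i
  proof (cases "i \<in> ?J")
    case False
    then have "q i l = 0" if "l \<in> ?E" for l using q_eigval[of i l] i that by (cases "q i l = 0") auto
    then show ?thesis by (simp add: sum.neutral)
  qed (use z in auto)
  have "z l' = 0" if l': "l' \<in> ?E" for l'
  proof -
    have "0 = (\<Sum>i<n. (\<Sum>l\<in>?E. q i l * z l) * cnj (q i l'))" using q0 by simp
    also have "\<dots> = (\<Sum>l\<in>?E. z l * (\<Sum>i<n. q i l * cnj (q i l')))"
      unfolding sum_distrib_left sum_distrib_right by (subst sum.swap) (simp add: mult_ac)
    also have "\<dots> = (\<Sum>l\<in>?E. if l = l' then z l * of_real (s l') else 0)"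
      using frame_coeffs(2)[OF v eS] l' by (intro sum.cong) auto
    also have "\<dots> = z l' * of_real (s l')" using l' by simp
    finally show ?thesis using l' by auto
  qed
  then show False using z(1) by blast
qed

end

lemma rotation_product:
  fixes x y :: real and u w u' w' :: complex
  shows "(of_real x * u + of_real y * w) * (of_real x * u' + of_real y * w')
    + (of_real x * w - of_real y * u) * (of_real x * w' - of_real y * u')
    = of_real (x * x + y * y) * (u * u' + w * w')"
  by (simp add: algebra_simps)

lemma cos_sin_product_sum: "cos t * cos t + sin t * sin t = (1 :: real)"
  using sin_cos_squared_add2[of t] by (simp add: power2_eq_square)

lemma sum_lessThan_split2:
  fixes h :: "nat \<Rightarrow> 'a :: comm_monoid_add"
  assumes "p < n" "q < n" "p \<noteq> q"
  shows "(\<Sum>i<n. h i) = h p + h q + (\<Sum>i\<in>{..<n} - {p, q}. h i)"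
proof -
  have "(\<Sum>i<n. h i) = (\<Sum>i\<in>{..<n} - {p, q}. h i) + sum h {p, q}"
    using assms by (intro sum.subset_diff) auto
  then show ?thesis using assms by (simp add: ac_simps)
qed

text \<open>The water filling profile \<open>max (C i + \<kappa> i) 0\<close> encodes the Karush-Kuhn-Tucker conditions for \<open>\<mu>\<close>:
  \<open>\<mu> i \<ge> 0\<close> and \<open>\<mu> i - \<kappa> i \<ge> C i\<close>, with equality if \<open>\<mu> i > 0\<close>.\<close>

definition fill :: "(nat \<Rightarrow> real) \<Rightarrow> (nat \<Rightarrow> real) \<Rightarrow> nat \<Rightarrow> real" where
  "fill C \<kappa> i = max (C i + \<kappa> i) 0"

context critical_block
begin

text \<open>If \<open>s x = s y\<close>, rotating the pair \<open>x, y\<close> changes neither the frame operator nor the norms,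
  so the rotated design is again a local minimizer; but then its vectors would have to be
  eigenvectors of the same residual, whose eigenvalues at \<open>x\<close> and \<open>y\<close> differ.\<close>

lemma class_order_strict:
  assumes x: "x < d j" and y: "y < d j" and s: "s x > 0" "s y > 0" and r: "r y > r x"
  shows "s x < s y"
proof (rule ccontr)
  assume "\<not> s x < s y"
  with class_order_weak[OF x y s r] have sxy: "s x = s y" by simp
  have xy: "x \<noteq> y" using r by auto
  have ov: "ip (d j) (v x) (v x) = 1" "ip (d j) (v y) (v y) = 1" "ip (d j) (v x) (v y) = 0" "ip (d j) (v y) (v x) = 0"
    using v x y xy by (auto simp: onb_def)
  \<comment> \<open>\<open>X t\<close> and \<open>Y t\<close> are the changes of \<open>v x\<close>
    and \<open>v y\<close> under a rotation by the angle \<open>t\<close> in their plane, so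
    \<open>\<delta> t i\<close> is the resulting change of \<open>f j i\<close>.\<close>
  define X where "X t = (\<lambda>a. of_real (cos t - 1) * v x a - of_real (sin t) * v y a)" for t
  define Y where "Y t = (\<lambda>a. of_real (sin t) * v x a + of_real (cos t - 1) * v y a)" for t
  define \<delta> where "\<delta> t i = (\<lambda>a. q i x * X t a + q i y * Y t a)" for t i
  define F where "F t j' i = (if j' = j then (\<lambda>a. f j i a + \<delta> t i a) else f j' i)" for t j' i
  have frm_eq: "frm n (F t j) a b = frm n (f j) a b" if a: "a < d j" and b: "b < d j" for t a b
  proof -
    have f\<delta>: "(\<Sum>i<n. f j i a * cnj (\<delta> t i b)) = of_real (s x) * (v x a * cnj (X t b) + v y a * cnj (Y t b))"
      if "a < d j" for a b
    proof -
      have "(\<Sum>i<n. f j i a * cnj (\<delta> t i b))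
        = (\<Sum>i<n. f j i a * cnj (q i x)) * cnj (X t b) + (\<Sum>i<n. f j i a * cnj (q i y)) * cnj (Y t b)"
        unfolding sum_distrib_right sum.distrib[symmetric] \<delta>_def
        by (intro sum.cong refl) (simp add: algebra_simps)
      also have "\<dots> = of_real (s x) * (v x a * cnj (X t b) + v y a * cnj (Y t b))"
        unfolding frame_coeffs(1)[OF v eS[OF x] x that] frame_coeffs(1)[OF v eS[OF y] y that] sxy
        by (simp add: algebra_simps)
      finally show ?thesis .
    qed
    have \<delta>f: "(\<Sum>i<n. \<delta> t i a * cnj (f j i b)) = cnj (of_real (s x) * (v x b * cnj (X t a) + v y b * cnj (Y t a)))"
      unfolding f\<delta>[OF b, symmetric] by (simp add: mult.commute)
    have \<delta>\<delta>: "(\<Sum>i<n. \<delta> t i a * cnj (\<delta> t i b)) = of_real (s x) * (X t a * cnj (X t b) + Y t a * cnj (Y t b))"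
    proof -
      have "(\<Sum>i<n. \<delta> t i a * cnj (\<delta> t i b))
        = (\<Sum>i<n. q i x * cnj (q i x)) * (X t a * cnj (X t b)) + (\<Sum>i<n. q i x * cnj (q i y)) * (X t a * cnj (Y t b))
        + (\<Sum>i<n. q i y * cnj (q i x)) * (Y t a * cnj (X t b)) + (\<Sum>i<n. q i y * cnj (q i y)) * (Y t a * cnj (Y t b))"
        unfolding sum_distrib_right sum.distrib[symmetric] \<delta>_def
        by (intro sum.cong refl) (simp add: algebra_simps)
      then show ?thesis
        unfolding frame_coeffs(2)[OF v eS[OF x] x x] frame_coeffs(2)[OF v eS[OF x] x y]
          frame_coeffs(2)[OF v eS[OF y] y x] frame_coeffs(2)[OF v eS[OF y] y y]
        using xy sxy by (simp add: algebra_simps)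
    qed
    have z: "v x a * cnj (X t b) + v y a * cnj (Y t b) + cnj (v x b * cnj (X t a) + v y b * cnj (Y t a))
        + (X t a * cnj (X t b) + Y t a * cnj (Y t b)) = 0" (is "?lhs = 0")
    proof -
      have "?lhs = (of_real (cos t) * v y a + of_real (sin t) * v x a) * (of_real (cos t) * cnj (v y b) + of_real (sin t) * cnj (v x b))
        + (of_real (cos t) * v x a - of_real (sin t) * v y a) * (of_real (cos t) * cnj (v x b) - of_real (sin t) * cnj (v y b))
        - (v y a * cnj (v y b) + v x a * cnj (v x b))"
        by (simp add: X_def Y_def algebra_simps)
      then show ?thesis by (simp only: rotation_product cos_sin_product_sum) simp
    qed
    have "frm n (F t j) a b = frm n (f j) a b + ((\<Sum>i<n. f j i a * cnj (\<delta> t i b))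
       + (\<Sum>i<n. \<delta> t i a * cnj (f j i b)) + (\<Sum>i<n. \<delta> t i a * cnj (\<delta> t i b)))"
      unfolding frm_def F_def sum.distrib[symmetric] by (intro sum.cong refl) (simp add: algebra_simps)
    also have "\<dots> = frm n (f j) a b + of_real (s x) * (v x a * cnj (X t b) + v y a * cnj (Y t b)
        + cnj (v x b * cnj (X t a) + v y b * cnj (Y t a)) + (X t a * cnj (X t b) + Y t a * cnj (Y t b)))"
      unfolding f\<delta>[OF a] \<delta>f \<delta>\<delta> by (simp add: distrib_left)
    finally show ?thesis unfolding z by simp
  qed
  have F: "F t j i = (\<lambda>a. f j i a + \<delta> t i a)" for t i by (simp add: F_def)
  have Fx: "ip (d j) (F t j i) (v x) = of_real (cos t) * q i x + of_real (sin t) * q i y"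
    and Fy: "ip (d j) (F t j i) (v y) = of_real (cos t) * q i y - of_real (sin t) * q i x" for t i
    unfolding F \<delta>_def X_def Y_def ip_linear ov by (simp_all add: algebra_simps)
  have Fl: "ip (d j) (F t j i) (v l) = q i l" if "l < d j" "l \<noteq> x" "l \<noteq> y" for t i l
  proof -
    have "ip (d j) (v x) (v l) = 0" "ip (d j) (v y) (v l) = 0"
      using v x y that by (auto simp: onb_def)
    then show ?thesis unfolding F_def \<delta>_def X_def Y_def by (simp add: ip_linear)
  qed
  have norm_eq: "Re (ip (d j) (F t j i) (F t j i)) = Re (ip (d j) (f j i) (f j i))" for t i
  proof -
    have par: "Re (ip (d j) u u) = (\<Sum>l<d j. (cmod (ip (d j) u (v l)))\<^sup>2)" for u
      unfolding parseval[OF v, of u u] complex_norm_square[symmetric] by simp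
    have rot: "(cmod (of_real p * z + of_real t * w))\<^sup>2 + (cmod (of_real p * w - of_real t * z))\<^sup>2
       = (p * p + t * t) * ((cmod z)\<^sup>2 + (cmod w)\<^sup>2)" for z w and p t :: real
      unfolding cmod_power2 by (simp add: power2_eq_square algebra_simps)
    have "(\<Sum>l\<in>{..<d j} - {x, y}. (cmod (ip (d j) (F t j i) (v l)))\<^sup>2) = (\<Sum>l\<in>{..<d j} - {x, y}. (cmod (q i l))\<^sup>2)"
      by (intro sum.cong refl) (simp add: Fl)
    then show ?thesis
      unfolding par sum_lessThan_split2[OF x y xy] Fx Fy by (simp only: rot cos_sin_product_sum) simp
  qed
  have adm: "admissible (F t)" for t
  proof -
    have "weight (F t) i = weight f i" for i
      unfolding weight_def
    proof (rule sum.cong[OF refl])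
      fix j' show "Re (ip (d j') (F t j' i) (F t j' i)) = Re (ip (d j') (f j' i) (f j' i))"
        using norm_eq[of t i] by (cases "j' = j") (simp_all add: F_def)
    qed
    then show ?thesis using f by (simp add: admissible_def locmin_def)
  qed
  have res_eq: "res (F t) j' a b = res f j' a b" if "a < d j'" "b < d j'" for t j' a b
  proof (cases "j' = j")
    case True
    with that frm_eq show ?thesis by (simp add: res_def)
  qed (simp add: res_def frm_def F_def)
  have dev_eq: "dev (F t) = dev f" for t
    unfolding dev_def res_def[symmetric] by (intro sum.cong refl) (simp add: res_eq)
  have lim: "((\<lambda>t. F t j' i a) \<longlongrightarrow> f j' i a) (at 0)" for j' i a
    by (cases "j' = j") (auto simp: F_def \<delta>_def X_def Y_def intro!: tendsto_eq_intros)
  obtain \<epsilon> where \<epsilon>: "\<epsilon> > 0" "\<And>g. admissible g \<Longrightarrow> close \<epsilon> f g \<Longrightarrow> dev g = dev f \<Longrightarrow> locmin g"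
    using locmin_transfer[OF f] by blast
  have "\<forall>\<^sub>F t in at 0. close \<epsilon> f (F t) \<and> sin t \<noteq> 0 \<and> cos t \<noteq> (0::real)"
  proof (intro eventually_conj)
    show "\<forall>\<^sub>F t in at 0. close \<epsilon> f (F t)" by (rule eventually_close[of F f, OF lim \<epsilon>(1)])
    have "\<forall>\<^sub>F t in at (0::real). t \<noteq> 0 \<and> \<bar>t\<bar> < 1"
      by (auto simp: eventually_at dist_real_def intro!: exI[of _ 1])
    then show "\<forall>\<^sub>F t in at 0. sin t \<noteq> (0::real)"
    proof (rule eventually_mono)
      fix t :: real assume "t \<noteq> 0 \<and> \<bar>t\<bar> < 1"
      then show "sin t \<noteq> 0"
        using sin_gt_zero_02[of t] sin_gt_zero_02[of "- t"] by (cases "t > 0") auto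
    qed
    have "((\<lambda>t::real. cos t) \<longlongrightarrow> cos 0) (at 0)" by (intro tendsto_intros)
    then show "\<forall>\<^sub>F t in at 0. cos t \<noteq> (0::real)" by (rule tendsto_imp_eventually_ne) simp
  qed
  \<comment> \<open>A vector with a \<open>v y\<close> component has no \<open>v x\<close>
    component, as \<open>r x\<close> and \<open>r y\<close> differ. With \<open>sin t\<close> and
    \<open>cos t\<close> nonzero, the rotated vector has both and cannot be an eigenvector of the
    unchanged residual.\<close>
  then obtain t :: real where t: "close \<epsilon> f (F t)" "sin t \<noteq> 0" "cos t \<noteq> 0"
    using eventually_happens'[OF at_neq_bot] by blast
  from locmin_eigvec[OF \<epsilon>(2)[OF adm t(1) dev_eq]] obtain c'
    where c': "\<And>i. i < n \<Longrightarrow> eigvec_on (d j) (res (F t) j) (of_real (c' i :: real)) (F t j i)" using j by blast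
  have e': "eigvec_on (d j) (res f j) (of_real (c' i)) (F t j i)" if "i < n" for i
    using c'[OF that] unfolding eigvec_on_def mv_def by (simp add: res_eq)
  obtain i where i: "i < n" "q i y \<noteq> 0"
    using q_square_sum[OF y] s(2) by (metis (no_types, lifting) lessThan_iff less_irrefl norm_zero power_zero_numeral sum.neutral)
  have "q i x = 0" using q_eigval[OF i(1) x] q_eigval[OF i(1) y i(2)] r by (cases "q i x = 0") auto
  with ip_eigvecs[OF res_hermitian[OF j] e'[OF i(1)] eR[OF x]] ip_eigvecs[OF res_hermitian[OF j] e'[OF i(1)] eR[OF y]]
  have "c' i = r x" "c' i = r y" using t i(2) unfolding Fx Fy by simp_all
  then show False using r by simp
qed

text \<open>Two counting arguments squeeze the sorted eigenvalues of the residual against the sorted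
  multipliers. The final equation evaluates the trace of residual times frame operator in two ways;
  summed over the blocks it becomes complementary slackness.\<close>

lemma block_structure:
  assumes \<pi>: "bij_betw \<pi> {..<n} {..<n}" and dec: "\<And>i l. i \<le> l \<Longrightarrow> l < n \<Longrightarrow> c (\<pi> l) \<le> c (\<pi> i)"
    and dn: "d j \<le> n"
  shows "\<exists>w \<kappa>. onb (d j) w \<and> (\<forall>i l. i \<le> l \<longrightarrow> l < d j \<longrightarrow> \<kappa> l \<le> \<kappa> i) \<and>
    (\<forall>a<d j. \<forall>b<d j. B j a b = spec (d j) \<kappa> w a b \<and>
      frm n (f j) a b = spec (d j) (fill (\<lambda>i. c (\<pi> i)) \<kappa>) w a b) \<and>
    (\<Sum>i<d j. c (\<pi> i) * fill (\<lambda>i. c (\<pi> i)) \<kappa> i) = (\<Sum>i<n. c i * Re (ip (d j) (f j i) (f j i)))"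
proof -
  \<comment> \<open>The key is \<open>s l + (s l - r l)\<close>, the sum of the eigenvalues of the
    frame operator and of the target. These are ordered alike, so sorting their sum sorts both at
    once, even where one of them has ties.\<close>
  obtain \<sigma> where \<sigma>: "bij_betw \<sigma> {..<d j} {..<d j}"
    and key: "\<And>i l. i \<le> l \<Longrightarrow> l < d j \<Longrightarrow> 2 * s (\<sigma> l) - r (\<sigma> l) \<le> 2 * s (\<sigma> i) - r (\<sigma> i)"
    using ex_sorting_permutation[of "d j" "\<lambda>l. 2 * s l - r l"] by blast
  have lt: "\<sigma> i < d j" if "i < d j" for i using \<sigma> that by (auto simp: bij_betw_def)
  have inj: "\<sigma> i = \<sigma> l \<longleftrightarrow> i = l" if "i < d j" "l < d j" for i l
    using \<sigma> that by (auto simp: bij_betw_def inj_on_def)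
  define w where "w i = v (\<sigma> i)" for i
  define \<mu> where "\<mu> i = s (\<sigma> i)" for i
  define \<kappa> where "\<kappa> i = s (\<sigma> i) - r (\<sigma> i)" for i
  have w: "onb (d j) w" using v lt inj by (simp add: onb_def w_def)
  have \<mu>0: "\<mu> i \<ge> 0" if "i < d j" for i using s_nonneg[OF lt[OF that]] by (simp add: \<mu>_def)
  have sorted: "\<mu> l \<le> \<mu> i \<and> \<kappa> l \<le> \<kappa> i" if il: "i \<le> l" "l < d j" for i l
  proof -
    have i: "i < d j" using il by simp
    have "\<mu> l > \<mu> i \<Longrightarrow> \<kappa> l \<ge> \<kappa> i" "\<mu> i > \<mu> l \<Longrightarrow> \<kappa> i \<ge> \<kappa> l"
      using opposite_order[OF lt[OF i] lt[OF il(2)]] opposite_order[OF lt[OF il(2)] lt[OF i]]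
      by (simp_all add: \<mu>_def \<kappa>_def)
    moreover have "\<mu> l + \<kappa> l \<le> \<mu> i + \<kappa> i" using key[OF il] by (simp add: \<mu>_def \<kappa>_def)
    ultimately show ?thesis by linarith
  qed
  \<comment> \<open>The strict order is essential here: the weak one would allow the residual
    eigenvalue to increase along a tie of \<open>\<mu>\<close>.\<close>
  have \<nu>_sorted: "\<mu> l - \<kappa> l \<le> \<mu> i - \<kappa> i" if "i \<le> l" "l < d j" "\<mu> l > 0" for i l
  proof (rule ccontr)
    assume "\<not> \<mu> l - \<kappa> l \<le> \<mu> i - \<kappa> i"
    moreover have "\<mu> i > 0" using sorted[OF that(1,2)] that(3) by linarith
    ultimately have "\<mu> i < \<mu> l"
      using class_order_strict[OF lt lt, of i l] that by (simp add: \<mu>_def \<kappa>_def)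
    then show False using sorted[OF that(1,2)] by simp
  qed
  have card_\<sigma>: "card {l. l < d j \<and> P l} = card {i. i < d j \<and> P (\<sigma> i)}" for P
  proof (rule bij_betw_same_card[symmetric, of \<sigma>])
    have "\<sigma> ` {i. i < d j \<and> P (\<sigma> i)} = {l. l < d j \<and> P l}"
      using \<sigma> unfolding bij_betw_def by (auto simp: image_iff set_eq_iff lt) (metis imageE lessThan_iff)
    then show "bij_betw \<sigma> {i. i < d j \<and> P (\<sigma> i)} {l. l < d j \<and> P l}"
      using \<sigma> unfolding bij_betw_def by (auto simp: inj_on_def)
  qed
  have inj\<pi>: "inj_on \<pi> {..<n}" using \<pi> by (simp add: bij_betw_def)
  \<comment> \<open>If \<open>c (\<pi> i)\<close> were larger than the \<open>i\<close>-th residual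
    eigenvalue, so would be at least \<open>i + 1\<close> multipliers, while at most
    \<open>i\<close> basis vectors with positive \<open>s\<close> have a larger eigenvalue.\<close>
  have lower: "c (\<pi> i) \<le> \<mu> i - \<kappa> i" if i: "i < d j" for i
  proof (rule ccontr)
    assume less: "\<not> c (\<pi> i) \<le> \<mu> i - \<kappa> i"
    let ?r = "r (\<sigma> i)"
    have \<nu>: "\<mu> i - \<kappa> i = ?r" by (simp add: \<mu>_def \<kappa>_def)
    have "\<pi> ` {..i} \<subseteq> {i'. i' < n \<and> c i' > ?r}"
    proof (rule image_subsetI)
      fix l assume "l \<in> {..i}"
      then have l: "l \<le> i" "l < n" using i dn by auto
      then have "\<pi> l < n" using \<pi> by (auto simp: bij_betw_def)
      moreover have "c (\<pi> l) \<ge> c (\<pi> i)" using dec[OF l(1)] i dn by simp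
      ultimately show "\<pi> l \<in> {i'. i' < n \<and> c i' > ?r}" using less \<nu> by simp
    qed
    moreover have "card (\<pi> ` {..i}) = Suc i"
    proof -
      have "inj_on \<pi> {..i}" by (rule inj_on_subset[OF inj\<pi>]) (use i dn in auto)
      then show ?thesis by (simp add: card_image)
    qed
    ultimately have "Suc i \<le> card {i'. i' < n \<and> c i' > ?r}"
      using card_mono[of "{i'. i' < n \<and> c i' > ?r}" "\<pi> ` {..i}"] by simp
    also have "\<dots> \<le> card {l. l < d j \<and> s l > 0 \<and> r l > ?r}" by (rule card_above_le[OF lt[OF i]])
    also have "\<dots> = card {l. l < d j \<and> s (\<sigma> l) > 0 \<and> r (\<sigma> l) > ?r}" by (rule card_\<sigma>)
    also have "\<dots> \<le> card {..<i}"
    proof (rule card_mono)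
      show "{l. l < d j \<and> s (\<sigma> l) > 0 \<and> r (\<sigma> l) > ?r} \<subseteq> {..<i}"
      proof
        fix l assume l: "l \<in> {l. l < d j \<and> s (\<sigma> l) > 0 \<and> r (\<sigma> l) > ?r}"
        show "l \<in> {..<i}"
        proof (rule ccontr)
          assume "l \<notin> {..<i}"
          with l \<nu>_sorted[of i l] show False by (simp add: \<mu>_def \<kappa>_def)
        qed
      qed
    qed simp
    finally show False by simp
  qed
  \<comment> \<open>Dually, at least \<open>i + 1\<close> basis vectors with positive
    \<open>s\<close> reach the \<open>i\<close>-th residual eigenvalue, while at most
    \<open>i\<close> multipliers would.\<close>
  have upper: "\<mu> i - \<kappa> i \<le> c (\<pi> i)" if i: "i < d j" and pos: "\<mu> i > 0" for i
  proof (rule ccontr)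
    assume less: "\<not> \<mu> i - \<kappa> i \<le> c (\<pi> i)"
    let ?r = "r (\<sigma> i)"
    have \<nu>: "\<mu> i - \<kappa> i = ?r" by (simp add: \<mu>_def \<kappa>_def)
    have "Suc i = card {..i}" by simp
    also have "\<dots> \<le> card {l. l < d j \<and> s (\<sigma> l) > 0 \<and> r (\<sigma> l) \<ge> ?r}"
    proof (rule card_mono)
      show "{..i} \<subseteq> {l. l < d j \<and> s (\<sigma> l) > 0 \<and> r (\<sigma> l) \<ge> ?r}"
      proof
        fix l assume "l \<in> {..i}"
        then have "l \<le> i" "l < d j" using i by auto
        with sorted[of l i] \<nu>_sorted[of l i] i pos show "l \<in> {l. l < d j \<and> s (\<sigma> l) > 0 \<and> r (\<sigma> l) \<ge> ?r}"
          by (simp add: \<mu>_def \<kappa>_def)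
      qed
    qed simp
    also have "\<dots> = card {l. l < d j \<and> s l > 0 \<and> r l \<ge> ?r}" by (rule card_\<sigma>[symmetric])
    also have "\<dots> \<le> card {i'. i' < n \<and> c i' \<ge> ?r}" by (rule card_at_least_le)
    also have "\<dots> \<le> card (\<pi> ` {..<i})"
    proof (rule card_mono)
      show "{i'. i' < n \<and> c i' \<ge> ?r} \<subseteq> \<pi> ` {..<i}"
      proof
        fix i' assume i': "i' \<in> {i'. i' < n \<and> c i' \<ge> ?r}"
        then obtain l where l: "l < n" "i' = \<pi> l" using \<pi> by (auto simp: bij_betw_def image_iff set_eq_iff)
        have "l < i"
        proof (rule ccontr)
          assume "\<not> l < i"
          with dec[of i l] l i' less \<nu> show False by simp
        qed
        with l show "i' \<in> \<pi> ` {..<i}" by simp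
      qed
    qed simp
    also have "\<dots> \<le> i" using card_image_le[of "{..<i}" \<pi>] by simp
    finally show False by simp
  qed
  have fill: "fill (\<lambda>i. c (\<pi> i)) \<kappa> i = \<mu> i" if "i < d j" for i
    using lower[OF that] upper[OF that] \<mu>0[OF that] by (cases "\<mu> i = 0") (auto simp: fill_def)
  have specS: "frm n (f j) a b = spec (d j) (fill (\<lambda>i. c (\<pi> i)) \<kappa>) w a b" if "a < d j" "b < d j" for a b
    using that eS[OF lt] by (intro spec_of_eigenbasis[OF w]) (simp_all add: fill w_def \<mu>_def)
  have specB: "B j a b = spec (d j) \<kappa> w a b" if "a < d j" "b < d j" for a b
  proof (rule spec_of_eigenbasis[OF w _ that])
    fix i assume i: "i < d j"
    have "mv (d j) (B j) x a = mv (d j) (frm n (f j)) x a - R f j x a" for x a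
      by (simp add: mv_def res_def sum_subtractf[symmetric] left_diff_distrib)
    then show "eigvec_on (d j) (B j) (of_real (\<kappa> i)) (w i)"
      using eS[OF lt[OF i]] eR[OF lt[OF i]] by (simp add: eigvec_on_def w_def \<kappa>_def left_diff_distrib)
  qed
  have "(\<Sum>i<d j. c (\<pi> i) * fill (\<lambda>i. c (\<pi> i)) \<kappa> i) = (\<Sum>i<d j. r (\<sigma> i) * s (\<sigma> i))"
  proof (rule sum.cong[OF refl])
    fix i assume "i \<in> {..<d j}"
    then have i: "i < d j" by simp
    show "c (\<pi> i) * fill (\<lambda>i. c (\<pi> i)) \<kappa> i = r (\<sigma> i) * s (\<sigma> i)"
      unfolding fill[OF i] using lower[OF i] upper[OF i] \<mu>0[OF i] by (cases "\<mu> i = 0") (auto simp: \<mu>_def \<kappa>_def)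
  qed
  also have "\<dots> = (\<Sum>l<d j. r l * s l)" by (rule sum.reindex_bij_betw[OF \<sigma>])
  also have "\<dots> = (\<Sum>l<d j. \<Sum>i<n. c i * (cmod (q i l))\<^sup>2)"
  proof (rule sum.cong[OF refl])
    fix l assume "l \<in> {..<d j}"
    then have l: "l < d j" by simp
    have "r l * s l = (\<Sum>i<n. r l * (cmod (q i l))\<^sup>2)"
      unfolding q_square_sum[OF l, symmetric] by (rule sum_distrib_left)
    also have "\<dots> = (\<Sum>i<n. c i * (cmod (q i l))\<^sup>2)"
    proof (rule sum.cong[OF refl])
      fix i assume "i \<in> {..<n}"
      then show "r l * (cmod (q i l))\<^sup>2 = c i * (cmod (q i l))\<^sup>2"
        using q_eigval[of i l] l by (cases "q i l = 0") auto
    qed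
    finally show "r l * s l = (\<Sum>i<n. c i * (cmod (q i l))\<^sup>2)" .
  qed
  also have "\<dots> = (\<Sum>i<n. c i * Re (ip (d j) (f j i) (f j i)))"
    unfolding parseval[OF v, of "f j _" "f j _"] complex_norm_square[symmetric]
    by (subst sum.swap) (simp add: sum_distrib_left)
  finally have tot: "(\<Sum>i<d j. c (\<pi> i) * fill (\<lambda>i. c (\<pi> i)) \<kappa> i)
    = (\<Sum>i<n. c i * Re (ip (d j) (f j i) (f j i)))" .
  show ?thesis
    by (rule exI[of _ w], rule exI[of _ \<kappa>], intro conjI allI impI)
      (fact w sorted[THEN conjunct2] specB specS tot)+
qed

end

text \<open>A solution of the eigenvalue problem is given by its multipliers \<open>C\<close>; the
  equation \<open>complementary\<close> is the slackness condition for the majorization constraints.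
  \<open>\<pi>\<close> is the order in which the weights meet the multipliers: it sorts the
  multipliers of a local minimizer, and is the identity for the constants \<open>c\<close>.\<close>

locale kkt = design_space +
  fixes \<pi> :: "nat \<Rightarrow> nat" and C :: "nat \<Rightarrow> real"
    and x :: cfam and \<kappa> :: "nat \<Rightarrow> nat \<Rightarrow> real"
  assumes dn: "j < m \<Longrightarrow> d j \<le> n"
    and \<pi>: "bij_betw \<pi> {..<n} {..<n}"
    and C_dec: "i \<le> l \<Longrightarrow> l < n \<Longrightarrow> C l \<le> C i"
    and x: "j < m \<Longrightarrow> onb (d j) (x j)"
    and \<kappa>_dec: "j < m \<Longrightarrow> i \<le> l \<Longrightarrow> l < d j \<Longrightarrow> \<kappa> j l \<le> \<kappa> j i"
    and B_spec: "j < m \<Longrightarrow> a < d j \<Longrightarrow> b < d j \<Longrightarrow> B j a b = spec (d j) (\<kappa> j) (x j) a b"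
    and complementary: "(\<Sum>j<m. \<Sum>i<d j. C i * fill C (\<kappa> j) i) = (\<Sum>i<n. C i * \<alpha> (\<pi> i))"

context design_space
begin

theorem locmin_structure:
  assumes f: "locmin f" and dn: "\<And>j. j < m \<Longrightarrow> d j \<le> n"
  shows "\<exists>\<pi> C w \<kappa>. kkt m n d \<alpha> B \<pi> C w \<kappa> \<and>
    (\<forall>j<m. \<forall>a<d j. \<forall>b<d j. frm n (f j) a b = spec (d j) (fill C (\<kappa> j)) (w j) a b)"
proof -
  obtain c where crit: "\<And>j i. j < m \<Longrightarrow> i < n \<Longrightarrow> eigvec_on (d j) (res f j) (of_real (c i :: real)) (f j i)"
    using locmin_eigvec[OF f] by blast
  obtain \<pi> where \<pi>: "bij_betw \<pi> {..<n} {..<n}" and dec: "\<And>i l. i \<le> l \<Longrightarrow> l < n \<Longrightarrow> c (\<pi> l) \<le> c (\<pi> i)"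
    using ex_sorting_permutation[of n c] by blast
  let ?C = "\<lambda>i. c (\<pi> i)"
  define P where "P j w \<kappa> \<longleftrightarrow> onb (d j) w \<and> (\<forall>i l. i \<le> l \<longrightarrow> l < d j \<longrightarrow> \<kappa> l \<le> \<kappa> i) \<and>
    (\<forall>a<d j. \<forall>b<d j. B j a b = spec (d j) \<kappa> w a b \<and> frm n (f j) a b = spec (d j) (fill ?C \<kappa>) w a b) \<and>
    (\<Sum>i<d j. ?C i * fill ?C \<kappa> i) = (\<Sum>i<n. c i * Re (ip (d j) (f j i) (f j i)))" for j w \<kappa>
  have ex: "\<exists>w \<kappa>. P j w \<kappa>" if j: "j < m" for j
  proof -
    let ?R = "res f j" and ?S = "frm n (f j)"
    note hR = res_hermitian[OF j, of f]
    \<comment> \<open>By the first order condition this product is the frame operator with the extra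
      factors \<open>c i\<close>. These are real, so the product is selfadjoint and its two
      selfadjoint factors commute.\<close>
    have RS: "(\<Sum>b<d j. ?R a b * ?S b e) = (\<Sum>i<n. of_real (c i) * f j i a * cnj (f j i e))" if a: "a < d j" for a e
    proof -
      have "(\<Sum>b<d j. ?R a b * ?S b e) = (\<Sum>i<n. mv (d j) ?R (f j i) a * cnj (f j i e))"
        unfolding frm_def mv_def sum_distrib_left sum_distrib_right by (subst sum.swap) (simp add: mult.assoc)
      also have "\<dots> = (\<Sum>i<n. of_real (c i) * f j i a * cnj (f j i e))"
        using crit[OF j] a by (intro sum.cong refl) (simp add: eigvec_on_def)
      finally show ?thesis .
    qed
    have comm: "(\<Sum>b<d j. ?R a b * ?S b e) = (\<Sum>b<d j. ?S a b * ?R b e)" if a: "a < d j" and e: "e < d j" for a e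
    proof -
      have "(\<Sum>b<d j. ?S a b * ?R b e) = (\<Sum>b<d j. cnj (?R e b * ?S b a))"
      proof (rule sum.cong[OF refl])
        fix b assume "b \<in> {..<d j}"
        then have "?S a b = cnj (?S b a)" "?R b e = cnj (?R e b)"
          using hR frm_hermitian[of "d j" n "f j"] a e unfolding hermitian_on_def by blast+
        then show "?S a b * ?R b e = cnj (?R e b * ?S b a)" by simp
      qed
      also have "\<dots> = cnj (\<Sum>b<d j. ?R e b * ?S b a)" by (rule cnj_sum[symmetric])
      also have "\<dots> = (\<Sum>i<n. of_real (c i) * f j i a * cnj (f j i e))"
        unfolding RS[OF e] by (simp add: mult_ac)
      finally show ?thesis unfolding RS[OF a] by simp
    qed
    obtain v r s where v: "onb (d j) v" and
      e: "\<And>i. i < d j \<Longrightarrow> eigvec_on (d j) ?R (of_real (r i :: real)) (v i)"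
         "\<And>i. i < d j \<Longrightarrow> eigvec_on (d j) ?S (of_real (s i :: real)) (v i)"
      using ex_joint_eigenbasis[OF hR frm_hermitian comm] by blast
    interpret critical_block m n d \<alpha> B f c j v r s
      by unfold_locales (use f crit j v e in auto)
    show ?thesis unfolding P_def by (rule block_structure[OF \<pi> dec dn[OF j]])
  qed
  obtain w \<kappa> where P: "\<And>j. j < m \<Longrightarrow> P j (w j) (\<kappa> j)"
    using ex by metis
  from P have w: "\<And>j. j < m \<Longrightarrow> onb (d j) (w j)"
    and \<kappa>: "\<And>j i l. j < m \<Longrightarrow> i \<le> l \<Longrightarrow> l < d j \<Longrightarrow> \<kappa> j l \<le> \<kappa> j i"
    and B: "\<And>j a b. j < m \<Longrightarrow> a < d j \<Longrightarrow> b < d j \<Longrightarrow> B j a b = spec (d j) (\<kappa> j) (w j) a b"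
    and frm: "\<And>j a b. j < m \<Longrightarrow> a < d j \<Longrightarrow> b < d j \<Longrightarrow> frm n (f j) a b = spec (d j) (fill ?C (\<kappa> j)) (w j) a b"
    and tot: "\<And>j. j < m \<Longrightarrow> (\<Sum>i<d j. ?C i * fill ?C (\<kappa> j) i) = (\<Sum>i<n. c i * Re (ip (d j) (f j i) (f j i)))"
    unfolding P_def by blast+
  have "(\<Sum>j<m. \<Sum>i<d j. ?C i * fill ?C (\<kappa> j) i) = (\<Sum>j<m. \<Sum>i<n. c i * Re (ip (d j) (f j i) (f j i)))"
    using tot by (intro sum.cong[OF refl]) blast
  also have "\<dots> = (\<Sum>i<n. c i * weight f i)"
    unfolding weight_def sum_distrib_left by (rule sum.swap)
  also have "\<dots> = (\<Sum>i<n. c i * \<alpha> i)" using f by (simp add: locmin_def admissible_def)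
  also have "\<dots> = (\<Sum>i<n. ?C i * \<alpha> (\<pi> i))" by (rule sum.reindex_bij_betw[OF \<pi>, symmetric])
  finally have total: "(\<Sum>j<m. \<Sum>i<d j. ?C i * fill ?C (\<kappa> j) i) = (\<Sum>i<n. ?C i * \<alpha> (\<pi> i))" .
  have "kkt m n d \<alpha> B \<pi> ?C w \<kappa>"
    by unfold_locales (fact dn \<pi> dec w \<kappa> B total)+
  with frm show ?thesis by blast
qed

end

section \<open>Comparison with the eigenvalue problem\<close>

lemma ip_spec_spec:
  "(\<Sum>a<k. \<Sum>b<k. spec k \<kappa> x a b * cnj (spec k \<mu> y a b))
    = of_real (\<Sum>i<k. \<Sum>l<k. \<kappa> i * \<mu> l * (cmod (ip k (x i) (y l)))\<^sup>2)"
proof -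
  have "(\<Sum>a<k. \<Sum>b<k. spec k \<kappa> x a b * cnj (spec k \<mu> y a b))
    = (\<Sum>a<k. \<Sum>b<k. \<Sum>i<k. \<Sum>l<k. of_real (\<kappa> i * \<mu> l) * ((x i a * cnj (y l a)) * (y l b * cnj (x i b))))"
    by (simp add: spec_def sum_product mult_ac)
  also have "\<dots> = (\<Sum>a<k. \<Sum>i<k. \<Sum>l<k. \<Sum>b<k. of_real (\<kappa> i * \<mu> l) * ((x i a * cnj (y l a)) * (y l b * cnj (x i b))))"
    by (rule sum.cong[OF refl], subst sum.swap, rule sum.cong[OF refl], rule sum.swap)
  also have "\<dots> = (\<Sum>i<k. \<Sum>l<k. \<Sum>a<k. \<Sum>b<k. of_real (\<kappa> i * \<mu> l) * ((x i a * cnj (y l a)) * (y l b * cnj (x i b))))"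
    by (subst sum.swap, rule sum.cong[OF refl], rule sum.swap)
  also have "\<dots> = (\<Sum>i<k. \<Sum>l<k. of_real (\<kappa> i * \<mu> l) * (ip k (x i) (y l) * ip k (y l) (x i)))"
    unfolding ip_def sum_product unfolding sum_distrib_left ..
  also have "\<dots> = of_real (\<Sum>i<k. \<Sum>l<k. \<kappa> i * \<mu> l * (cmod (ip k (x i) (y l)))\<^sup>2)"
    unfolding of_real_sum of_real_mult complex_norm_square ip_cnj ..
  finally show ?thesis .
qed

lemma frobenius_spec_diff:
  assumes x: "onb k x" and y: "onb k y"
  shows "(\<Sum>a<k. \<Sum>b<k. (cmod (spec k \<mu> y a b - spec k \<kappa> x a b))\<^sup>2)
    = (\<Sum>i<k. (\<mu> i)\<^sup>2) + (\<Sum>i<k. (\<kappa> i)\<^sup>2) - 2 * (\<Sum>i<k. \<Sum>l<k. \<kappa> i * \<mu> l * (cmod (ip k (x i) (y l)))\<^sup>2)"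
proof -
  have self: "(\<Sum>i<k. \<Sum>l<k. \<kappa> i * \<kappa> l * (cmod (ip k (z i) (z l)))\<^sup>2) = (\<Sum>i<k. (\<kappa> i)\<^sup>2)"
    if z: "onb k z" for z and \<kappa> :: "nat \<Rightarrow> real"
  proof (rule sum.cong[OF refl])
    fix i assume "i \<in> {..<k}"
    then have "(\<Sum>l<k. \<kappa> i * \<kappa> l * (cmod (ip k (z i) (z l)))\<^sup>2) = (\<Sum>l<k. if l = i then \<kappa> i * \<kappa> l else 0)"
      using z by (intro sum.cong) (auto simp: onb_def)
    then show "(\<Sum>l<k. \<kappa> i * \<kappa> l * (cmod (ip k (z i) (z l)))\<^sup>2) = (\<kappa> i)\<^sup>2"
      using \<open>i \<in> {..<k}\<close> by (simp add: power2_eq_square)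
  qed
  have Re_ip: "(\<Sum>a<k. \<Sum>b<k. Re (spec k \<kappa> x a b * cnj (spec k \<mu> y a b)))
    = (\<Sum>i<k. \<Sum>l<k. \<kappa> i * \<mu> l * (cmod (ip k (x i) (y l)))\<^sup>2)" for \<kappa> \<mu> x y
    using arg_cong[OF ip_spec_spec[of k \<kappa> x \<mu> y], of Re] by (simp only: Re_sum Re_complex_of_real)
  have sq: "(cmod z)\<^sup>2 = Re (z * cnj z)" for z
    unfolding complex_norm_square[symmetric] by simp
  have diff: "(cmod (z - w))\<^sup>2 = Re (z * cnj z) + Re (w * cnj w) - 2 * Re (w * cnj z)" for z w
    unfolding cmod_power2 by (simp add: power2_eq_square algebra_simps)
  show ?thesis
    unfolding diff sum_subtractf sum.distrib sum_distrib_left[symmetric] Re_ip self[OF x] self[OF y] ..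
qed

text \<open>By Parseval's identity the squared moduli of the inner products of two orthonormal bases
  are doubly stochastic, which bounds the mixed term. This is the Hoffman-Wielandt inequality,
  equivalent to von Neumann's trace inequality.\<close>

lemma sum_square_diff_le_frobenius:
  assumes x: "onb k x" and y: "onb k y"
    and "\<And>i j. i \<le> j \<Longrightarrow> j < k \<Longrightarrow> \<kappa> j \<le> \<kappa> i" "\<And>i j. i \<le> j \<Longrightarrow> j < k \<Longrightarrow> \<mu> j \<le> \<mu> i"
  shows "(\<Sum>i<k. (\<mu> i - \<kappa> i)\<^sup>2) \<le> (\<Sum>a<k. \<Sum>b<k. (cmod (spec k \<mu> y a b - spec k \<kappa> x a b))\<^sup>2)"
proof -
  have sum1: "(\<Sum>l<k. (cmod (ip k u (z l)))\<^sup>2) = 1" if "ip k u u = 1" "onb k z" for u z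
  proof -
    have "of_real (\<Sum>l<k. (cmod (ip k u (z l)))\<^sup>2) = (1 :: complex)"
      unfolding of_real_sum complex_norm_square using parseval[OF that(2), of u u] that(1) by simp
    then show ?thesis by (simp only: of_real_eq_1_iff)
  qed
  have comm: "cmod (ip k u w) = cmod (ip k w u)" for u w
    using ip_cnj[of k u w] by (metis complex_mod_cnj)
  have "(\<Sum>i<k. \<Sum>l<k. \<kappa> i * \<mu> l * (cmod (ip k (x i) (y l)))\<^sup>2) \<le> (\<Sum>i<k. \<kappa> i * \<mu> i)"
  proof (rule doubly_stochastic_sum_le)
    show "(\<Sum>l<k. (cmod (ip k (x i) (y l)))\<^sup>2) = 1" if "i < k" for i
      using x that by (intro sum1 y) (simp add: onb_def)
    show "(\<Sum>i<k. (cmod (ip k (x i) (y l)))\<^sup>2) = 1" if "l < k" for l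
      unfolding comm[of _ "y l"] using y that by (intro sum1 x) (simp add: onb_def)
  qed (use assms in auto)
  moreover have "(\<Sum>i<k. (\<mu> i - \<kappa> i)\<^sup>2) = (\<Sum>i<k. (\<mu> i)\<^sup>2) + (\<Sum>i<k. (\<kappa> i)\<^sup>2) - 2 * (\<Sum>i<k. \<kappa> i * \<mu> i)"
    by (simp add: power2_diff sum.distrib sum_subtractf sum_distrib_left mult_ac)
  ultimately show ?thesis unfolding frobenius_spec_diff[OF x y] by simp
qed

lemma spec_diff: "spec k \<mu> x a b - spec k \<kappa> x a b = spec k (\<lambda>i. \<mu> i - \<kappa> i) x a b"
  by (simp add: spec_def sum_subtractf[symmetric] left_diff_distrib)

lemma frobenius_spec_same_basis:
  assumes x: "onb k x"
  shows "(\<Sum>a<k. \<Sum>b<k. (cmod (spec k \<mu> x a b - spec k \<kappa> x a b))\<^sup>2) = (\<Sum>i<k. (\<mu> i - \<kappa> i)\<^sup>2)"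
  using frobenius_spec_diff[OF x x, of "\<lambda>i. \<mu> i - \<kappa> i" "\<lambda>_. 0"]
  by (simp add: spec_diff)

text \<open>The case of distance zero in the preceding inequality, which spares any discussion of
  multiplicities.\<close>

lemma sorted_spec_unique:
  assumes x: "onb k x" and y: "onb k y"
    and "\<And>i j. i \<le> j \<Longrightarrow> j < k \<Longrightarrow> \<kappa> j \<le> \<kappa> i" "\<And>i j. i \<le> j \<Longrightarrow> j < k \<Longrightarrow> \<mu> j \<le> \<mu> i"
    and eq: "\<And>a b. a < k \<Longrightarrow> b < k \<Longrightarrow> spec k \<mu> y a b = spec k \<kappa> x a b" and i: "i < k"
  shows "\<mu> i = \<kappa> i"
proof -
  have "(\<Sum>i<k. (\<mu> i - \<kappa> i)\<^sup>2) \<le> 0"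
    using sum_square_diff_le_frobenius[of k x y \<kappa> \<mu>, OF assms(1-4)] eq by simp
  then have "(\<Sum>i<k. (\<mu> i - \<kappa> i)\<^sup>2) = 0" by (simp add: order_antisym sum_nonneg)
  then have "(\<mu> i - \<kappa> i)\<^sup>2 = 0" using i by (subst (asm) sum_nonneg_eq_0_iff) auto
  then show ?thesis by simp
qed

section \<open>Ky Fan's inequality for frame operators\<close>

context
  fixes k n :: nat and F v :: cmat and \<mu> :: "nat \<Rightarrow> real"
  assumes v: "onb k v" and frm: "\<And>a b. a < k \<Longrightarrow> b < k \<Longrightarrow> frm n F a b = spec k \<mu> v a b"
begin

lemma frm_eigvec: "l < k \<Longrightarrow> eigvec_on k (frm n F) (of_real (\<mu> l)) (v l)"
  by (rule eigvec_spec[OF v frm])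

lemma frm_eigval_nonneg: "l < k \<Longrightarrow> 0 \<le> \<mu> l"
  using frame_coeffs(3)[OF v frm_eigvec, of l] by (metis sum_nonneg zero_le_power2)

lemma Re_ip_parseval: "Re (ip k u u) = (\<Sum>l<k. (cmod (ip k u (v l)))\<^sup>2)"
  unfolding parseval[OF v, of u u] complex_norm_square[symmetric] by simp

lemma frm_trace: "(\<Sum>i<n. Re (ip k (F i) (F i))) = (\<Sum>l<k. \<mu> l)"
  unfolding Re_ip_parseval
  by (subst sum.swap) (intro sum.cong refl frame_coeffs(3)[OF v frm_eigvec], auto)

text \<open>Bessel's inequality for the coefficients of \<open>F i\<close>, rescaled by the pseudo-inverse
  of the frame operator.\<close>

lemma frame_bessel:
  assumes i: "i < n"
  shows "(\<Sum>l<k. if \<mu> l > 0 then (cmod (ip k (F i) (v l)))\<^sup>2 / \<mu> l else 0) \<le> 1" (is "?Q \<le> 1")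
proof -
  let ?q = "\<lambda>i l. ip k (F i) (v l)"
  \<comment> \<open>\<open>y\<close> is the pseudo-inverse of the frame operator applied to
    \<open>F i\<close>. Both \<open>ip k (F i) y\<close> and the sum of all squared moduli of
    \<open>ip k (F i') y\<close> equal \<open>?Q\<close>, so the square of \<open>?Q\<close> is at
    most \<open>?Q\<close>.\<close>
  define g where "g l = (if \<mu> l > 0 then ?q i l / of_real (\<mu> l) else 0)" for l
  define y where "y = (\<lambda>a. \<Sum>l<k. g l * v l a)"
  have Fy: "ip k (F i') y = (\<Sum>l<k. cnj (g l) * ?q i' l)" for i'
    unfolding y_def ip_linear ..
  have gq: "cnj (g l) * ?q i l = of_real (if \<mu> l > 0 then (cmod (?q i l))\<^sup>2 / \<mu> l else 0)" for l
    using complex_norm_square[of "?q i l"] by (simp add: g_def mult.commute)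
  have Fiy: "ip k (F i) y = of_real ?Q" unfolding Fy gq of_real_sum ..
  have Q: "(cmod (ip k (F i) y))\<^sup>2 = ?Q\<^sup>2" unfolding Fiy norm_of_real power2_abs ..
  have "of_real (\<Sum>i'<n. (cmod (ip k (F i') y))\<^sup>2)
    = (\<Sum>i'<n. \<Sum>l<k. \<Sum>l'<k. cnj (g l) * g l' * (?q i' l * cnj (?q i' l')))"
    unfolding of_real_sum complex_norm_square Fy cnj_sum sum_product
    by (intro sum.cong refl) (simp add: mult_ac)
  also have "\<dots> = (\<Sum>l<k. \<Sum>l'<k. cnj (g l) * g l' * (\<Sum>i'<n. ?q i' l * cnj (?q i' l')))"
    unfolding sum_distrib_left
    by (subst sum.swap, rule sum.cong[OF refl], rule sum.swap)
  also have "\<dots> = (\<Sum>l<k. \<Sum>l'<k. if l' = l then cnj (g l) * g l' * of_real (\<mu> l') else 0)"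
    using frame_coeffs(2)[OF v frm_eigvec] by (intro sum.cong refl) auto
  also have "\<dots> = (\<Sum>l<k. cnj (g l) * g l * of_real (\<mu> l))" by simp
  also have "\<dots> = (\<Sum>l<k. cnj (g l) * ?q i l)"
    by (intro sum.cong refl) (simp add: g_def)
  also have "\<dots> = of_real ?Q" unfolding gq of_real_sum ..
  finally have total: "(\<Sum>i'<n. (cmod (ip k (F i') y))\<^sup>2) = ?Q" by (simp only: of_real_eq_iff)
  have "(cmod (ip k (F i) y))\<^sup>2 \<le> (\<Sum>i'<n. (cmod (ip k (F i') y))\<^sup>2)"
    using i by (intro member_le_sum) auto
  then have "?Q\<^sup>2 \<le> ?Q" unfolding Q total .
  then show ?thesis by (simp add: power2_eq_square mult_le_cancel_right2 not_le) linarith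
qed

text \<open>The share \<open>t l\<close> of the vectors in \<open>J\<close> in the eigenvalue
  \<open>\<mu> l\<close> lies between 0 and 1, and by \<open>frame_bessel\<close> these shares add
  up to at most \<open>card J\<close>. The default value 0 covers sets \<open>J\<close> with more
  than \<open>k\<close> elements.\<close>

lemma frame_ky_fan:
  assumes dec: "\<And>i j. i \<le> j \<Longrightarrow> j < k \<Longrightarrow> \<mu> j \<le> \<mu> i" and J: "J \<subseteq> {..<n}"
  shows "(\<Sum>i\<in>J. Re (ip k (F i) (F i))) \<le> (\<Sum>l<card J. if l < k then \<mu> l else 0)"
proof -
  let ?q = "\<lambda>i l. ip k (F i) (v l)"
  have fin: "finite J" using J finite_subset by blast
  define t where "t l = (\<Sum>i\<in>J. if \<mu> l > 0 then (cmod (?q i l))\<^sup>2 / \<mu> l else 0)" for l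
  have part: "(\<Sum>i\<in>J. (cmod (?q i l))\<^sup>2) \<le> \<mu> l" if "l < k" for l
    unfolding frame_coeffs(3)[OF v frm_eigvec[OF that] that, symmetric] using J by (intro sum_mono2) auto
  have mt: "(\<Sum>i\<in>J. (cmod (?q i l))\<^sup>2) = \<mu> l * t l" if l: "l < k" for l
  proof (cases "\<mu> l > 0")
    case True
    then show ?thesis by (simp add: t_def sum_distrib_left)
  next
    case False
    then have "\<mu> l = 0" using frm_eigval_nonneg[OF l] by simp
    with part[OF l] have "(\<Sum>i\<in>J. (cmod (?q i l))\<^sup>2) = 0" by (simp add: order_antisym sum_nonneg)
    then show ?thesis using \<open>\<mu> l = 0\<close> by simp
  qed
  have t: "0 \<le> t l \<and> t l \<le> 1" if l: "l < k" for l
  proof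
    show "0 \<le> t l" unfolding t_def by (intro sum_nonneg) auto
    show "t l \<le> 1"
    proof (cases "\<mu> l > 0")
      case True
      then have "\<mu> l * t l \<le> \<mu> l * 1" using part[OF l] mt[OF l] by simp
      then show ?thesis using True by simp
    qed (simp add: t_def)
  qed
  have "(\<Sum>l<k. t l) = (\<Sum>i\<in>J. \<Sum>l<k. if \<mu> l > 0 then (cmod (?q i l))\<^sup>2 / \<mu> l else 0)"
    unfolding t_def by (rule sum.swap)
  also have "\<dots> \<le> (\<Sum>i\<in>J. 1)" using frame_bessel J by (intro sum_mono) auto
  finally have tJ: "(\<Sum>l<k. t l) \<le> card J" by simp
  have tk: "(\<Sum>l<k. t l) \<le> k" using sum_mono[of "{..<k}" t "\<lambda>_. 1"] t by simp
  have "(\<Sum>i\<in>J. Re (ip k (F i) (F i))) = (\<Sum>l<k. \<mu> l * t l)"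
    unfolding Re_ip_parseval by (subst sum.swap) (intro sum.cong refl mt, simp)
  also have "\<dots> \<le> (\<Sum>l<min (card J) k. \<mu> l)"
    using tJ tk frm_eigval_nonneg by (intro sum_mult_weights_le_prefix[OF dec t]) (auto simp: min_def)
  also have "\<dots> = (\<Sum>l<card J. if l < k then \<mu> l else 0)"
    by (intro sum.mono_neutral_cong_left) auto
  finally show ?thesis .
qed

end

section \<open>The lower bound and the uniqueness of the optimal spectra\<close>

context kkt
begin

abbreviation \<mu> :: "nat \<Rightarrow> nat \<Rightarrow> real" where
  "\<mu> j \<equiv> fill C (\<kappa> j)"

definition opt :: real where
  "opt = (\<Sum>j<m. \<Sum>i<d j. (\<mu> j i - \<kappa> j i)\<^sup>2)"

lemma \<mu>_dec: "j < m \<Longrightarrow> i \<le> l \<Longrightarrow> l < d j \<Longrightarrow> \<mu> j l \<le> \<mu> j i"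
  using \<kappa>_dec[of j i l] C_dec[of i l] dn[of j] by (simp add: fill_def)

text \<open>Strong convexity keeps the squared distance of the two spectra in the bound. This gap
  later forces the spectra of an optimal design.\<close>

theorem dev_lower_bound:
  assumes f: "admissible f"
  shows "\<exists>y \<mu>'. (\<forall>j. onb (d j) (y j) \<and> (\<forall>i l. i \<le> l \<longrightarrow> l < d j \<longrightarrow> \<mu>' j l \<le> \<mu>' j i) \<and>
      (\<forall>a<d j. \<forall>b<d j. frm n (f j) a b = spec (d j) (\<mu>' j) (y j) a b)) \<and>
    opt + (\<Sum>j<m. \<Sum>i<d j. (\<mu>' j i - \<mu> j i)\<^sup>2) \<le> dev f"
proof -
  have "\<exists>y \<mu>'. onb (d j) y \<and> (\<forall>i l. i \<le> l \<longrightarrow> l < d j \<longrightarrow> \<mu>' l \<le> \<mu>' i) \<and>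
      (\<forall>a<d j. \<forall>b<d j. frm n (f j) a b = spec (d j) \<mu>' y a b)" for j
    by (rule ex_spectral_decomposition[OF frm_hermitian])
  then obtain y \<mu>' where y: "\<And>j. onb (d j) (y j)"
    and \<mu>': "\<And>j i l. i \<le> l \<Longrightarrow> l < d j \<Longrightarrow> \<mu>' j l \<le> \<mu>' j i"
    and frm: "\<And>j a b. a < d j \<Longrightarrow> b < d j \<Longrightarrow> frm n (f j) a b = spec (d j) (\<mu>' j) (y j) a b" by metis
  have \<mu>'0: "0 \<le> \<mu>' j i" if "i < d j" for j i
    using frm_eigval_nonneg[OF y frm that] .
  define W where "W i = (\<Sum>j<m. if i < d j then \<mu>' j i else 0)" for i
  have swapC: "(\<Sum>j<m. \<Sum>i<d j. G i * \<mu>' j i) = (\<Sum>i<n. G i * W i)" for G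
  proof -
    have "(\<Sum>j<m. \<Sum>i<d j. G i * \<mu>' j i) = (\<Sum>j<m. \<Sum>i<n. G i * (if i < d j then \<mu>' j i else 0))"
      using dn by (intro sum.cong refl sum.mono_neutral_cong_left) auto
    then show ?thesis unfolding W_def sum_distrib_left by (subst (asm) sum.swap)
  qed
  have \<alpha>_sum: "(\<Sum>i\<in>J. \<alpha> i) = (\<Sum>j<m. \<Sum>i\<in>J. Re (ip (d j) (f j i) (f j i)))" if "J \<subseteq> {..<n}" for J
  proof -
    have "(\<Sum>i\<in>J. \<alpha> i) = (\<Sum>i\<in>J. weight f i)"
      using f that by (intro sum.cong) (auto simp: admissible_def)
    then show ?thesis unfolding weight_def by (subst sum.swap)
  qed
  \<comment> \<open>Ky Fan's inequality, applied in every block to the images of initial segments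
    under \<open>\<pi>\<close>, bounds the partial sums of the permuted weights by those of
    \<open>W\<close>.\<close>
  have "(\<Sum>i<n. C i * \<alpha> (\<pi> i)) \<le> (\<Sum>i<n. C i * W i)"
  proof (rule sum_mult_mono_prefix[OF C_dec])
    fix l assume l: "l < n"
    have inj: "inj_on \<pi> {..<l}" using \<pi> l by (auto simp: bij_betw_def intro: inj_on_subset)
    have sub: "\<pi> ` {..<l} \<subseteq> {..<n}" using \<pi> l by (auto simp: bij_betw_def)
    have "(\<Sum>i<l. \<alpha> (\<pi> i)) = (\<Sum>i\<in>\<pi> ` {..<l}. \<alpha> i)" by (simp add: sum.reindex[OF inj])
    also have "\<dots> = (\<Sum>j<m. \<Sum>i\<in>\<pi> ` {..<l}. Re (ip (d j) (f j i) (f j i)))" by (rule \<alpha>_sum[OF sub])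
    also have "\<dots> \<le> (\<Sum>j<m. \<Sum>i<card (\<pi> ` {..<l}). if i < d j then \<mu>' j i else 0)"
      using frame_ky_fan[OF y frm \<mu>' sub] by (intro sum_mono)
    also have "\<dots> = (\<Sum>i<l. W i)" unfolding W_def card_image[OF inj] by (simp, rule sum.swap)
    finally show "(\<Sum>i<l. \<alpha> (\<pi> i)) \<le> (\<Sum>i<l. W i)" .
  next
    have "(\<Sum>i<n. \<alpha> (\<pi> i)) = (\<Sum>i<n. \<alpha> i)" by (rule sum.reindex_bij_betw[OF \<pi>])
    also have "\<dots> = (\<Sum>j<m. \<Sum>i<n. Re (ip (d j) (f j i) (f j i)))" by (rule \<alpha>_sum) simp
    also have "\<dots> = (\<Sum>j<m. \<Sum>i<d j. \<mu>' j i)" using frm_trace[OF y frm] by simp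
    also have "\<dots> = (\<Sum>i<n. W i)" using swapC[of "\<lambda>_. 1"] by simp
    finally show "(\<Sum>i<n. \<alpha> (\<pi> i)) = (\<Sum>i<n. W i)" .
  qed
  then have CW: "(\<Sum>j<m. \<Sum>i<d j. C i * \<mu> j i) \<le> (\<Sum>j<m. \<Sum>i<d j. C i * \<mu>' j i)"
    unfolding complementary swapC .
  have arith: "r + s + 2 * (t - u) \<le> v \<Longrightarrow> v \<le> w \<Longrightarrow> u \<le> t \<Longrightarrow> r + s \<le> w"
    for r s t u v w :: real by argo
  \<comment> \<open>Either \<open>\<mu> j i - \<kappa> j i = C i\<close>, or
    \<open>\<mu> j i = 0\<close> and \<open>C i \<le> - \<kappa> j i\<close> is multiplied by
    \<open>\<mu>' j i \<ge> 0\<close>. The rest is the expansion of the square around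
    \<open>\<mu> j i\<close>.\<close>
  have "(\<mu> j i - \<kappa> j i)\<^sup>2 + (\<mu>' j i - \<mu> j i)\<^sup>2 + 2 * (C i * \<mu>' j i - C i * \<mu> j i) \<le> (\<mu>' j i - \<kappa> j i)\<^sup>2"
    if i: "i < d j" for j i
  proof -
    have "C i * (\<mu>' j i - \<mu> j i) \<le> (\<mu> j i - \<kappa> j i) * (\<mu>' j i - \<mu> j i)"
    proof (cases "C i + \<kappa> j i > 0")
      case False
      then have "\<mu> j i = 0" by (simp add: fill_def)
      then show ?thesis using mult_right_mono[of "C i" "- \<kappa> j i", OF _ \<mu>'0[OF i]] False by simp
    qed (simp add: fill_def)
    then show ?thesis by (simp add: power2_eq_square algebra_simps)
  qed
  then have "(\<Sum>j<m. \<Sum>i<d j. (\<mu> j i - \<kappa> j i)\<^sup>2 + (\<mu>' j i - \<mu> j i)\<^sup>2 + 2 * (C i * \<mu>' j i - C i * \<mu> j i))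
     \<le> (\<Sum>j<m. \<Sum>i<d j. (\<mu>' j i - \<kappa> j i)\<^sup>2)"
    by (intro sum_mono) auto
  moreover have "(\<Sum>j<m. \<Sum>i<d j. (\<mu>' j i - \<kappa> j i)\<^sup>2) \<le> dev f"
    unfolding dev_def
  proof (rule sum_mono)
    fix j assume "j \<in> {..<m}"
    then have j: "j < m" by simp
    let ?D = "\<Sum>a<d j. \<Sum>b<d j. (cmod (frm n (f j) a b - B j a b))\<^sup>2"
    have "(\<Sum>i<d j. (\<mu>' j i - \<kappa> j i)\<^sup>2)
      \<le> (\<Sum>a<d j. \<Sum>b<d j. (cmod (spec (d j) (\<mu>' j) (y j) a b - spec (d j) (\<kappa> j) (x j) a b))\<^sup>2)"
      by (rule sum_square_diff_le_frobenius[OF x[OF j] y \<kappa>_dec[OF j] \<mu>'])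
    also have "\<dots> = ?D"
      by (intro sum.cong refl) (simp add: frm B_spec[OF j])
    finally show "(\<Sum>i<d j. (\<mu>' j i - \<kappa> j i)\<^sup>2) \<le> ?D" .
  qed
  ultimately have "opt + (\<Sum>j<m. \<Sum>i<d j. (\<mu>' j i - \<mu> j i)\<^sup>2) \<le> dev f"
    using CW unfolding opt_def sum.distrib sum_subtractf sum_distrib_left[symmetric] by (rule arith)
  then show ?thesis
    by (intro exI[of _ y] exI[of _ \<mu>'] conjI allI impI y \<mu>' frm)
qed

lemma dev_eq_opt:
  assumes frm: "\<And>j a b. j < m \<Longrightarrow> a < d j \<Longrightarrow> b < d j \<Longrightarrow> frm n (f j) a b = spec (d j) (\<mu> j) (x j) a b"
  shows "dev f = opt"
  unfolding dev_def opt_def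
proof (rule sum.cong[OF refl])
  fix j assume "j \<in> {..<m}"
  then have j: "j < m" by simp
  let ?D = "\<Sum>a<d j. \<Sum>b<d j. (cmod (frm n (f j) a b - B j a b))\<^sup>2"
  have "?D
    = (\<Sum>a<d j. \<Sum>b<d j. (cmod (spec (d j) (\<mu> j) (x j) a b - spec (d j) (\<kappa> j) (x j) a b))\<^sup>2)"
    by (intro sum.cong refl) (simp add: frm[OF j] B_spec[OF j])
  then show "?D = (\<Sum>i<d j. (\<mu> j i - \<kappa> j i)\<^sup>2)"
    unfolding frobenius_spec_same_basis[OF x[OF j]] .
qed

theorem opt_le_dev:
  assumes "admissible f"
  shows "opt \<le> dev f"
proof -
  obtain \<mu>' where "opt + (\<Sum>j<m. \<Sum>i<d j. (\<mu>' j i - \<mu> j i)\<^sup>2) \<le> dev f"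
    using dev_lower_bound[OF assms] by blast
  moreover have "0 \<le> (\<Sum>j<m. \<Sum>i<d j. (\<mu>' j i - \<mu> j i)\<^sup>2)" by (intro sum_nonneg) auto
  ultimately show ?thesis by linarith
qed

end

theorem (in design_space) locmin_imp_global:
  assumes f: "locmin f" and dn: "\<And>j. j < m \<Longrightarrow> d j \<le> n" and g: "admissible g"
  shows "dev f \<le> dev g"
proof -
  obtain \<pi> C w \<kappa> where K: "kkt m n d \<alpha> B \<pi> C w \<kappa>"
    and frm: "\<forall>j<m. \<forall>a<d j. \<forall>b<d j. frm n (f j) a b = spec (d j) (fill C (\<kappa> j)) (w j) a b"
    using locmin_structure[OF f dn] by blast
  interpret kkt m n d \<alpha> B \<pi> C w \<kappa> by (rule K)
  have "dev f = opt" using frm by (intro dev_eq_opt) blast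
  then show ?thesis using opt_le_dev[OF g] by simp
qed

text \<open>\<open>x\<close> diagonalizes the targets only, so a joint basis is taken from the
  structure of local minimizers, which comes with multipliers \<open>C'\<close> of its own. Its
  spectra are the expected ones because sorted spectra are unique and the gap in
  \<open>dev_lower_bound\<close> vanishes.\<close>

theorem (in kkt) optimal_imp_joint_basis:
  assumes f: "admissible f" and eq: "dev f = opt" and j: "j < m"
  shows "\<exists>w. onb (d j) w \<and>
    (\<forall>a<d j. \<forall>b<d j. frm n (f j) a b = spec (d j) (\<mu> j) w a b \<and> B j a b = spec (d j) (\<kappa> j) w a b)"
proof -
  have "locmin f" using f opt_le_dev eq by (auto simp: locmin_def intro!: exI[of _ 1])
  from locmin_structure[OF this dn] obtain \<pi>' C' w \<kappa>' where K': "kkt m n d \<alpha> B \<pi>' C' w \<kappa>'"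
    and frm: "\<forall>j<m. \<forall>a<d j. \<forall>b<d j. frm n (f j) a b = spec (d j) (fill C' (\<kappa>' j)) (w j) a b" by blast
  interpret K: kkt m n d \<alpha> B \<pi>' C' w \<kappa>' by (rule K')
  from dev_lower_bound[OF f] obtain y \<mu>' where
    y': "\<forall>j. onb (d j) (y j) \<and> (\<forall>i l. i \<le> l \<longrightarrow> l < d j \<longrightarrow> \<mu>' j l \<le> \<mu>' j i) \<and>
      (\<forall>a<d j. \<forall>b<d j. frm n (f j) a b = spec (d j) (\<mu>' j) (y j) a b)"
    and le: "opt + (\<Sum>j<m. \<Sum>i<d j. (\<mu>' j i - \<mu> j i)\<^sup>2) \<le> dev f" by blast
  from y' have y: "onb (d j) (y j)" and \<mu>': "\<And>i l. i \<le> l \<Longrightarrow> l < d j \<Longrightarrow> \<mu>' j l \<le> \<mu>' j i"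
    and frm': "\<And>a b. a < d j \<Longrightarrow> b < d j \<Longrightarrow> frm n (f j) a b = spec (d j) (\<mu>' j) (y j) a b" by blast+
  have "(\<Sum>j<m. \<Sum>i<d j. (\<mu>' j i - \<mu> j i)\<^sup>2) = 0"
    using le eq by (intro order_antisym sum_nonneg) auto
  then have "\<forall>j\<in>{..<m}. (\<Sum>i<d j. (\<mu>' j i - \<mu> j i)\<^sup>2) = 0"
    by (subst (asm) sum_nonneg_eq_0_iff) (auto intro: sum_nonneg)
  then have "(\<Sum>i<d j. (\<mu>' j i - \<mu> j i)\<^sup>2) = 0" using j by simp
  then have \<mu>'_eq: "\<mu>' j i = \<mu> j i" if "i < d j" for i
    using that by (subst (asm) sum_nonneg_eq_0_iff) auto
  have \<mu>_eq: "K.\<mu> j i = \<mu>' j i" if "i < d j" for i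
    using frm j frm' by (intro sorted_spec_unique[OF y K.x[OF j] \<mu>' K.\<mu>_dec[OF j] _ that]) simp_all
  have \<kappa>_eq: "\<kappa>' j i = \<kappa> j i" if "i < d j" for i
    using K.B_spec[OF j] B_spec[OF j]
    by (intro sorted_spec_unique[OF x[OF j] K.x[OF j] \<kappa>_dec[OF j] K.\<kappa>_dec[OF j] _ that]) simp_all
  have "spec (d j) (K.\<mu> j) (w j) a b = spec (d j) (\<mu> j) (w j) a b"
    "spec (d j) (\<kappa>' j) (w j) a b = spec (d j) (\<kappa> j) (w j) a b" for a b
    by (rule spec_cong, simp add: \<mu>_eq \<mu>'_eq \<kappa>_eq)+
  with K.x[OF j] K.B_spec[OF j] frm j show ?thesis by (intro exI[of _ "w j"]) simp
qed

section \<open>Designs with prescribed frame operators and norms\<close>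

context design_space
begin

text \<open>The vectors at \<open>p\<close> and \<open>q\<close> are mixed by the same rotation in
  all blocks. At the angle \<open>pi / 2\<close> the two weights are exchanged, so the intermediate
  value theorem reaches every value between them.\<close>

lemma rotate_weights:
  assumes p: "p < n" and q: "q < n" and pq: "p \<noteq> q" and t: "weight f q \<le> t" "t \<le> weight f p"
  shows "\<exists>g. (\<forall>j a b. frm n (g j) a b = frm n (f j) a b) \<and>
    (\<forall>i. weight g i = (if i = p then t else if i = q then weight f p + weight f q - t else weight f i))"
proof -
  define G where "G s j i = (if i = p then (\<lambda>a. of_real (cos s) * f j p a + of_real (sin s) * f j q a)
    else if i = q then (\<lambda>a. of_real (cos s) * f j q a - of_real (sin s) * f j p a) else f j i)" for s j i
  define K where "K = (\<Sum>j<m. Re (ip (d j) (f j p) (f j q)))"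
  have frm_G: "frm n (G s j) a b = frm n (f j) a b" for s j a b
  proof -
    have pair: "G s j p a * cnj (G s j p b) + G s j q a * cnj (G s j q b)
      = f j p a * cnj (f j p b) + f j q a * cnj (f j q b)" (is "?l = _")
    proof -
      have "?l = (of_real (cos s) * f j p a + of_real (sin s) * f j q a) * (of_real (cos s) * cnj (f j p b) + of_real (sin s) * cnj (f j q b))
        + (of_real (cos s) * f j q a - of_real (sin s) * f j p a) * (of_real (cos s) * cnj (f j q b) - of_real (sin s) * cnj (f j p b))"
        using pq by (simp add: G_def)
      also have "\<dots> = of_real (cos s * cos s + sin s * sin s)
          * (f j p a * cnj (f j p b) + f j q a * cnj (f j q b))" by (rule rotation_product)
      finally show ?thesis unfolding cos_sin_product_sum by simp
    qed
    have "(\<Sum>i\<in>{..<n} - {p, q}. G s j i a * cnj (G s j i b)) = (\<Sum>i\<in>{..<n} - {p, q}. f j i a * cnj (f j i b))"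
      by (intro sum.cong) (auto simp: G_def)
    then show ?thesis
      unfolding frm_def sum_lessThan_split2[OF p q pq] pair by simp
  qed
  have rest: "weight (G s) i = weight f i" if "i \<noteq> p" "i \<noteq> q" for s i
    using that by (simp add: weight_def G_def)
  have wp: "weight (G s) p = cos s * cos s * weight f p + sin s * sin s * weight f q + 2 * cos s * sin s * K" for s
  proof -
    have "Re (ip (d j) (G s j p) (G s j p)) = cos s * cos s * Re (ip (d j) (f j p) (f j p))
      + sin s * sin s * Re (ip (d j) (f j q) (f j q)) + 2 * cos s * sin s * Re (ip (d j) (f j p) (f j q))" for j
    proof -
      have "G s j p = (\<lambda>a. of_real (cos s) * f j p a + of_real (sin s) * f j q a)" by (simp add: G_def)
      then show ?thesis
        using Re_ip_commute[of "d j" "f j q" "f j p"] by (simp only: ip_linear) (simp add: algebra_simps)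
    qed
    then show ?thesis unfolding weight_def K_def sum_distrib_left sum.distrib[symmetric] by simp
  qed
  have wq: "weight (G s) q = cos s * cos s * weight f q + sin s * sin s * weight f p - 2 * cos s * sin s * K" for s
  proof -
    have "Re (ip (d j) (G s j q) (G s j q)) = cos s * cos s * Re (ip (d j) (f j q) (f j q))
      + sin s * sin s * Re (ip (d j) (f j p) (f j p)) - 2 * cos s * sin s * Re (ip (d j) (f j p) (f j q))" for j
    proof -
      have "G s j q = (\<lambda>a. of_real (cos s) * f j q a - of_real (sin s) * f j p a)" using pq by (simp add: G_def)
      then show ?thesis
        using Re_ip_commute[of "d j" "f j q" "f j p"] by (simp only: ip_linear) (simp add: algebra_simps)
    qed
    then show ?thesis
      unfolding weight_def K_def sum_distrib_left sum.distrib[symmetric] sum_subtractf[symmetric] by simp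
  qed
  have "\<exists>s\<ge>0. s \<le> pi / 2 \<and> weight (G s) p = t"
  proof (rule IVT2')
    show "continuous_on {0..pi / 2} (\<lambda>s. weight (G s) p)"
      unfolding wp by (intro continuous_intros)
  qed (use t in \<open>simp_all add: wp\<close>)
  then obtain s where s: "weight (G s) p = t" by blast
  have alg: "(u * u * x + w * w * y + 2 * u * w * z) + (u * u * y + w * w * x - 2 * u * w * z)
    = (u * u + w * w) * (x + y)" for u w x y z :: real by (simp add: algebra_simps)
  have "weight (G s) p + weight (G s) q = (cos s * cos s + sin s * sin s) * (weight f p + weight f q)"
    unfolding wp wq by (rule alg)
  then have "weight (G s) q = weight f p + weight f q - t" unfolding cos_sin_product_sum s by simp
  with s rest frm_G show ?thesis by (intro exI[of _ "G s"]) simp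
qed

text \<open>Each rotation moves weight from an index where it is too large to a later one where it is too
  small, until one of the two is correct.\<close>

lemma ex_admissible_same_frames:
  assumes dec: "\<And>i l. i \<le> l \<Longrightarrow> l < n \<Longrightarrow> \<alpha> l \<le> \<alpha> i"
    and pre: "\<And>l. l \<le> n \<Longrightarrow> (\<Sum>i<l. \<alpha> i) \<le> (\<Sum>i<l. weight f i)"
    and tot: "(\<Sum>i<n. \<alpha> i) = (\<Sum>i<n. weight f i)"
  shows "\<exists>g. admissible g \<and> (\<forall>j a b. frm n (g j) a b = frm n (f j) a b)"
  using pre tot
proof (induction "card {i. i < n \<and> weight f i \<noteq> \<alpha> i}" arbitrary: f rule: less_induct)
  case (less f)
  show ?case
  proof (cases "\<exists>q<n. weight f q < \<alpha> q")
    case False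
    have "(\<Sum>i<n. weight f i - \<alpha> i) = 0" using less.prems(2) by (simp add: sum_subtractf)
    moreover have "0 \<le> weight f i - \<alpha> i" if "i < n" for i
      using False that by (meson diff_ge_0_iff_ge not_le)
    ultimately have "\<forall>i\<in>{..<n}. weight f i - \<alpha> i = 0"
      by (subst (asm) sum_nonneg_eq_0_iff) auto
    then have "admissible f" by (simp add: admissible_def)
    then show ?thesis by blast
  next
    case True
    \<comment> \<open>\<open>q\<close> is the first index with too little weight. All indices before
      it have enough, and the prefix condition up to and including \<open>q\<close> forces a surplus
      at some \<open>p < q\<close>.\<close>
    define q where "q = (LEAST q. q < n \<and> weight f q < \<alpha> q)"
    have q: "q < n" "weight f q < \<alpha> q" using LeastI_ex[OF True] by (simp_all add: q_def)
    have before: "\<alpha> i \<le> weight f i" if "i < q" for i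
      using not_less_Least[of i "\<lambda>q. q < n \<and> weight f q < \<alpha> q"] that q(1) by (auto simp: q_def[symmetric])
    have "\<exists>p<q. weight f p > \<alpha> p"
    proof (rule ccontr)
      assume "\<not> ?thesis"
      then have "weight f i \<le> \<alpha> i" if "i < q" for i using that by (meson not_le)
      then have "(\<Sum>i<q. weight f i) \<le> (\<Sum>i<q. \<alpha> i)" by (intro sum_mono) simp
      then show False using less.prems(1)[of "Suc q"] q by simp
    qed
    then obtain p where p: "p < q" "weight f p > \<alpha> p" by blast
    define t where "t = min (weight f p - \<alpha> p) (\<alpha> q - weight f q)"
    have t: "t > 0" "t \<le> weight f p - \<alpha> p" "t \<le> \<alpha> q - weight f q" using p q by (simp_all add: t_def)
    \<comment> \<open>The order of the prescribed weights puts the new weight at \<open>p\<close>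
      between the two current ones, as a rotation requires.\<close>
    have "\<alpha> q \<le> \<alpha> p" using dec[of p q] p q by simp
    then have "weight f q \<le> weight f p - t" "weight f p - t \<le> weight f p" using t q by simp_all
    from rotate_weights[OF _ q(1) _ this] p q(1) obtain g
      where frm_g: "\<forall>j a b. frm n (g j) a b = frm n (f j) a b"
        and wg: "\<And>i. weight g i = (if i = p then weight f p - t
           else if i = q then weight f p + weight f q - (weight f p - t) else weight f i)" by auto
    have wg': "weight g i = weight f i + (if i = q then t else 0) - (if i = p then t else 0)" for i
      using p by (simp add: wg)
    have sum_g: "(\<Sum>i<l. weight g i) = (\<Sum>i<l. weight f i) + (if q < l then t else 0) - (if p < l then t else 0)" for l
      unfolding wg' by (simp add: sum.distrib sum_subtractf)
    have fewer: "card {i. i < n \<and> weight g i \<noteq> \<alpha> i} < card {i. i < n \<and> weight f i \<noteq> \<alpha> i}"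
    proof (rule psubset_card_mono)
      have "weight g p = \<alpha> p \<or> weight g q = \<alpha> q" using p by (auto simp: wg t_def min_def)
      moreover have "weight f p \<noteq> \<alpha> p" "weight f q \<noteq> \<alpha> q" "p < n" using p q by auto
      moreover have "weight g i \<noteq> \<alpha> i \<Longrightarrow> weight f i \<noteq> \<alpha> i" for i
        using p(2) q(2) by (cases "i = p \<or> i = q") (auto simp: wg)
      ultimately show "{i. i < n \<and> weight g i \<noteq> \<alpha> i} \<subset> {i. i < n \<and> weight f i \<noteq> \<alpha> i}"
        using q(1) by blast
    qed simp
    \<comment> \<open>Prefix sums lose \<open>t\<close> only for \<open>p < l\<close> and
      \<open>l \<le> q\<close>. There no index falls short, and the surplus at \<open>p\<close>
      alone is at least \<open>t\<close>.\<close>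
    have "(\<Sum>i<l. \<alpha> i) \<le> (\<Sum>i<l. weight g i)" if l: "l \<le> n" for l
    proof (cases "p < l \<and> l \<le> q")
      case True
      have "weight f p - \<alpha> p \<le> (\<Sum>i<l. weight f i - \<alpha> i)"
        using True before by (intro member_le_sum) auto
      then show ?thesis using True t unfolding sum_g by (simp add: sum_subtractf)
    next
      case False
      then show ?thesis using less.prems(1)[OF l] p unfolding sum_g by auto
    qed
    moreover have "(\<Sum>i<n. \<alpha> i) = (\<Sum>i<n. weight g i)"
      using less.prems(2) p q unfolding sum_g by simp
    ultimately obtain h where "admissible h" "\<forall>j a b. frm n (h j) a b = frm n (g j) a b"
      using less.hyps[OF fewer] by blast
    with frm_g show ?thesis by (intro exI[of _ h]) simp
  qed
qed

theorem ex_admissible_spec: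
  assumes dn: "\<And>j. j < m \<Longrightarrow> d j \<le> n"
    and x: "\<And>j. j < m \<Longrightarrow> onb (d j) (x j)"
    and \<mu>: "\<And>j i. j < m \<Longrightarrow> i < d j \<Longrightarrow> 0 \<le> \<mu> j i"
    and dec: "\<And>i l. i \<le> l \<Longrightarrow> l < n \<Longrightarrow> \<alpha> l \<le> \<alpha> i"
    and pre: "\<And>l. l \<le> n \<Longrightarrow> (\<Sum>i<l. \<alpha> i) \<le> (\<Sum>i<l. \<Sum>j<m. if i < d j then \<mu> j i else 0)"
    and tot: "(\<Sum>i<n. \<alpha> i) = (\<Sum>i<n. \<Sum>j<m. if i < d j then \<mu> j i else 0)"
  shows "\<exists>g. admissible g \<and> (\<forall>j<m. \<forall>a b. frm n (g j) a b = spec (d j) (\<mu> j) (x j) a b)"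
proof -
  \<comment> \<open>Rescaled eigenvectors, padded with zero vectors up to index \<open>n\<close>.
    The frame operators are already the required ones; only the weights have to be
    corrected.\<close>
  define f where "f j i = (if i < d j then (\<lambda>a. of_real (sqrt (\<mu> j i)) * x j i a) else (\<lambda>_. 0))" for j i
  have "weight f i = (\<Sum>j<m. if i < d j then \<mu> j i else 0)" for i
    unfolding weight_def
  proof (rule sum.cong[OF refl])
    fix j assume "j \<in> {..<m}"
    then have j: "j < m" by simp
    show "Re (ip (d j) (f j i) (f j i)) = (if i < d j then \<mu> j i else 0)"
    proof (cases "i < d j")
      case True
      then have "ip (d j) (x j i) (x j i) = 1" using x[OF j] by (simp add: onb_def)
      then show ?thesis using True \<mu>[OF j True] unfolding f_def by (simp add: ip_linear)
    qed (simp add: f_def ip_def)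
  qed
  then obtain g where g: "admissible g" "\<And>j a b. frm n (g j) a b = frm n (f j) a b"
    using ex_admissible_same_frames[OF dec, of f] pre tot by auto
  have "frm n (f j) a b = spec (d j) (\<mu> j) (x j) a b" if j: "j < m" for j a b
  proof -
    have "frm n (f j) a b = (\<Sum>i<d j. f j i a * cnj (f j i b))"
      unfolding frm_def using dn[OF j] by (intro sum.mono_neutral_right) (auto simp: f_def)
    also have "\<dots> = spec (d j) (\<mu> j) (x j) a b"
      unfolding spec_def
    proof (rule sum.cong[OF refl])
      fix i assume "i \<in> {..<d j}"
      then have i: "i < d j" by simp
      have "complex_of_real (sqrt (\<mu> j i)) * of_real (sqrt (\<mu> j i)) = of_real (\<mu> j i)"
        using \<mu>[OF j i] by (simp flip: of_real_mult)
      then show "f j i a * cnj (f j i b) = of_real (\<mu> j i) * x j i a * cnj (x j i b)"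
        using i by (simp add: f_def mult_ac)
    qed
    finally show ?thesis .
  qed
  with g show ?thesis by auto
qed

end

section \<open>The multipliers given by the optimal constants\<close>

lemma desc_eq_self:
  assumes "sorted_wrt (\<ge>) xs"
  shows "desc xs = xs"
proof -
  have "sort xs = rev xs"
    by (rule properties_for_sort) (use assms in \<open>simp_all add: sorted_wrt_rev\<close>)
  then show ?thesis by (simp add: desc_def)
qed

lemma sorted_wrt_map_upt:
  fixes u :: "nat \<Rightarrow> real"
  assumes "\<And>i j. s \<le> i \<Longrightarrow> i \<le> j \<Longrightarrow> j < e \<Longrightarrow> u j \<le> u i"
  shows "sorted_wrt (\<ge>) (map u [s..<e])"
  using assms by (auto simp: sorted_wrt_iff_nth_less)

lemma majorized_map_upt:
  fixes u w :: "nat \<Rightarrow> real"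
  assumes maj: "majorized (map u [s..<e]) (map w [s..<e'])"
    and u: "\<And>i j. s \<le> i \<Longrightarrow> i \<le> j \<Longrightarrow> j < e \<Longrightarrow> u j \<le> u i"
    and w: "\<And>i j. s \<le> i \<Longrightarrow> i \<le> j \<Longrightarrow> j < e' \<Longrightarrow> w j \<le> w i"
  shows "s \<le> l \<Longrightarrow> l \<le> e \<Longrightarrow> l \<le> e' \<Longrightarrow> (\<Sum>i=s..<l. u i) \<le> (\<Sum>i=s..<l. w i)"
    and "(\<Sum>i=s..<e. u i) = (\<Sum>i=s..<e'. w i)"
proof -
  have du: "desc (map u [s..<e]) = map u [s..<e]" and dw: "desc (map w [s..<e']) = map w [s..<e']"
    by (rule desc_eq_self, rule sorted_wrt_map_upt, erule (2) u, rule desc_eq_self, rule sorted_wrt_map_upt, erule (2) w)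
  have sums: "sum_list (map g [i..<j]) = (\<Sum>k=i..<j. g k)" for g :: "nat \<Rightarrow> real" and i j
    by (simp add: sum_list_distinct_conv_sum_set)
  show "(\<Sum>i=s..<e. u i) = (\<Sum>i=s..<e'. w i)"
    using maj by (simp add: majorized_def sums)
  assume l: "s \<le> l" "l \<le> e" "l \<le> e'"
  show "(\<Sum>i=s..<l. u i) \<le> (\<Sum>i=s..<l. w i)"
  proof (cases "l = s")
    case False
    have "l - s \<in> {1..min (length (map u [s..<e])) (length (map w [s..<e']))}" using l False by auto
    then have "sum_list (take (l - s) (map u [s..<e])) \<le> sum_list (take (l - s) (map w [s..<e']))"
      using maj unfolding majorized_def du dw by blast
    then show ?thesis using l by (simp add: take_map sums)
  qed simp
qed

text \<open>Blockwise inequalities glue together because the totals agree at the end of each block.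
  As \<open>C\<close> is constant on a block, the block totals alone give the weighted equation,
  which is the source of complementary slackness for the constants \<open>c\<close>.\<close>

lemma prefix_sums_of_blocks:
  fixes u w C :: "nat \<Rightarrow> real" and b :: "nat \<Rightarrow> nat"
  assumes b0: "b 0 = 0" and mono: "\<And>k. k < p \<Longrightarrow> b k \<le> b (Suc k)"
    and pre: "\<And>k l. k < p \<Longrightarrow> b k \<le> l \<Longrightarrow> l \<le> b (Suc k) \<Longrightarrow> (\<Sum>i=b k..<l. u i) \<le> (\<Sum>i=b k..<l. w i)"
    and tot: "\<And>k. k < p \<Longrightarrow> (\<Sum>i=b k..<b (Suc k). u i) = (\<Sum>i=b k..<b (Suc k). w i)"
    and C: "\<And>k i. k < p \<Longrightarrow> b k \<le> i \<Longrightarrow> i < b (Suc k) \<Longrightarrow> C i = e k"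
    and K: "K \<le> p"
  shows "l \<le> b K \<Longrightarrow> (\<Sum>i<l. u i) \<le> (\<Sum>i<l. w i)"
    and "(\<Sum>i<b K. u i) = (\<Sum>i<b K. w i)"
    and "(\<Sum>i<b K. C i * w i) = (\<Sum>i<b K. C i * u i)"
proof -
  have split: "(\<Sum>i<l. g i) = (\<Sum>i<k. g i) + (\<Sum>i=k..<l. g i)" if "k \<le> l" for g :: "nat \<Rightarrow> real" and k l
    using that sum.atLeastLessThan_concat[of 0 k l g] by (simp add: lessThan_atLeast0)
  have "(\<forall>l\<le>b K. (\<Sum>i<l. u i) \<le> (\<Sum>i<l. w i)) \<and> (\<Sum>i<b K. u i) = (\<Sum>i<b K. w i) \<and>
    (\<Sum>i<b K. C i * w i) = (\<Sum>i<b K. C i * u i)"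
    using K
  proof (induction K)
    case (Suc K)
    then have K: "K < p" by simp
    with Suc have IH: "\<And>l. l \<le> b K \<Longrightarrow> (\<Sum>i<l. u i) \<le> (\<Sum>i<l. w i)" "(\<Sum>i<b K. u i) = (\<Sum>i<b K. w i)"
      "(\<Sum>i<b K. C i * w i) = (\<Sum>i<b K. C i * u i)" by auto
    have const: "(\<Sum>i=b K..<b (Suc K). C i * g i) = e K * (\<Sum>i=b K..<b (Suc K). g i)" for g
      unfolding sum_distrib_left using C[OF K] by (intro sum.cong) auto
    have "(\<Sum>i<l. u i) \<le> (\<Sum>i<l. w i)" if "l \<le> b (Suc K)" for l
    proof (cases "l \<le> b K")
      case False
      then show ?thesis using pre[OF K, of l] that IH(2) by (simp add: split[of "b K" l])
    qed (rule IH(1))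
    moreover have "(\<Sum>i<b (Suc K). u i) = (\<Sum>i<b (Suc K). w i)"
      using IH(2) tot[OF K] by (simp add: split[OF mono[OF K]])
    moreover have "(\<Sum>i<b (Suc K). C i * w i) = (\<Sum>i<b (Suc K). C i * u i)"
      unfolding split[OF mono[OF K]] const IH(3) tot[OF K] ..
    ultimately show ?case by blast
  qed (simp add: b0)
  then show "l \<le> b K \<Longrightarrow> (\<Sum>i<l. u i) \<le> (\<Sum>i<l. w i)" "(\<Sum>i<b K. u i) = (\<Sum>i<b K. w i)"
    "(\<Sum>i<b K. C i * w i) = (\<Sum>i<b K. C i * u i)" by auto
qed

lemma ex_block_of_index:
  fixes b :: "nat \<Rightarrow> nat"
  assumes "b 0 = 0" "i < b p"
  shows "\<exists>k<p. b k \<le> i \<and> i < b (Suc k)"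
  using assms by (induction p) (auto simp: not_less less_Suc_eq, metis leI)

lemma nth_concat_replicate:
  fixes cs :: "'a list"
  assumes ss: "length ss = p" and k: "k < p"
    and i: "sum_list (take k ss) \<le> i" "i < sum_list (take (Suc k) ss)"
  shows "concat (map (\<lambda>k. replicate (ss ! k) (cs ! k)) [0..<p]) ! i = cs ! k"
proof -
  let ?f = "\<lambda>k. replicate (ss ! k) (cs ! k)"
  have len: "length (concat (map ?f [0..<k])) = sum_list (take k ss)" if "k \<le> p" for k
    using that ss by (induction k) (auto simp: take_Suc_conv_app_nth)
  have "[0..<p] = [0..<k] @ k # [Suc k..<p]"
    using k by (metis upt_add_eq_append upt_conv_Cons less_imp_le_nat le_add_diff_inverse zero_le)
  then have "concat (map ?f [0..<p]) = concat (map ?f [0..<k]) @ ?f k @ concat (map ?f [Suc k..<p])" by simp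
  moreover have "i - sum_list (take k ss) < ss ! k"
    using i k ss by (simp add: take_Suc_conv_app_nth)
  ultimately show ?thesis using i(1) len[of k] k by (simp add: nth_append)
qed

lemma water_antimono:
  assumes inc: "\<And>j i l. j < length d \<Longrightarrow> i \<le> l \<Longrightarrow> l < d ! j \<Longrightarrow> lam_tilde d \<Phi>0 j ! i \<le> lam_tilde d \<Phi>0 j ! l"
    and il: "i \<le> l"
  shows "water d \<Phi>0 t l \<le> water d \<Phi>0 t i"
proof -
  have "water d \<Phi>0 t l \<le> (\<Sum>j | j < length d \<and> l < d ! j. max (t - lam_tilde d \<Phi>0 j ! i) 0)"
    unfolding water_def
  proof (rule sum_mono)
    fix j assume "j \<in> {j. j < length d \<and> l < d ! j}"
    then show "max (t - lam_tilde d \<Phi>0 j ! l) 0 \<le> max (t - lam_tilde d \<Phi>0 j ! i) 0"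
      using inc[of j i l] il by auto
  qed
  also have "\<dots> \<le> water d \<Phi>0 t i"
    unfolding water_def using il by (intro sum_mono2) auto
  finally show ?thesis .
qed

text \<open>The constants \<open>c\<close> extended by their last value are the multipliers of the optimal spectra.\<close>

lemma optimal_constants_prefix_sums:
  assumes opt: "optimal_constants \<alpha> d \<Phi>0 c"
    and d0: "d ! 0 \<le> length \<alpha>" "d ! 0 \<ge> 1" and d_le: "\<And>j. j < length d \<Longrightarrow> d ! j \<le> d ! 0"
    and \<alpha>: "sorted_wrt (\<ge>) \<alpha>" "\<forall>i<length \<alpha>. \<alpha> ! i > 0"
    and inc: "\<And>j i l. j < length d \<Longrightarrow> i \<le> l \<Longrightarrow> l < d ! j \<Longrightarrow> lam_tilde d \<Phi>0 j ! i \<le> lam_tilde d \<Phi>0 j ! l"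
  defines "W \<equiv> \<lambda>i. \<Sum>j<length d. if i < d ! j then max (c ! i - lam_tilde d \<Phi>0 j ! i) 0 else 0"
    and "C \<equiv> \<lambda>i. c ! min i (d ! 0 - 1)"
  shows "i \<le> l \<Longrightarrow> C l \<le> C i"
    and "l \<le> length \<alpha> \<Longrightarrow> (\<Sum>i<l. \<alpha> ! i) \<le> (\<Sum>i<l. W i)"
    and "(\<Sum>i<length \<alpha>. \<alpha> ! i) = (\<Sum>i<length \<alpha>. W i)"
    and "(\<Sum>i<length \<alpha>. C i * W i) = (\<Sum>i<length \<alpha>. C i * \<alpha> ! i)"
proof -
  let ?n = "length \<alpha>"
  from opt obtain cs ss where p1: "length cs \<ge> 1" and ss: "length ss = length cs"
    and cs: "sorted_wrt (>) cs" and ss1: "\<forall>s\<in>set ss. s \<ge> 1" and sum_ss: "sum_list ss = d ! 0"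
    and c: "c = concat (map (\<lambda>k. replicate (ss ! k) (cs ! k)) [0..<length cs])"
    and maj: "\<forall>k<length cs - 1. majorized (map (\<lambda>i. \<alpha> ! i) [sum_list (take k ss)..<sum_list (take (k + 1) ss)])
                             (map (water d \<Phi>0 (cs ! k)) [sum_list (take k ss)..<sum_list (take (k + 1) ss)])"
    and maj_last: "majorized (map (\<lambda>i. \<alpha> ! i) [sum_list (take (length cs - 1) ss)..<?n])
                  (map (water d \<Phi>0 (cs ! (length cs - 1))) [sum_list (take (length cs - 1) ss)..<d ! 0])"
    unfolding optimal_constants_def Let_def by blast
  define p where "p = length cs"
  define b where "b k = sum_list (take k ss)" for k
  \<comment> \<open>The block boundaries, except that the last block ends at \<open>?n\<close>
    instead of \<open>d ! 0\<close>.\<close>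
  define b' where "b' k = (if k < p then b k else ?n)" for k
  note p1 = p1[folded p_def] and ss = ss[folded p_def] and c = c[folded p_def]
    and maj = maj[folded p_def b_def] and maj_last = maj_last[folded p_def b_def]
  have b0: "b 0 = 0" and bp: "b p = d ! 0" using ss sum_ss by (simp_all add: b_def)
  have b_Suc: "b (Suc k) = b k + ss ! k" if "k < p" for k
    using that ss by (simp add: b_def take_Suc_conv_app_nth)
  have b_mono: "b k \<le> b k'" if "k \<le> k'" for k k'
    using that unfolding b_def by (metis le_add_diff_inverse2 le_iff_add sum_list_append take_add)
  have c_nth: "c ! i = cs ! k" if "k < p" "b k \<le> i" "i < b (Suc k)" for k i
    unfolding c using nth_concat_replicate[OF ss that(1)] that(2,3) by (simp add: b_def)
  have block: "\<exists>k<p. b k \<le> i \<and> i < b (Suc k)" if "i < d ! 0" for i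
    using ex_block_of_index[of b i p] b0 bp that by simp
  show C_dec: "C l \<le> C i" if "i \<le> l" for i l
  proof -
    define i' l' where "i' = min i (d ! 0 - 1)" and "l' = min l (d ! 0 - 1)"
    have il: "i' \<le> l'" "l' < d ! 0" using that d0 by (auto simp: i'_def l'_def)
    then obtain k k' where k: "k < p" "b k \<le> i'" "i' < b (Suc k)" and k': "k' < p" "b k' \<le> l'" "l' < b (Suc k')"
      using block[of i'] block[of l'] by auto
    have "k \<le> k'"
    proof (rule ccontr)
      assume "\<not> k \<le> k'"
      then have "b (Suc k') \<le> b k" by (intro b_mono) simp
      then show False using k k' il by simp
    qed
    then have "cs ! k' \<le> cs ! k"
      using cs k' by (cases "k = k'") (auto simp: sorted_wrt_iff_nth_less p_def intro: less_imp_le)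
    then show ?thesis using c_nth[OF k] c_nth[OF k'] by (simp add: C_def i'_def l'_def)
  qed
  have W_water: "W i = water d \<Phi>0 (c ! i) i" for i
    unfolding W_def water_def by (simp add: sum.If_cases Int_def)
  have W0: "W i = 0" if "i \<ge> d ! 0" for i
    unfolding W_def using d_le that by (intro sum.neutral) force
  have \<alpha>_dec: "\<alpha> ! l \<le> \<alpha> ! i" if "i \<le> l" "l < ?n" for i l
    using \<alpha>(1) that by (cases "i = l") (auto simp: sorted_wrt_iff_nth_less)
  have w_dec: "water d \<Phi>0 t l \<le> water d \<Phi>0 t i" if "i \<le> l" for t i l
    by (rule water_antimono[OF inc that])
  have bd: "b k \<le> d ! 0" if "k \<le> p" for k using b_mono[OF that] bp by simp
  have b'_last: "b' p = ?n" by (simp add: b'_def)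
  have W_block: "(\<Sum>i=b k..<l. W i) = (\<Sum>i=b k..<l. water d \<Phi>0 (cs ! k) i)" if "k < p" "l \<le> b (Suc k)" for k l
    using that c_nth by (intro sum.cong) (auto simp: W_water)
  have blocks: "(\<forall>l. b' k \<le> l \<longrightarrow> l \<le> b' (Suc k) \<longrightarrow> (\<Sum>i=b' k..<l. \<alpha> ! i) \<le> (\<Sum>i=b' k..<l. W i)) \<and>
      (\<Sum>i=b' k..<b' (Suc k). \<alpha> ! i) = (\<Sum>i=b' k..<b' (Suc k). W i)" if k: "k < p" for k
  proof (cases "k < p - 1")
    case True
    then have k': "b' k = b k" "b' (Suc k) = b (Suc k)" "Suc k \<le> p" by (auto simp: b'_def)
    have len: "b (Suc k) \<le> ?n" using bd[OF k'(3)] d0 by simp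
    have m: "majorized (map (\<lambda>i. \<alpha> ! i) [b k..<b (Suc k)]) (map (water d \<Phi>0 (cs ! k)) [b k..<b (Suc k)])"
      using maj True by simp
    have \<alpha>': "\<alpha> ! l \<le> \<alpha> ! i" if "b k \<le> i" "i \<le> l" "l < b (Suc k)" for i l
      using \<alpha>_dec that len by simp
    show ?thesis
      unfolding k'(1,2)
      using majorized_map_upt[OF m \<alpha>' w_dec] W_block[OF k] by simp
  next
    case False
    then have k_last: "k = p - 1" using k by simp
    then have k': "b' k = b k" "b' (Suc k) = ?n" "b (Suc k) = d ! 0" using k bp by (auto simp: b'_def)
    have m: "majorized (map (\<lambda>i. \<alpha> ! i) [b k..<?n]) (map (water d \<Phi>0 (cs ! k)) [b k..<d ! 0])"
      using maj_last k_last by simp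
    have \<alpha>': "\<alpha> ! l \<le> \<alpha> ! i" if "b k \<le> i" "i \<le> l" "l < ?n" for i l
      using \<alpha>_dec that by simp
    have bk: "b k \<le> d ! 0" using bd[of k] k by simp
    \<comment> \<open>Beyond \<open>d ! 0\<close> every spectrum is exhausted and \<open>W\<close>
      vanishes, so its sums stop growing. The remaining \<open>\<alpha>\<close> are positive, so
      their partial sums stay below the total.\<close>
    have ext: "(\<Sum>i=b k..<l. W i) = (\<Sum>i=b k..<d ! 0. W i)" if "l \<ge> d ! 0" for l
      using that W0 by (intro sum.mono_neutral_right) auto
    have tot: "(\<Sum>i=b k..<?n. \<alpha> ! i) = (\<Sum>i=b k..<d ! 0. W i)"
      using majorized_map_upt(2)[OF m \<alpha>' w_dec] W_block[OF k, of "d ! 0"] k'(3) by simp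
    have "(\<Sum>i=b k..<l. \<alpha> ! i) \<le> (\<Sum>i=b k..<l. W i)" if l: "b k \<le> l" "l \<le> ?n" for l
    proof (cases "l \<le> d ! 0")
      case True
      then show ?thesis
        using majorized_map_upt(1)[OF m \<alpha>' w_dec l] W_block[OF k, of l] k'(3) by simp
    next
      case False
      have "(\<Sum>i=b k..<l. \<alpha> ! i) \<le> (\<Sum>i=b k..<?n. \<alpha> ! i)"
        using l \<alpha>(2) by (intro sum_mono2) (auto intro: less_imp_le)
      then show ?thesis using tot ext[of l] False by simp
    qed
    then show ?thesis unfolding k'(1,2) using tot ext[OF d0(1)] by simp
  qed
  \<comment> \<open>Past \<open>d ! 0\<close> the index is cut back to \<open>d ! 0 - 1\<close>,
    which lies in the last block because this block has at least one position.\<close>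
  have C_block: "C i = cs ! k" if "k < p" "b' k \<le> i" "i < b' (Suc k)" for k i
  proof (cases "i < d ! 0")
    case True
    have "i < b (Suc k)" using that True bp by (cases "Suc k < p") (auto simp: b'_def not_less_eq less_Suc_eq)
    moreover have "min i (d ! 0 - 1) = i" using True by simp
    ultimately show ?thesis using c_nth[of k i] that by (simp add: C_def b'_def)
  next
    case False
    have "\<not> Suc k < p" using that False bd[of "Suc k"] by (auto simp: b'_def)
    then have Sk: "Suc k = p" using that by simp
    have "ss ! k \<in> set ss" using ss that by simp
    then have "b k < d ! 0" using ss1 b_Suc[OF that(1)] bp Sk by fastforce
    then have "c ! (d ! 0 - 1) = cs ! k" using bp Sk by (intro c_nth[OF that(1)]) auto
    moreover have "min i (d ! 0 - 1) = d ! 0 - 1" using False by simp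
    ultimately show ?thesis by (simp add: C_def)
  qed
  have b'0: "b' 0 = 0" using b0 p1 by (simp add: b'_def)
  have b'_mono: "b' k \<le> b' (Suc k)" if "k < p" for k
    using that b_mono[of k "Suc k"] bd[of k] d0 by (auto simp: b'_def)
  note prefix = prefix_sums_of_blocks[of b' p "\<lambda>i. \<alpha> ! i" W C "\<lambda>k. cs ! k", OF b'0 b'_mono _ _ C_block order_refl]
  show "(\<Sum>i<l. \<alpha> ! i) \<le> (\<Sum>i<l. W i)" if "l \<le> ?n" for l
    by (rule prefix(1)) (use blocks that b'_last in auto)
  show "(\<Sum>i<?n. \<alpha> ! i) = (\<Sum>i<?n. W i)"
    unfolding b'_last[symmetric] by (rule prefix(2)) (use blocks in auto)
  show "(\<Sum>i<?n. C i * W i) = (\<Sum>i<?n. C i * \<alpha> ! i)"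
    unfolding b'_last[symmetric] by (rule prefix(3)) (use blocks in auto)
qed

section \<open>Translation to matrices\<close>

definition vec_fun :: "complex vec \<Rightarrow> cvec" where
  "vec_fun x a = x $ a"

definition entries :: "complex mat \<Rightarrow> cmat" where
  "entries A a b = A $$ (a, b)"

lemma hermitian_on_cong:
  assumes h: "hermitian_on k A" and eq: "\<And>a b. a < k \<Longrightarrow> b < k \<Longrightarrow> A' a b = A a b"
  shows "hermitian_on k A'"
  unfolding hermitian_on_def
proof (intro allI impI)
  fix a b assume ab: "a < k" "b < k"
  have "A a b = cnj (A b a)" using h ab unfolding hermitian_on_def by blast
  then show "A' a b = cnj (A' b a)" by (simp only: eq ab)
qed

lemma mat_sum_carrier:
  assumes "set As \<subseteq> carrier_mat k k"
  shows "mat_sum k As \<in> carrier_mat k k"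
  using assms by (induction As) (auto simp: mat_sum_def)

lemma mat_sum_index:
  assumes "set As \<subseteq> carrier_mat k k" "a < k" "b < k"
  shows "mat_sum k As $$ (a, b) = (\<Sum>i<length As. As ! i $$ (a, b))"
  using assms(1)
proof (induction As)
  case Nil
  then show ?case using assms by (simp add: mat_sum_def)
next
  case (Cons A As)
  then have "mat_sum k As \<in> carrier_mat k k" by (intro mat_sum_carrier) simp
  moreover have "mat_sum k (A # As) = A + mat_sum k As" by (simp add: mat_sum_def)
  ultimately show ?case using Cons assms(2,3) by (simp add: sum.lessThan_Suc_shift del: sum.lessThan_Suc)
qed

lemma frame_op_carrier:
  assumes "set fs \<subseteq> carrier_vec k"
  shows "frame_op k fs \<in> carrier_mat k k"
  unfolding frame_op_def using assms by (intro mat_sum_carrier) (auto simp: outer_prod_def)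

lemma frame_op_entries:
  assumes "set fs \<subseteq> carrier_vec k" "a < k" "b < k"
  shows "entries (frame_op k fs) a b = frm (length fs) (\<lambda>i. vec_fun (fs ! i)) a b"
proof -
  have dim: "dim_vec (fs ! i) = k" if "i < length fs" for i
    using assms(1) that nth_mem by fastforce
  have "entries (frame_op k fs) a b = (\<Sum>i<length fs. outer_prod (fs ! i) (fs ! i) $$ (a, b))"
    unfolding frame_op_def entries_def using assms
    by (subst mat_sum_index) (auto simp: outer_prod_def)
  then show ?thesis
    using assms(2,3) by (simp add: frm_def vec_fun_def outer_prod_def dim)
qed

lemma cscalar_prod_eq_ip:
  assumes "v \<in> carrier_vec k" "w \<in> carrier_vec k"
  shows "v \<bullet>c w = ip k (vec_fun v) (vec_fun w)"
  using assms by (simp add: scalar_prod_def ip_def vec_fun_def lessThan_atLeast0)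

lemma vnorm_square:
  assumes "v \<in> carrier_vec k"
  shows "(vnorm v)\<^sup>2 = Re (ip k (vec_fun v) (vec_fun v))"
  unfolding vnorm_def cscalar_prod_eq_ip[OF assms assms] by (simp add: ip_self sum_nonneg)

lemma frobenius_norm_square:
  assumes A: "A \<in> carrier_mat k k"
  shows "(frobenius_norm A)\<^sup>2 = (\<Sum>a<k. \<Sum>b<k. (cmod (entries A a b))\<^sup>2)"
proof -
  have adj: "mat_adjoint A \<in> carrier_mat k k"
    using A by (auto simp: mat_adjoint_def mat_of_rows_def cols_def)
  then have "mat_adjoint A * A \<in> carrier_mat k k" using A by (rule mult_carrier_mat)
  moreover have "(mat_adjoint A * A) $$ (b, b) = (\<Sum>a<k. entries A a b * cnj (entries A a b))" if "b < k" for b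
    using A that
    by (auto simp: mat_adjoint_def scalar_prod_def entries_def lessThan_atLeast0 mult.commute)
  ultimately have "mat_trace (mat_adjoint A * A) = of_real (\<Sum>b<k. \<Sum>a<k. (cmod (entries A a b))\<^sup>2)"
    using adj by (simp add: mat_trace_def complex_norm_square del: of_real_power)
  then have "Re (mat_trace (mat_adjoint A * A)) = (\<Sum>a<k. \<Sum>b<k. (cmod (entries A a b))\<^sup>2)"
    by (simp only: Re_complex_of_real) (rule sum.swap)
  then show ?thesis by (simp add: frobenius_norm_def sum_nonneg)
qed

text \<open>With the basis vectors as columns, \<open>U\<close> conjugates \<open>A\<close> to the
  diagonal matrix of the \<open>r i\<close>. The characteristic polynomial is thus a product of
  linear factors, whose root multiset counts multiplicities correctly.\<close>

lemma eig_desc_spec: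
  assumes A: "A \<in> carrier_mat k k" and w: "onb k w"
    and spec: "\<And>a b. a < k \<Longrightarrow> b < k \<Longrightarrow> entries A a b = spec k r w a b"
  shows "eig_desc A = desc (map r [0..<k])"
proof -
  define U where "U = mat k k (\<lambda>(a, i). w i a)"
  define V where "V = mat k k (\<lambda>(i, a). cnj (w i a))"
  define D where "D = mat k k (\<lambda>(i, l). if i = l then complex_of_real (r i) else 0)"
  have carr: "U \<in> carrier_mat k k" "V \<in> carrier_mat k k" "D \<in> carrier_mat k k"
    by (simp_all add: U_def V_def D_def)
  have UV: "U * V = 1\<^sub>m k"
    by (rule eq_matI) (auto simp: U_def V_def scalar_prod_def lessThan_atLeast0[symmetric] onb_resolution[OF w])
  have VU: "V * U = 1\<^sub>m k" by (rule mat_mult_left_right_inverse[OF carr(1,2) UV])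
  have "A = U * D * V"
  proof (rule eq_matI)
    fix a b assume "a < dim_row (U * D * V)" "b < dim_col (U * D * V)"
    then have ab: "a < k" "b < k" by (simp_all add: U_def V_def)
    have UD: "(U * D) $$ (a, i) = w i a * of_real (r i)" if "i < k" for i
      using ab that
      by (simp add: U_def D_def scalar_prod_def lessThan_atLeast0[symmetric] if_distrib[of "\<lambda>x. _ * x"] cong: if_cong)
    have "(E * V) $$ (a, b) = (\<Sum>i<k. E $$ (a, i) * V $$ (i, b))" if "E \<in> carrier_mat k k" for E
      using ab carr that by (simp add: scalar_prod_def lessThan_atLeast0[symmetric])
    then have "(U * D * V) $$ (a, b) = (\<Sum>i<k. (U * D) $$ (a, i) * V $$ (i, b))"
      using mult_carrier_mat[OF carr(1,3)] by blast
    also have "\<dots> = spec k r w a b"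
      unfolding spec_def using ab by (intro sum.cong refl) (simp add: UD V_def)
    finally show "A $$ (a, b) = (U * D * V) $$ (a, b)" using spec[OF ab] by (simp add: entries_def)
  qed (use A carr in auto)
  then have "similar_mat A D"
    using carr A UV VU unfolding similar_mat_def similar_mat_wit_def Let_def by blast
  then have "char_poly A = char_poly D" by (rule char_poly_similar)
  also have "\<dots> = (\<Prod>a\<leftarrow>diag_mat D. [:- a, 1:])"
    by (rule char_poly_upper_triangular[OF carr(3)]) (auto simp: upper_triangular_def D_def)
  also have "diag_mat D = map (\<lambda>i. complex_of_real (r i)) [0..<k]"
    by (auto simp: diag_mat_def D_def)
  finally have cp: "char_poly A = (\<Prod>i\<leftarrow>[0..<k]. [:- complex_of_real (r i), 1:])" by (simp add: comp_def)
  have "proots (\<Prod>i\<leftarrow>is. [:- complex_of_real (r i), 1:]) = mset (map (\<lambda>i. complex_of_real (r i)) is)" for "is"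
  proof (induction "is")
    case (Cons a "is")
    have "(\<Prod>i\<leftarrow>is. [:- complex_of_real (r i), 1:]) \<noteq> 0" by (auto simp: prod_list_zero_iff)
    with Cons show ?case by (simp add: proots_mult del: mult_pCons_left)
  qed simp
  then have "image_mset Re (proots (char_poly A)) = mset (map r [0..<k])"
    unfolding cp by (simp add: image_mset.compositionality comp_def)
  then show ?thesis unfolding eig_desc_def desc_def by (simp only: sorted_list_of_multiset_mset)
qed

text \<open>The matrix with the vectors as rows has its adjoint as inverse, so its determinant is
  nonzero and the rows are independent. Distinctness ensures that the set of rows still has
  \<open>k\<close> elements.\<close>

lemma onb_imp_orthonormal_basis:
  assumes w: "onb k w"
  shows "orthonormal_basis k (map (\<lambda>i. vec k (w i)) [0..<k])"
proof -
  let ?vs = "map (\<lambda>i. vec k (w i)) [0..<k]"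
  have ip: "?vs ! i \<bullet>c ?vs ! l = (if i = l then 1 else 0)" if "i < k" "l < k" for i l
  proof -
    have "?vs ! i \<bullet>c ?vs ! l = ip k (w i) (w l)"
      using that by (subst cscalar_prod_eq_ip[of _ k]) (auto simp: vec_fun_def intro: ip_cong)
    then show ?thesis using w that by (simp add: onb_def)
  qed
  define U where "U = mat k k (\<lambda>(i, a). w i a)"
  define V where "V = mat k k (\<lambda>(a, i). cnj (w i a))"
  have carr: "U \<in> carrier_mat k k" "V \<in> carrier_mat k k" by (simp_all add: U_def V_def)
  have rows: "rows U = ?vs" by (auto simp: rows_def U_def intro!: nth_equalityI)
  have UV: "U * V = 1\<^sub>m k"
    using w by (intro eq_matI) (auto simp: U_def V_def scalar_prod_def lessThan_atLeast0[symmetric] onb_def ip_def)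
  have "det U * det V = 1" using det_mult[OF carr] UV by simp
  then have det: "det U \<noteq> 0" by auto
  interpret vec_space "TYPE(complex)" k .
  have dist: "distinct ?vs"
    unfolding distinct_conv_nth
  proof (intro allI impI)
    fix i l assume "i < length ?vs" "l < length ?vs" "i \<noteq> l"
    then show "?vs ! i \<noteq> ?vs ! l" using ip[of i l] ip[of i i] by auto
  qed
  have card: "card (set ?vs) = k" using distinct_card[OF dist] by simp
  have li: "lin_indpt (set ?vs)" using det_not_0_imp_lin_indpt_rows[OF carr(1) det] unfolding rows .
  have "basis (set ?vs)"
    by (rule dim_li_is_basis[OF fin_dim _ _ li]) (use card in \<open>auto simp: dim_is_n\<close>)
  with ip show ?thesis by (simp add: orthonormal_basis_def)
qed

lemma spectral_sum_carrier: "spectral_sum k \<mu> (map (\<lambda>i. vec k (w i)) [0..<k]) \<in> carrier_mat k k"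
  unfolding spectral_sum_def by (intro mat_sum_carrier) (auto simp: outer_prod_def)

lemma spectral_sum_entries:
  assumes "a < k" "b < k"
  shows "entries (spectral_sum k \<mu> (map (\<lambda>i. vec k (w i)) [0..<k])) a b = spec k (\<lambda>i. \<mu> ! i) w a b"
  unfolding entries_def spectral_sum_def spec_def using assms
  by (subst mat_sum_index) (auto simp: outer_prod_def intro!: sum.cong)

lemma eq_mat_by_entries:
  assumes "A \<in> carrier_mat k k" "A' \<in> carrier_mat k k" "\<And>a b. a < k \<Longrightarrow> b < k \<Longrightarrow> entries A a b = entries A' a b"
  shows "A = A'"
  using assms by (intro eq_matI) (auto simp: entries_def)

lemma sum_list_square_desc: "(\<Sum>x\<leftarrow>desc xs. x\<^sup>2) = (\<Sum>x\<leftarrow>xs. x\<^sup>2 :: real)"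
proof -
  have "sum_mset (image_mset (\<lambda>x. x\<^sup>2) (mset (desc xs))) = sum_mset (image_mset (\<lambda>x. x\<^sup>2) (mset xs))"
    by (simp add: desc_def)
  then show ?thesis by (simp only: mset_map[symmetric] sum_mset_sum_list)
qed

text \<open>In an eigenbasis the matrix is diagonal. Consequently the spectra of the differences
  alone determine the value of \<open>Theta\<close>.\<close>

lemma frobenius_norm_square_eig:
  assumes A: "A \<in> carrier_mat k k" and h: "hermitian_on k (entries A)"
  shows "(frobenius_norm A)\<^sup>2 = (\<Sum>x\<leftarrow>eig_desc A. x\<^sup>2)"
proof -
  obtain v r where v: "onb k v" and e: "\<forall>a<k. \<forall>b<k. entries A a b = spec k r v a b"
    using ex_spectral_decomposition[OF h] by blast
  have "(frobenius_norm A)\<^sup>2 = (\<Sum>a<k. \<Sum>b<k. (cmod (spec k r v a b - spec k (\<lambda>_. 0) v a b))\<^sup>2)"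
    unfolding frobenius_norm_square[OF A]
  proof (intro sum.cong refl)
    fix a b assume "a \<in> {..<k}" "b \<in> {..<k}"
    then have "entries A a b = spec k r v a b" using e by blast
    then show "(cmod (entries A a b))\<^sup>2 = (cmod (spec k r v a b - spec k (\<lambda>_. 0) v a b))\<^sup>2"
      by (simp add: spec_def[of k "\<lambda>_. 0"])
  qed
  also have "\<dots> = (\<Sum>i<k. (r i)\<^sup>2)" unfolding frobenius_spec_same_basis[OF v] by simp
  also have "\<dots> = (\<Sum>x\<leftarrow>map r [0..<k]. x\<^sup>2)"
    by (simp add: sum_list_distinct_conv_sum_set lessThan_atLeast0 comp_def)
  also have "\<dots> = (\<Sum>x\<leftarrow>eig_desc A. x\<^sup>2)"
  proof -
    have "eig_desc A = desc (map r [0..<k])" by (rule eig_desc_spec[OF A v]) (use e in blast)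
    then show ?thesis by (simp only: sum_list_square_desc)
  qed
  finally show ?thesis .
qed

section \<open>Designs as families of coordinate functions\<close>

definition design_fun :: "design \<Rightarrow> cfam" where
  "design_fun \<Phi> j i = vec_fun (\<Phi> ! j ! i)"

definition list_design :: "nat \<Rightarrow> nat list \<Rightarrow> cfam \<Rightarrow> design" where
  "list_design n d g = map (\<lambda>j. map (\<lambda>i. vec (d ! j) (g j i)) [0..<n]) [0..<length d]"

lemma list_design_nth:
  assumes "j < length d"
  shows "length (list_design n d g ! j) = n"
    and "i < n \<Longrightarrow> list_design n d g ! j ! i = vec (d ! j) (g j i)"
    and "i < n \<Longrightarrow> a < d ! j \<Longrightarrow> design_fun (list_design n d g) j i a = g j i a"
  using assms by (simp_all add: list_design_def design_fun_def vec_fun_def)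

locale target_design =
  fixes \<alpha> :: "real list" and d :: "nat list" and \<Phi>0 :: design
  assumes \<alpha>_pos': "\<forall>i<length \<alpha>. \<alpha> ! i > 0" and \<Phi>0: "\<Phi>0 \<in> d_designs d"
begin

abbreviation B :: cfam where
  "B j \<equiv> entries (design_op d \<Phi>0 j)"

lemma design_op_carrier: "\<Phi> \<in> d_designs d \<Longrightarrow> j < length d \<Longrightarrow> design_op d \<Phi> j \<in> carrier_mat (d ! j) (d ! j)"
  unfolding design_op_def by (rule frame_op_carrier) (simp add: d_designs_def)

lemma B_herm: "j < length d \<Longrightarrow> hermitian_on (d ! j) (B j)"
proof -
  assume j: "j < length d"
  have "B j a b = frm (length (\<Phi>0 ! j)) (\<lambda>i. vec_fun (\<Phi>0 ! j ! i)) a b" if "a < d ! j" "b < d ! j" for a b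
    unfolding design_op_def by (rule frame_op_entries) (use \<Phi>0 j that in \<open>auto simp: d_designs_def\<close>)
  then show "hermitian_on (d ! j) (B j)" by (rule hermitian_on_cong[OF frm_hermitian])
qed

sublocale design_space "length d" "length \<alpha>" "\<lambda>j. d ! j" "\<lambda>i. \<alpha> ! i" B
  by unfold_locales (use B_herm \<alpha>_pos' in auto)

lemma design_op_entries:
  assumes "\<Phi> \<in> ad_designs \<alpha> d" "j < length d" "a < d ! j" "b < d ! j"
  shows "entries (design_op d \<Phi> j) a b = frm (length \<alpha>) (design_fun \<Phi> j) a b"
proof -
  have "set (\<Phi> ! j) \<subseteq> carrier_vec (d ! j)" "length (\<Phi> ! j) = length \<alpha>"
    using assms by (auto simp: ad_designs_def d_designs_def)
  with frame_op_entries[OF this(1) assms(3,4)] show ?thesis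
    by (simp add: design_op_def design_fun_def[abs_def])
qed

lemma design_vec_carrier:
  assumes "\<Phi> \<in> ad_designs \<alpha> d" "j < length d" "i < length \<alpha>"
  shows "\<Phi> ! j ! i \<in> carrier_vec (d ! j)"
proof -
  have "set (\<Phi> ! j) \<subseteq> carrier_vec (d ! j)" "length (\<Phi> ! j) = length \<alpha>"
    using assms by (auto simp: ad_designs_def d_designs_def)
  then show ?thesis using assms(3) nth_mem by fastforce
qed

lemma design_admissible:
  assumes \<Phi>: "\<Phi> \<in> ad_designs \<alpha> d"
  shows "admissible (design_fun \<Phi>)"
  unfolding admissible_def
proof (intro allI impI)
  fix i assume i: "i < length \<alpha>"
  have "weight (design_fun \<Phi>) i = (\<Sum>j<length d. (vnorm (\<Phi> ! j ! i))\<^sup>2)"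
    unfolding weight_def design_fun_def using vnorm_square[OF design_vec_carrier[OF \<Phi> _ i]] by simp
  then show "weight (design_fun \<Phi>) i = \<alpha> ! i" using \<Phi> i by (simp add: ad_designs_def)
qed

abbreviation as_design :: "cfam \<Rightarrow> design" where
  "as_design \<equiv> list_design (length \<alpha>) d"

lemma list_design_in:
  assumes g: "admissible g"
  shows "as_design g \<in> ad_designs \<alpha> d"
proof -
  have "(\<Sum>j<length d. (vnorm (as_design g ! j ! i))\<^sup>2) = \<alpha> ! i" if i: "i < length \<alpha>" for i
  proof -
    have "(\<Sum>j<length d. (vnorm (as_design g ! j ! i))\<^sup>2) = weight g i"
      unfolding weight_def
    proof (rule sum.cong[OF refl])
      fix j assume "j \<in> {..<length d}"
      then have j: "j < length d" by simp
      show "(vnorm (as_design g ! j ! i))\<^sup>2 = Re (ip (d ! j) (g j i) (g j i))"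
        unfolding list_design_nth(2)[OF j i] vnorm_square[OF vec_carrier]
        by (intro arg_cong[of _ _ Re] ip_cong) (simp_all add: vec_fun_def)
    qed
    then show ?thesis using g i by (simp add: admissible_def)
  qed
  then show ?thesis
    by (auto simp: ad_designs_def d_designs_def list_design_def)
qed

lemma Theta_eq_dev:
  assumes \<Phi>: "\<Phi> \<in> ad_designs \<alpha> d"
  shows "Theta d \<Phi>0 \<Phi> = dev (design_fun \<Phi>)"
  unfolding Theta_def dev_def
proof (rule sum.cong[OF refl])
  fix j assume "j \<in> {..<length d}"
  then have j: "j < length d" by simp
  let ?D = "design_op d \<Phi>0 j - design_op d \<Phi> j" and ?E = "\<lambda>a b. frm (length \<alpha>) (design_fun \<Phi> j) a b - B j a b"
  have carr: "design_op d \<Phi>0 j \<in> carrier_mat (d ! j) (d ! j)" "design_op d \<Phi> j \<in> carrier_mat (d ! j) (d ! j)"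
    using design_op_carrier[OF _ j] \<Phi>0 \<Phi> by (auto simp: ad_designs_def)
  have "(frobenius_norm ?D)\<^sup>2
    = (\<Sum>a<d ! j. \<Sum>b<d ! j. (cmod (entries ?D a b))\<^sup>2)"
    by (rule frobenius_norm_square[OF minus_carrier_mat[OF carr(2)]])
  also have "\<dots> = (\<Sum>a<d ! j. \<Sum>b<d ! j. (cmod (?E a b))\<^sup>2)"
  proof (intro sum.cong refl)
    fix a b assume "a \<in> {..<d ! j}" "b \<in> {..<d ! j}"
    then have ab: "a < d ! j" "b < d ! j" by simp_all
    have "entries ?D a b = B j a b - frm (length \<alpha>) (design_fun \<Phi> j) a b"
      unfolding design_op_entries[OF \<Phi> j ab, symmetric] using carr ab by (simp add: entries_def)
    then show "(cmod (entries ?D a b))\<^sup>2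
      = (cmod (?E a b))\<^sup>2" by (simp only: norm_minus_commute)
  qed
  finally show "(frobenius_norm ?D)\<^sup>2
    = (\<Sum>a<d ! j. \<Sum>b<d ! j. (cmod (?E a b))\<^sup>2)" .
qed

lemma dev_list_design: "dev (design_fun (as_design g)) = dev g"
  unfolding dev_def
proof (intro sum.cong refl)
  fix j a b assume "j \<in> {..<length d}" "a \<in> {..<d ! j}" "b \<in> {..<d ! j}"
  then show "(cmod (frm (length \<alpha>) (design_fun (as_design g) j) a b - B j a b))\<^sup>2
    = (cmod (frm (length \<alpha>) (g j) a b - B j a b))\<^sup>2"
    by (simp add: frm_def list_design_nth(3))
qed

lemma local_minimizer_imp_locmin:
  assumes "local_minimizer \<alpha> d (Theta d \<Phi>0) \<Phi>"
  shows "locmin (design_fun \<Phi>)"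
proof -
  let ?n = "length \<alpha>"
  have \<Phi>: "\<Phi> \<in> ad_designs \<alpha> d" using assms by (simp add: local_minimizer_def)
  obtain \<epsilon> where \<epsilon>: "\<epsilon> > 0" and
    min: "\<And>\<Phi>'. \<Phi>' \<in> ad_designs \<alpha> d \<Longrightarrow> design_dist \<alpha> d \<Phi> \<Phi>' < \<epsilon> \<Longrightarrow> Theta d \<Phi>0 \<Phi> \<le> Theta d \<Phi>0 \<Phi>'"
    using assms by (auto simp: local_minimizer_def)
  \<comment> \<open>If all entries differ by less than \<open>\<eta>\<close>, block \<open>j\<close>
    contributes at most \<open>\<eta> * sqrt (?n * d ! j)\<close> to the distance. The 1 added to
    \<open>K\<close> makes the final estimate strict and keeps the quotient defined for
    \<open>K = 0\<close>.\<close>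
  define K where "K = (\<Sum>j<length d. sqrt (?n * d ! j))"
  have K: "K \<ge> 0" by (simp add: K_def sum_nonneg)
  define \<eta> where "\<eta> = \<epsilon> / (1 + K)"
  have \<eta>: "\<eta> > 0" using \<epsilon> K by (simp add: \<eta>_def)
  have "dev (design_fun \<Phi>) \<le> dev g" if g: "admissible g" "close \<eta> (design_fun \<Phi>) g" for g
  proof -
    let ?\<Psi> = "as_design g" and ?\<Delta> = "\<lambda>j i. \<Phi> ! j ! i - as_design g ! j ! i"
    have "design_dist \<alpha> d \<Phi> ?\<Psi> \<le> (\<Sum>j<length d. \<eta> * sqrt (?n * d ! j))"
      unfolding design_dist_def
    proof (rule sum_mono)
      fix j assume "j \<in> {..<length d}"
      then have j: "j < length d" by simp
      have "(\<Sum>i<?n. (vnorm (?\<Delta> j i))\<^sup>2) \<le> (\<Sum>i<?n. \<Sum>a<d ! j. \<eta>\<^sup>2)"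
      proof (rule sum_mono)
        fix i assume "i \<in> {..<?n}"
        then have i: "i < ?n" by simp
        have c: "\<Phi> ! j ! i \<in> carrier_vec (d ! j)" by (rule design_vec_carrier[OF \<Phi> j i])
        then have "?\<Delta> j i \<in> carrier_vec (d ! j)"
          by (simp add: list_design_nth(2)[OF j i])
        from vnorm_square[OF this] have "(vnorm (?\<Delta> j i))\<^sup>2
          = (\<Sum>a<d ! j. (cmod (vec_fun (?\<Delta> j i) a))\<^sup>2)" by (simp only: ip_self Re_complex_of_real)
        also have "\<dots> \<le> (\<Sum>a<d ! j. \<eta>\<^sup>2)"
        proof (rule sum_mono)
          fix a assume "a \<in> {..<d ! j}"
          then have a: "a < d ! j" by simp
          have "cmod (g j i a - design_fun \<Phi> j i a) < \<eta>" using g(2) j i a by (simp add: close_def)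
          moreover have "vec_fun (?\<Delta> j i) a = design_fun \<Phi> j i a - g j i a"
            using c a by (simp add: list_design_nth(2)[OF j i] vec_fun_def design_fun_def)
          ultimately show "(cmod (vec_fun (?\<Delta> j i) a))\<^sup>2 \<le> \<eta>\<^sup>2"
            by (intro power_mono) (simp_all add: norm_minus_commute)
        qed
        finally show "(vnorm (?\<Delta> j i))\<^sup>2 \<le> (\<Sum>a<d ! j. \<eta>\<^sup>2)" .
      qed
      also have "\<dots> = \<eta>\<^sup>2 * (?n * d ! j)" by simp
      finally have "sqrt (\<Sum>i<?n. (vnorm (?\<Delta> j i))\<^sup>2) \<le> sqrt (\<eta>\<^sup>2 * (?n * d ! j))"
        by (rule real_sqrt_le_mono)
      also have "\<dots> = \<eta> * sqrt (?n * d ! j)" using \<eta> by (simp add: real_sqrt_mult)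
      finally show "sqrt (\<Sum>i<?n. (vnorm (?\<Delta> j i))\<^sup>2) \<le> \<eta> * sqrt (?n * d ! j)" .
    qed
    also have "\<dots> = \<eta> * K" by (simp add: K_def sum_distrib_left)
    also have "\<dots> < \<eta> * (1 + K)" using \<eta> by simp
    also have "\<dots> = \<epsilon>" using K by (simp add: \<eta>_def)
    finally have "Theta d \<Phi>0 \<Phi> \<le> Theta d \<Phi>0 ?\<Psi>" by (rule min[OF list_design_in[OF g(1)]])
    then show ?thesis
      unfolding Theta_eq_dev[OF \<Phi>] Theta_eq_dev[OF list_design_in[OF g(1)]] dev_list_design .
  qed
  then show ?thesis
    unfolding locmin_def using design_admissible[OF \<Phi>] \<eta> by blast
qed

abbreviation diff_op :: "design \<Rightarrow> nat \<Rightarrow> complex mat" where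
  "diff_op \<Phi> j \<equiv> design_op d \<Phi>0 j - design_op d \<Phi> j"

lemma difference_hermitian:
  assumes "\<Phi> \<in> ad_designs \<alpha> d" "j < length d"
  shows "hermitian_on (d ! j) (entries (diff_op \<Phi> j))"
proof (rule hermitian_on_cong)
  show "hermitian_on (d ! j) (\<lambda>a b. - res (design_fun \<Phi>) j a b)"
    unfolding hermitian_on_def
  proof (intro allI impI)
    fix a b assume ab: "a < d ! j" "b < d ! j"
    have "res (design_fun \<Phi>) j a b = cnj (res (design_fun \<Phi>) j b a)"
      using res_hermitian[OF assms(2)] ab unfolding hermitian_on_def by blast
    then show "- res (design_fun \<Phi>) j a b = cnj (- res (design_fun \<Phi>) j b a)" by simp
  qed
  fix a b assume ab: "a < d ! j" "b < d ! j"
  have "design_op d \<Phi>0 j \<in> carrier_mat (d ! j) (d ! j)" "design_op d \<Phi> j \<in> carrier_mat (d ! j) (d ! j)"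
    using design_op_carrier[OF _ assms(2)] \<Phi>0 assms(1) by (auto simp: ad_designs_def)
  then show "entries (diff_op \<Phi> j) a b = - res (design_fun \<Phi>) j a b"
    unfolding res_def design_op_entries[OF assms ab, symmetric] using ab by (simp add: entries_def)
qed

end

theorem theorem3p4:
  fixes d :: "nat list" and \<alpha> c :: "real list" and \<Phi>0 :: design
  assumes "length d \<ge> 1" and "length \<alpha> \<ge> 1"
    and "\<forall>j<length d. d ! j \<ge> 1" and "sorted_wrt (\<ge>) d" and "d ! 0 \<le> length \<alpha>"
    and "sorted_wrt (\<ge>) \<alpha>" and "\<forall>i<length \<alpha>. \<alpha> ! i > 0"
    and "\<Phi>0 \<in> d_designs d"
    and "optimal_constants \<alpha> d \<Phi>0 c"
  shows "(delta_sum d \<Phi>0 c \<in> Theta d \<Phi>0 ` ad_designs \<alpha> d \<and>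
          (\<forall>t \<in> Theta d \<Phi>0 ` ad_designs \<alpha> d. delta_sum d \<Phi>0 c \<le> t)) \<and>
    (\<forall>\<Phi> \<in> ad_designs \<alpha> d.
       (Theta d \<Phi>0 \<Phi> = delta_sum d \<Phi>0 c \<longleftrightarrow>
         (\<forall>j<length d. eig_desc (design_op d \<Phi>0 j - design_op d \<Phi> j) = desc (delta d \<Phi>0 c j))) \<and>
       (Theta d \<Phi>0 \<Phi> = delta_sum d \<Phi>0 c \<longrightarrow>
         (\<forall>j<length d. \<exists>v. orthonormal_basis (d ! j) v \<and>
            design_op d \<Phi>0 j = spectral_sum (d ! j) (lam d \<Phi>0 j) v \<and>
            design_op d \<Phi> j =
              spectral_sum (d ! j)
                (map (\<lambda>i. lam d \<Phi>0 j ! i - delta d \<Phi>0 c j ! i) [0..<d ! j]) v))) \<and>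
    (\<forall>\<Phi>. local_minimizer \<alpha> d (Theta d \<Phi>0) \<Phi> \<longrightarrow> global_minimizer \<alpha> d (Theta d \<Phi>0) \<Phi>)"
proof -
  interpret target_design \<alpha> d \<Phi>0 by unfold_locales fact+
  let ?m = "length d" and ?n = "length \<alpha>" and ?M = "Mbound d \<Phi>0"
  have d_le: "d ! j \<le> d ! 0" if "j < ?m" for j
    using assms(4) that by (cases "j = 0") (auto simp: sorted_wrt_iff_nth_less)
  then have dn: "d ! j \<le> ?n" if "j < ?m" for j using assms(5) that by fastforce
  have d0: "d ! 0 \<ge> 1" using assms(1,3) by fastforce
  have "\<exists>v r. onb (d ! j) v \<and> (\<forall>i l. i \<le> l \<longrightarrow> l < d ! j \<longrightarrow> r l \<le> r i) \<and>
     (\<forall>a<d ! j. \<forall>b<d ! j. B j a b = spec (d ! j) r v a b)" if "j < ?m" for j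
    by (rule ex_spectral_decomposition[OF B_herm[OF that]])
  then obtain x \<kappa> where x: "\<And>j. j < ?m \<Longrightarrow> onb (d ! j) (x j)"
    and \<kappa>: "\<And>j i l. j < ?m \<Longrightarrow> i \<le> l \<Longrightarrow> l < d ! j \<Longrightarrow> \<kappa> j l \<le> \<kappa> j i"
    and Bx: "\<And>j a b. j < ?m \<Longrightarrow> a < d ! j \<Longrightarrow> b < d ! j \<Longrightarrow> B j a b = spec (d ! j) (\<kappa> j) (x j) a b" by metis
  have lam: "lam d \<Phi>0 j = map (\<kappa> j) [0..<d ! j]" if j: "j < ?m" for j
  proof -
    have "lam d \<Phi>0 j = desc (map (\<kappa> j) [0..<d ! j])"
      unfolding lam_def by (rule eig_desc_spec[OF design_op_carrier[OF \<Phi>0 j] x[OF j] Bx[OF j]])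
    then show ?thesis using \<kappa>[OF j] by (simp add: desc_eq_self sorted_wrt_map_upt)
  qed
  have lt_nth: "lam_tilde d \<Phi>0 j ! i = ?M - \<kappa> j i" if "j < ?m" "i < d ! j" for j i
    using lam[OF that(1)] that(2) by (simp add: lam_tilde_def)
  have lt_inc: "lam_tilde d \<Phi>0 j ! i \<le> lam_tilde d \<Phi>0 j ! l" if "j < ?m" "i \<le> l" "l < d ! j" for j i l
    using lt_nth[of j i] lt_nth[of j l] \<kappa>[OF that] that by simp
  \<comment> \<open>As \<open>lam_tilde\<close> is \<open>?M\<close> minus the spectrum
    \<open>\<kappa>\<close>, subtracting \<open>?M\<close> from the constants turns the water levels
    above \<open>lam_tilde\<close> into \<open>fill C (\<kappa> j)\<close>. The \<open>min\<close>
    continues \<open>c\<close> by its last entry up to index \<open>?n\<close>.\<close>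
  define C where "C i = c ! min i (d ! 0 - 1) - ?M" for i
  define W where "W i = (\<Sum>j<?m. if i < d ! j then fill C (\<kappa> j) i else 0)" for i
  have W: "(\<Sum>j<?m. if i < d ! j then max (c ! i - lam_tilde d \<Phi>0 j ! i) 0 else 0) = W i" for i
    unfolding W_def
  proof (intro sum.cong refl if_cong)
    fix j assume "j \<in> {..<?m}" "i < d ! j"
    then have ij: "j < ?m" "i < d ! j" by simp_all
    then have "min i (d ! 0 - 1) = i" using d_le[of j] by simp
    then show "max (c ! i - lam_tilde d \<Phi>0 j ! i) 0 = fill C (\<kappa> j) i"
      using lt_nth[OF ij] by (simp add: fill_def C_def)
  qed
  have C_dec: "C l \<le> C i" if "i \<le> l" "l < ?n" for i l
    unfolding C_def
    by (intro diff_right_mono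
      optimal_constants_prefix_sums(1)[OF assms(9,5) d0 d_le assms(6,7) lt_inc that(1)])
  have prefix: "(\<Sum>i<l. \<alpha> ! i) \<le> (\<Sum>i<l. W i)" if "l \<le> ?n" for l
    unfolding W[symmetric]
    by (rule optimal_constants_prefix_sums(2)[OF assms(9,5) d0 d_le assms(6,7) lt_inc that])
  have total: "(\<Sum>i<?n. \<alpha> ! i) = (\<Sum>i<?n. W i)"
    unfolding W[symmetric]
    by (rule optimal_constants_prefix_sums(3)[OF assms(9,5) d0 d_le assms(6,7) lt_inc])
  have weighted: "(\<Sum>i<?n. c ! min i (d ! 0 - 1) * W i) = (\<Sum>i<?n. c ! min i (d ! 0 - 1) * \<alpha> ! i)"
    unfolding W[symmetric]
    by (rule optimal_constants_prefix_sums(4)[OF assms(9,5) d0 d_le assms(6,7) lt_inc])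
  have "(\<Sum>j<?m. \<Sum>i<d ! j. C i * fill C (\<kappa> j) i)
    = (\<Sum>j<?m. \<Sum>i<?n. C i * (if i < d ! j then fill C (\<kappa> j) i else 0))"
    using dn by (intro sum.cong refl sum.mono_neutral_cong_left) auto
  also have "\<dots> = (\<Sum>i<?n. C i * W i)"
    unfolding W_def sum_distrib_left by (rule sum.swap)
  also have "\<dots> = (\<Sum>i<?n. c ! min i (d ! 0 - 1) * W i) - ?M * (\<Sum>i<?n. W i)"
    by (simp add: C_def left_diff_distrib sum_subtractf sum_distrib_left)
  \<comment> \<open>The shift by \<open>?M\<close> is harmless because \<open>W\<close> and
    \<open>\<alpha>\<close> have the same total.\<close>
  also have "\<dots> = (\<Sum>i<?n. c ! min i (d ! 0 - 1) * \<alpha> ! i) - ?M * (\<Sum>i<?n. \<alpha> ! i)"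
    unfolding weighted total ..
  also have "\<dots> = (\<Sum>i<?n. C i * \<alpha> ! i)"
    by (simp add: C_def left_diff_distrib sum_subtractf sum_distrib_left)
  finally have tot: "(\<Sum>j<?m. \<Sum>i<d ! j. C i * fill C (\<kappa> j) i) = (\<Sum>i<?n. C i * \<alpha> ! i)" .
  have id: "bij_betw (\<lambda>i. i) {..<?n} {..<?n}" by (simp add: bij_betw_def)
  interpret kkt ?m ?n "\<lambda>j. d ! j" "\<lambda>i. \<alpha> ! i" B "\<lambda>i. i" C x \<kappa>
    by unfold_locales (fact dn id C_dec x \<kappa> Bx tot)+
  \<comment> \<open>Entrywise, \<open>?M - max (c ! i) (?M - \<kappa> j i)\<close> equals
    \<open>\<kappa> j i - max (C i + \<kappa> j i) 0\<close>.\<close>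
  have delta: "delta d \<Phi>0 c j = map (\<lambda>i. \<kappa> j i - \<mu> j i) [0..<d ! j]" if j: "j < ?m" for j
  proof (rule nth_equalityI)
    fix i assume "i < length (delta d \<Phi>0 c j)"
    then have i: "i < d ! j" by (simp add: delta_def nu_tilde_def)
    then have "min i (d ! 0 - 1) = i" using d_le[OF j] by simp
    then show "delta d \<Phi>0 c j ! i = map (\<lambda>i. \<kappa> j i - \<mu> j i) [0..<d ! j] ! i"
      using i lt_nth[OF j i] by (simp add: delta_def nu_tilde_def fill_def C_def)
  qed (simp add: delta_def nu_tilde_def)
  have sum_delta: "(\<Sum>y\<leftarrow>delta d \<Phi>0 c j. y\<^sup>2) = (\<Sum>i<d ! j. (\<mu> j i - \<kappa> j i)\<^sup>2)" if j: "j < ?m" for j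
    unfolding delta[OF j]
    by (simp add: sum_list_distinct_conv_sum_set lessThan_atLeast0 comp_def power2_commute)
  have delta_sum: "delta_sum d \<Phi>0 c = opt"
    unfolding delta_sum_def opt_def using sum_delta by (intro sum.cong refl) (simp add: sum_nonneg)
  have bound: "delta_sum d \<Phi>0 c \<le> Theta d \<Phi>0 \<Phi>" if \<Phi>: "\<Phi> \<in> ad_designs \<alpha> d" for \<Phi>
    unfolding delta_sum Theta_eq_dev[OF \<Phi>] by (rule opt_le_dev[OF design_admissible[OF \<Phi>]])
  have carr: "design_op d \<Phi>0 j \<in> carrier_mat (d ! j) (d ! j)" if "j < ?m" for j
    by (rule design_op_carrier[OF \<Phi>0 that])
  have carr': "design_op d \<Phi> j \<in> carrier_mat (d ! j) (d ! j)" if "\<Phi> \<in> ad_designs \<alpha> d" "j < ?m" for \<Phi> j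
    using that by (intro design_op_carrier) (auto simp: ad_designs_def)
  have attained: "delta_sum d \<Phi>0 c \<in> Theta d \<Phi>0 ` ad_designs \<alpha> d"
  proof -
    have \<alpha>_dec: "\<alpha> ! l \<le> \<alpha> ! i" if "i \<le> l" "l < ?n" for i l
      using assms(6) that by (cases "i = l") (auto simp: sorted_wrt_iff_nth_less)
    have \<mu>0: "0 \<le> \<mu> j i" if "j < ?m" "i < d ! j" for j i by (simp add: fill_def)
    have "\<exists>g. admissible g \<and> (\<forall>j<?m. \<forall>a b. frm ?n (g j) a b = spec (d ! j) (\<mu> j) (x j) a b)"
      by (rule ex_admissible_spec) (fact dn x \<mu>0 \<alpha>_dec prefix[unfolded W_def] total[unfolded W_def])+
    then obtain g where g: "admissible g"
      and frm_g: "\<forall>j<?m. \<forall>a b. frm ?n (g j) a b = spec (d ! j) (\<mu> j) (x j) a b" by blast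
    have "Theta d \<Phi>0 (as_design g) = dev g"
      unfolding Theta_eq_dev[OF list_design_in[OF g]] by (rule dev_list_design)
    also have "dev g = delta_sum d \<Phi>0 c"
      unfolding delta_sum by (rule dev_eq_opt) (simp add: frm_g)
    finally show ?thesis using list_design_in[OF g] by (metis image_eqI)
  qed
  \<comment> \<open>The prescribed spectra fix the Frobenius norm of every block, so the value is
    attained without any information on eigenvectors.\<close>
  have eig_only_if: "Theta d \<Phi>0 \<Phi> = delta_sum d \<Phi>0 c"
    if \<Phi>: "\<Phi> \<in> ad_designs \<alpha> d"
      and eig: "\<forall>j<?m. eig_desc (diff_op \<Phi> j) = desc (delta d \<Phi>0 c j)" for \<Phi>
    unfolding Theta_def delta_sum opt_def
  proof (rule sum.cong[OF refl])
    fix j assume "j \<in> {..<?m}"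
    then have j: "j < ?m" by simp
    have "(frobenius_norm (diff_op \<Phi> j))\<^sup>2
      = (\<Sum>y\<leftarrow>eig_desc (diff_op \<Phi> j). y\<^sup>2)"
      by (rule frobenius_norm_square_eig[OF minus_carrier_mat[OF carr'[OF \<Phi> j]] difference_hermitian[OF \<Phi> j]])
    then show "(frobenius_norm (diff_op \<Phi> j))\<^sup>2 = (\<Sum>i<d ! j. (\<mu> j i - \<kappa> j i)\<^sup>2)"
      using eig j by (simp add: sum_list_square_desc sum_delta)
  qed
  have eig_if: "eig_desc (diff_op \<Phi> j) = desc (delta d \<Phi>0 c j)" and spectral: "\<exists>v. orthonormal_basis (d ! j) v \<and>
      design_op d \<Phi>0 j = spectral_sum (d ! j) (lam d \<Phi>0 j) v \<and>
      design_op d \<Phi> j = spectral_sum (d ! j)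
        (map (\<lambda>i. lam d \<Phi>0 j ! i - delta d \<Phi>0 c j ! i) [0..<d ! j]) v" (is "\<exists>v. ?P v")
    if \<Phi>: "\<Phi> \<in> ad_designs \<alpha> d" and eq: "Theta d \<Phi>0 \<Phi> = delta_sum d \<Phi>0 c" and j: "j < ?m" for \<Phi> j
  proof -
    obtain w where w: "onb (d ! j) w"
      and S: "\<And>a b. a < d ! j \<Longrightarrow> b < d ! j \<Longrightarrow> entries (design_op d \<Phi> j) a b = spec (d ! j) (\<mu> j) w a b"
      and S0: "\<And>a b. a < d ! j \<Longrightarrow> b < d ! j \<Longrightarrow> B j a b = spec (d ! j) (\<kappa> j) w a b"
      using optimal_imp_joint_basis[OF design_admissible[OF \<Phi>] _ j] eq design_op_entries[OF \<Phi> j]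
      unfolding delta_sum Theta_eq_dev[OF \<Phi>] by auto
    show "eig_desc (diff_op \<Phi> j) = desc (delta d \<Phi>0 c j)"
      unfolding delta[OF j]
    proof (rule eig_desc_spec[OF minus_carrier_mat[OF carr'[OF \<Phi> j]] w])
      fix a b assume ab: "a < d ! j" "b < d ! j"
      have "entries (diff_op \<Phi> j) a b = B j a b - entries (design_op d \<Phi> j) a b"
        using carr[OF j] carr'[OF \<Phi> j] ab by (simp add: entries_def)
      then show "entries (diff_op \<Phi> j) a b = spec (d ! j) (\<lambda>i. \<kappa> j i - \<mu> j i) w a b"
        unfolding S[OF ab] S0[OF ab] spec_diff .
    qed
    have "design_op d \<Phi>0 j = spectral_sum (d ! j) (lam d \<Phi>0 j) (map (\<lambda>i. vec (d ! j) (w i)) [0..<d ! j])"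
      by (rule eq_mat_by_entries[OF carr[OF j] spectral_sum_carrier], unfold spectral_sum_entries S0)
        (rule spec_cong, simp add: lam[OF j])
    moreover have "design_op d \<Phi> j = spectral_sum (d ! j)
        (map (\<lambda>i. lam d \<Phi>0 j ! i - delta d \<Phi>0 c j ! i) [0..<d ! j]) (map (\<lambda>i. vec (d ! j) (w i)) [0..<d ! j])"
      by (rule eq_mat_by_entries[OF carr'[OF \<Phi> j] spectral_sum_carrier], unfold spectral_sum_entries S)
        (rule spec_cong, simp add: lam[OF j] delta[OF j])
    ultimately show "\<exists>v. ?P v"
      using onb_imp_orthonormal_basis[OF w] by blast
  qed
  have local_global: "global_minimizer \<alpha> d (Theta d \<Phi>0) \<Phi>"
    if loc: "local_minimizer \<alpha> d (Theta d \<Phi>0) \<Phi>" for \<Phi>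
  proof -
    have \<Phi>: "\<Phi> \<in> ad_designs \<alpha> d" using loc by (simp add: local_minimizer_def)
    have "Theta d \<Phi>0 \<Phi> \<le> Theta d \<Phi>0 \<Phi>'" if \<Phi>': "\<Phi>' \<in> ad_designs \<alpha> d" for \<Phi>'
      unfolding Theta_eq_dev[OF \<Phi>] Theta_eq_dev[OF \<Phi>']
      by (rule locmin_imp_global[OF local_minimizer_imp_locmin[OF loc] dn design_admissible[OF \<Phi>']])
    with \<Phi> show ?thesis by (simp add: global_minimizer_def)
  qed
  show ?thesis
  proof (intro conjI ballI allI impI)
    fix t assume "t \<in> Theta d \<Phi>0 ` ad_designs \<alpha> d"
    then show "delta_sum d \<Phi>0 c \<le> t" using bound by blast
  next
    fix \<Phi> assume \<Phi>: "\<Phi> \<in> ad_designs \<alpha> d"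
    show "(Theta d \<Phi>0 \<Phi> = delta_sum d \<Phi>0 c) =
      (\<forall>j<?m. eig_desc (diff_op \<Phi> j) = desc (delta d \<Phi>0 c j))"
      using eig_if[OF \<Phi>] eig_only_if[OF \<Phi>] by blast
  qed (fact attained spectral local_global)+
qed

end
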